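(* There is a function $C(k)$, defined for integers $k\ge 3$ and satisfying $$C(k) = \exp\big(4k \log\log k + k \log\log\log k + O(k)\big)$$ (with an absolute implied constant), such that for every fixed integer $k \ge 3$, as $q \to \infty$ through the positive integers, $$\frac{1}{\phi(q)} \sum_{\substack{\chi \bmod q\\ \chi \ne \chi_0}} M(\chi)^{2k} \le \big(C(k) + o(1)\big)\, q^k ,$$ where, for each fixed $k$, the $o(1)$ term tends to $0$ as $q\to\infty$.
   Context: For a Dirichlet character $\chi$ modulo $q$, let $S_\chi(t) = \sum_{1\le n \le t}\chi(n)$ and $M(\chi) = \max_{t} |S_\chi(t)|$. The sum runs over all nonprincipal Dirichlet characters modulo $q$; $\chi_0$ denotes the principal character modulo $q$ and $\phi$ is Euler's function. *)

theory Defs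
  imports Complex_Main "HOL-Number_Theory.Number_Theory"
begin

definition dirichlet_char :: "nat \<Rightarrow> (nat \<Rightarrow> complex) \<Rightarrow> bool" where
  "dirichlet_char q \<chi> \<longleftrightarrow>
     q > 0 \<and>
     (\<forall>n. \<chi> (n + q) = \<chi> n) \<and>
     (\<forall>m n. \<chi> (m * n) = \<chi> m * \<chi> n) \<and>
     (\<forall>n. \<chi> n \<noteq> 0 \<longleftrightarrow> coprime n q)"

definition principal_char :: "nat \<Rightarrow> nat \<Rightarrow> complex" where
  "principal_char q n = (if coprime n q then 1 else 0)"

definition nonprincipal_chars :: "nat \<Rightarrow> (nat \<Rightarrow> complex) set" where
  "nonprincipal_chars q = {\<chi>. dirichlet_char q \<chi> \<and> \<chi> \<noteq> principal_char q}"

definition char_sum :: "(nat \<Rightarrow> complex) \<Rightarrow> real \<Rightarrow> complex" where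
  "char_sum \<chi> t = (\<Sum>n | 1 \<le> n \<and> real n \<le> t. \<chi> n)"

text \<open>The maximum is over an infinite index set, but for a nonprincipal character only
  finitely many values occur: see \<open>finite_range_norm_char_sum\<close> below. Likewise
  \<open>finite_nonprincipal_chars\<close> ensures that sums over all nonprincipal characters are
  genuine finite sums.\<close>

definition max_char_sum :: "(nat \<Rightarrow> complex) \<Rightarrow> real" where
  "max_char_sum \<chi> = Max (range (\<lambda>t. norm (char_sum \<chi> t)))"

lemma dirichlet_char_1: "dirichlet_char q \<chi> \<Longrightarrow> \<chi> 1 = 1"
proof -
  assume a: "dirichlet_char q \<chi>"
  have "\<chi> (1 * 1) = \<chi> 1 * \<chi> 1" "\<chi> 1 \<noteq> 0"
    using a unfolding dirichlet_char_def by (blast, simp)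
  thus ?thesis by simp
qed

lemma dirichlet_char_mod:
  assumes "dirichlet_char q \<chi>"
  shows "\<chi> (n mod q) = \<chi> n"
proof -
  have "\<chi> (m + k * q) = \<chi> m" for m k
  proof (induction k)
    case (Suc k)
    have "\<chi> ((m + k * q) + q) = \<chi> (m + k * q)"
      using assms unfolding dirichlet_char_def by blast
    with Suc show ?case by (simp add: algebra_simps)
  qed simp
  from this[of "n mod q" "n div q"] show ?thesis by simp
qed

lemma dirichlet_char_power:
  assumes "dirichlet_char q \<chi>"
  shows "\<chi> (n ^ k) = \<chi> n ^ k"
proof (induction k)
  case 0
  show ?case using dirichlet_char_1[OF assms] by simp
next
  case (Suc k)
  thus ?case using assms by (simp add: dirichlet_char_def)
qed

lemma dirichlet_char_cong:
  assumes "dirichlet_char q \<chi>" "[m = n] (mod q)"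
  shows "\<chi> m = \<chi> n"
  using dirichlet_char_mod[OF assms(1), of m] dirichlet_char_mod[OF assms(1), of n] assms(2)
  by (simp add: cong_def)

lemma dirichlet_char_power_totient:
  assumes "dirichlet_char q \<chi>" "coprime n q"
  shows "\<chi> n ^ totient q = 1"
proof -
  have "\<chi> (n ^ totient q) = \<chi> 1"
    by (rule dirichlet_char_cong[OF assms(1) euler_theorem[OF assms(2)]])
  thus ?thesis using dirichlet_char_power[OF assms(1)] dirichlet_char_1[OF assms(1)] by simp
qed

lemma finite_dirichlet_chars: "finite {\<chi>. dirichlet_char q \<chi>}"
proof (cases "q = 0")
  case True
  thus ?thesis by (simp add: dirichlet_char_def)
next
  case False
  define V :: "complex set" where "V = insert 0 {z. z ^ totient q = 1}"
  have "totient q > 0" using False by simp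
  hence "finite {z :: complex. z ^ totient q = 1}" by (intro finite_roots_unity) linarith
  hence "finite V" by (simp add: V_def)
  hence fin: "finite (PiE {..<q} (\<lambda>_. V))" by (intro finite_PiE) auto
  have "inj_on (\<lambda>\<chi>. restrict \<chi> {..<q}) {\<chi>. dirichlet_char q \<chi>}"
  proof (rule inj_onI, rule ext)
    fix \<chi> \<psi> and n :: nat
    assume a: "\<chi> \<in> {\<chi>. dirichlet_char q \<chi>}" "\<psi> \<in> {\<chi>. dirichlet_char q \<chi>}"
      and eq: "restrict \<chi> {..<q} = restrict \<psi> {..<q}"
    have "\<chi> (n mod q) = \<psi> (n mod q)"
      using fun_cong[OF eq, of "n mod q"] False by simp
    thus "\<chi> n = \<psi> n" using a by (simp add: dirichlet_char_mod[of q \<chi>] dirichlet_char_mod[of q \<psi>])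
  qed
  moreover have "(\<lambda>\<chi>. restrict \<chi> {..<q}) ` {\<chi>. dirichlet_char q \<chi>} \<subseteq> PiE {..<q} (\<lambda>_. V)"
  proof (rule image_subsetI)
    fix \<chi> assume "\<chi> \<in> {\<chi>. dirichlet_char q \<chi>}"
    hence d: "dirichlet_char q \<chi>" by simp
    have "\<chi> n \<in> V" for n
    proof (cases "coprime n q")
      case True
      thus ?thesis using dirichlet_char_power_totient[OF d] by (simp add: V_def)
    next
      case False
      thus ?thesis using d unfolding dirichlet_char_def V_def by blast
    qed
    thus "restrict \<chi> {..<q} \<in> PiE {..<q} (\<lambda>_. V)" by auto
  qed
  ultimately show ?thesis using fin by (meson finite_imageD finite_subset)
qed

lemma finite_nonprincipal_chars: "finite (nonprincipal_chars q)"
  by (rule finite_subset[OF _ finite_dirichlet_chars[of q]]) (auto simp: nonprincipal_chars_def)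

lemma sum_full_period_eq_0:
  assumes "\<chi> \<in> nonprincipal_chars q"
  shows "(\<Sum>n<q. \<chi> n) = 0"
proof -
  have d: "dirichlet_char q \<chi>" and np: "\<chi> \<noteq> principal_char q"
    using assms by (auto simp: nonprincipal_chars_def)
  have q: "q > 0" using d by (simp add: dirichlet_char_def)
  obtain a where a: "\<chi> a \<noteq> principal_char q a" using np by blast
  have cop: "coprime a q"
  proof (rule ccontr)
    assume "\<not> coprime a q"
    moreover from this have "\<chi> a = 0" using d unfolding dirichlet_char_def by blast
    ultimately show False using a by (simp add: principal_char_def)
  qed
  hence a1: "\<chi> a \<noteq> 1" using a by (simp add: principal_char_def)
  have inj: "inj_on (\<lambda>n. (a * n) mod q) {..<q}"
  proof (rule inj_onI)
    fix x y assume xy: "x \<in> {..<q}" "y \<in> {..<q}" "(a * x) mod q = (a * y) mod q"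
    hence "[a * x = a * y] (mod q)" by (simp add: cong_def)
    hence "[x = y] (mod q)" using cop cong_mult_lcancel_nat by blast
    thus "x = y" using xy by (simp add: cong_def)
  qed
  have img: "(\<lambda>n. (a * n) mod q) ` {..<q} = {..<q}"
    by (rule endo_inj_surj[OF _ _ inj]) (use q in auto)
  have "(\<Sum>n<q. \<chi> n) = (\<Sum>n<q. \<chi> ((a * n) mod q))"
    using sum.reindex[OF inj, of \<chi>] img by (simp add: o_def)
  also have "\<dots> = \<chi> a * (\<Sum>n<q. \<chi> n)"
  proof -
    have "\<chi> ((a * n) mod q) = \<chi> a * \<chi> n" for n
      using dirichlet_char_mod[OF d] d unfolding dirichlet_char_def by metis
    thus ?thesis by (simp add: sum_distrib_left)
  qed
  finally have "(1 - \<chi> a) * (\<Sum>n<q. \<chi> n) = 0" by (simp add: algebra_simps)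
  thus ?thesis using a1 by simp
qed

lemma finite_range_norm_char_sum:
  assumes "\<chi> \<in> nonprincipal_chars q"
  shows "finite (range (\<lambda>t. norm (char_sum \<chi> t)))"
proof -
  have d: "dirichlet_char q \<chi>" using assms by (auto simp: nonprincipal_chars_def)
  hence q: "q > 0" by (simp add: dirichlet_char_def)
  define F where "F m = (\<Sum>n<m. \<chi> n)" for m
  have add: "F (m + q) = F m" for m
  proof (induction m)
    case 0
    show ?case using sum_full_period_eq_0[OF assms] by (simp add: F_def)
  next
    case (Suc m)
    have "\<chi> (m + q) = \<chi> m" using d by (simp add: dirichlet_char_def)
    with Suc show ?case by (simp add: F_def)
  qed
  have "F (m + k * q) = F m" for m k
  proof (induction k)
    case (Suc k)
    with add[of "m + k * q"] show ?case by (simp add: algebra_simps)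
  qed simp
  from this[of "m mod q" "m div q" for m] have F_mod: "F m = F (m mod q)" for m by simp
  have "char_sum \<chi> t \<in> insert 0 ((\<lambda>z. z - \<chi> 0) ` F ` {..<q})" for t
  proof (cases "t < 0")
    case True
    hence no: "\<not> (1 \<le> n \<and> real n \<le> t)" for n by linarith
    have "char_sum \<chi> t = 0" by (simp only: char_sum_def no) simp
    thus ?thesis by simp
  next
    case False
    have eq: "{n. 1 \<le> n \<and> real n \<le> t} = {..<Suc (nat \<lfloor>t\<rfloor>)} - {0}"
      using False by (auto simp: less_Suc_eq_le le_nat_iff le_floor_iff)
    have "char_sum \<chi> t = F (Suc (nat \<lfloor>t\<rfloor>)) - \<chi> 0"
      unfolding char_sum_def eq F_def by (subst sum_diff1) auto
    also have "\<dots> = F (Suc (nat \<lfloor>t\<rfloor>) mod q) - \<chi> 0" by (subst F_mod) simp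
    finally show ?thesis using q by auto
  qed
  hence "range (char_sum \<chi>) \<subseteq> insert 0 ((\<lambda>z. z - \<chi> 0) ` F ` {..<q})" by blast
  hence "finite (range (char_sum \<chi>))" by (rule finite_subset) simp
  hence "finite (norm ` range (char_sum \<chi>))" by (rule finite_imageI)
  thus ?thesis by (simp add: image_image)
qed

end

theory Submission
  imports Defs "HOL-Analysis.Convex" "HOL-Real_Asymp.Real_Asymp"
begin

text \<open>
  For a primitive character, averaging the sum over \<open>H\<close> translates and expanding by Gauss sums
  bounds \<open>M(\<chi>)\<close>, up to \<open>O(\<surd>q)\<close>, by \<open>\<surd>q\<close> times the maximum over \<open>\<alpha>\<close> of
  \<open>\<bar>\<Sum>h\<le>N. v h * \<chi> h * e(h \<alpha>)\<bar>\<close> with \<open>\<bar>v h\<bar> \<le> 1 / h\<close>, where \<open>N = q\<^bsup>0.55\<^esup>\<close> suffices because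
  the averaging damps the high frequencies. Write \<open>h = a b\<close> with \<open>a\<close> composed of primes up to
  \<open>y = 16\<^sup>l\<close>, where \<open>k \<le> 2\<^sup>l\<close>, and \<open>b\<close> of larger primes. The smooth part costs
  \<open>\<Sum> 1 / a = O(l\<^sup>2)\<close>, by Chebyshev's bound for primes in dyadic intervals. The terms \<open>b = 1\<close> are
  bounded trivially. The \<open>b > 1\<close> are cut into blocks \<open>16\<^sup>j < b \<le> 16\<^sup>j\<^sup>+\<^sup>1\<close>; on a block \<open>\<alpha>\<close> is
  restricted to a net of \<open>32\<^sup>j\<close> points, and the moments at a fixed point are estimated by Bessel's
  inequality for the characters modulo \<open>q\<close>: the diagonal terms are under control because a number
  \<open>m\<close> without prime factors up to \<open>y\<close> has at most \<open>m\<^bsup>1/4\<^esup>\<close> ordered factorizations into \<open>k\<close> factors.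
  Blocks with \<open>16\<^bsup>(j+1)k\<^esup> \<le> q\<close> are treated with the \<open>2k\<close>-th moment; on the others the fourth
  moment already saves a power of \<open>q\<close>. This gives \<open>O(log k)\<^bsup>4k\<^esup> \<phi>(q) q\<^sup>k\<close> for primitive characters,
  which is stronger than needed by the factor \<open>(log log k)\<^sup>k\<close>. Passing from \<open>\<chi>\<close> modulo \<open>q\<close> to the
  primitive character modulo \<open>d\<close> inducing it costs \<open>2\<close> for each prime dividing \<open>q / d\<close>, which the
  factor \<open>(d / q)\<^sup>k\<close> absorbs.
\<close>

section \<open>Bessel's inequality for Dirichlet characters\<close>

text \<open>The length at which a character sum is largest depends on the character, and so does the
  frequency \<alpha>; a mean value estimate over characters works only at a common frequency. Each
  block therefore gets its own net, and this is affordable because the moment of a block decays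
  faster than its net grows. The decay rests on roughness: the number of ways to write m as an
  r-fold product is controlled by m^(1/4) once all primes of m are at least r^4. Base 16 keeps these
  powers integral, since r <= 2^l gives r^4 <= 16^l, and m <= 16^n gives at most 2^n factorizations.
  The blocks are recombined by Jensen's inequality with weights 1/(a j^2), where a is the smooth
  part and j the block. Their total is O(l^2), and its 2k-th power l^(4k) is the source of the
  exponent 4k log log k. The size of k matters when the net is paid for (32 <= 4^k) and when the
  contributions of the conductors q/e, proportional to e^(-k/2), are summed.\<close>

lemma dirichlet_char_mult: "dirichlet_char q \<chi> \<Longrightarrow> \<chi> (m * n) = \<chi> m * \<chi> n"
  unfolding dirichlet_char_def by blast

lemma dirichlet_char_eq_0_iff: "dirichlet_char q \<chi> \<Longrightarrow> \<chi> n = 0 \<longleftrightarrow> \<not> coprime n q"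
  unfolding dirichlet_char_def by blast

lemma dirichlet_char_pos: "dirichlet_char q \<chi> \<Longrightarrow> q > 0"
  unfolding dirichlet_char_def by blast

lemma norm_dirichlet_char:
  assumes "dirichlet_char q \<chi>"
  shows "norm (\<chi> n) = (if coprime n q then 1 else 0)"
proof (cases "coprime n q")
  case True
  have "norm (\<chi> n) ^ totient q = 1"
    using dirichlet_char_power_totient[OF assms True] by (metis norm_one norm_power)
  moreover have "totient q > 0" using dirichlet_char_pos[OF assms] by simp
  ultimately have "norm (\<chi> n) = 1"
    using power_eq_imp_eq_base[of "norm (\<chi> n)" "totient q" 1] by simp
  thus ?thesis using True by simp
qed (use dirichlet_char_eq_0_iff[OF assms] in simp)

lemma norm_dirichlet_char_le_1: "dirichlet_char q \<chi> \<Longrightarrow> norm (\<chi> n) \<le> 1"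
  by (simp add: norm_dirichlet_char)

lemma dirichlet_char_mult_cnj:
  assumes "dirichlet_char q \<chi>" "dirichlet_char q \<psi>"
  shows "dirichlet_char q (\<lambda>n. \<chi> n * cnj (\<psi> n))"
  using assms unfolding dirichlet_char_def by (auto simp: mult_ac)

lemma dirichlet_char_cnj:
  assumes "dirichlet_char q \<chi>"
  shows "dirichlet_char q (\<lambda>n. cnj (\<chi> n))"
  using assms unfolding dirichlet_char_def by auto

lemma dirichlet_char_cnj_mult_self:
  assumes "dirichlet_char q \<chi>"
  shows "\<chi> n * cnj (\<chi> n) = (if coprime n q then 1 else 0)"
  using norm_dirichlet_char[OF assms, of n] by (simp flip: complex_norm_square)

text \<open>The product of \<open>\<chi>\<close> with the conjugate of \<open>\<psi>\<close> is
  again a character, and it is principal only if the two agree.\<close>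

lemma dirichlet_char_orthogonality:
  assumes \<chi>: "dirichlet_char q \<chi>" and \<psi>: "dirichlet_char q \<psi>" and ne: "\<chi> \<noteq> \<psi>"
  shows "(\<Sum>n<q. \<chi> n * cnj (\<psi> n)) = 0"
proof (rule sum_full_period_eq_0)
  have "(\<lambda>n. \<chi> n * cnj (\<psi> n)) \<noteq> principal_char q"
  proof
    assume eq: "(\<lambda>n. \<chi> n * cnj (\<psi> n)) = principal_char q"
    have "\<chi> n = \<psi> n" for n
    proof (cases "coprime n q")
      case True
      have "\<chi> n * cnj (\<psi> n) * \<psi> n = \<psi> n"
        using True fun_cong[OF eq, of n] by (simp add: principal_char_def)
      moreover have "cnj (\<psi> n) * \<psi> n = 1"
        using dirichlet_char_cnj_mult_self[OF \<psi>, of n] True by (simp add: mult.commute)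
      ultimately show ?thesis by (simp add: mult.assoc)
    next
      case False
      thus ?thesis
        using dirichlet_char_eq_0_iff[OF \<chi>, of n] dirichlet_char_eq_0_iff[OF \<psi>, of n] by simp
    qed
    thus False using ne by blast
  qed
  thus "(\<lambda>n. \<chi> n * cnj (\<psi> n)) \<in> nonprincipal_chars q"
    using dirichlet_char_mult_cnj[OF \<chi> \<psi>] by (simp add: nonprincipal_chars_def)
qed

lemma card_coprime_lessThan:
  assumes "q > 0"
  shows "card {n\<in>{..<q}. coprime n q} = totient q"
proof (cases "q = 1")
  case True
  thus ?thesis by (simp add: Collect_conv_if lessThan_Suc)
next
  case False
  have "{n\<in>{..<q}. coprime n q} = totatives q"
  proof (intro equalityI subsetI)
    fix n assume n: "n \<in> {n\<in>{..<q}. coprime n q}"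
    hence "n \<noteq> 0" using False by (cases "n = 0") auto
    thus "n \<in> totatives q" using n by (auto simp: totatives_def)
  next
    fix n assume n: "n \<in> totatives q"
    hence "n \<noteq> q" using False by (auto simp: totatives_def)
    thus "n \<in> {n\<in>{..<q}. coprime n q}" using n by (auto simp: totatives_def)
  qed
  thus ?thesis by (simp add: totient_def)
qed

lemma dirichlet_char_norm_sum:
  assumes "dirichlet_char q \<chi>"
  shows "(\<Sum>n<q. \<chi> n * cnj (\<chi> n)) = of_nat (totient q)"
proof -
  have "(\<Sum>n<q. \<chi> n * cnj (\<chi> n)) = (\<Sum>n | n \<in> {..<q} \<and> coprime n q. 1)"
    unfolding dirichlet_char_cnj_mult_self[OF assms] by (subst sum.inter_filter) auto
  thus ?thesis using card_coprime_lessThan[OF dirichlet_char_pos[OF assms]] by simp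
qed

text \<open>The characters are pairwise orthogonal functions on the residues, of squared norm
  \<phi>(q). \<open>w\<close> is \<phi>(q) times the projection of \<open>v\<close> onto the span of
  their conjugates, and the inequality is the nonnegativity of the squared norm of
  \<open>\<phi> * v - w\<close>.\<close>

lemma bessel_dirichlet_chars:
  fixes v :: "nat \<Rightarrow> complex"
  assumes q: "q > 0"
  shows "(\<Sum>\<chi> | dirichlet_char q \<chi>. norm (\<Sum>a<q. v a * \<chi> a) ^ 2) \<le> totient q * (\<Sum>a<q. norm (v a) ^ 2)"
proof -
  define X where "X = {\<chi>. dirichlet_char q \<chi>}"
  have fin: "finite X" unfolding X_def by (rule finite_dirichlet_chars)
  define A where "A \<chi> = (\<Sum>a<q. v a * \<chi> a)" for \<chi>
  define w where "w a = (\<Sum>\<chi>\<in>X. A \<chi> * cnj (\<chi> a))" for a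
  define S where "S = (\<Sum>\<chi>\<in>X. norm (A \<chi>) ^ 2)"
  define \<phi> where "\<phi> = real (totient q)"
  have ww: "(\<Sum>a<q. w a * cnj (w a)) = of_real (\<phi> * S)"
  proof -
    have "(\<Sum>a<q. w a * cnj (w a))
        = (\<Sum>a<q. \<Sum>\<chi>\<in>X. \<Sum>\<psi>\<in>X. A \<chi> * cnj (A \<psi>) * (\<psi> a * cnj (\<chi> a)))"
      unfolding w_def cnj_sum sum_product by (simp add: mult_ac)
    also have "\<dots> = (\<Sum>\<chi>\<in>X. \<Sum>\<psi>\<in>X. A \<chi> * cnj (A \<psi>) * (\<Sum>a<q. \<psi> a * cnj (\<chi> a)))"
      unfolding sum_distrib_left by (subst sum.swap, rule sum.cong[OF refl], rule sum.swap)
    also have "\<dots> = (\<Sum>\<chi>\<in>X. \<Sum>\<psi>\<in>X. if \<psi> = \<chi> then A \<chi> * cnj (A \<chi>) * \<phi> else 0)"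
      by (intro sum.cong refl)
         (auto simp: X_def \<phi>_def dirichlet_char_orthogonality dirichlet_char_norm_sum)
    also have "\<dots> = (\<Sum>\<chi>\<in>X. A \<chi> * cnj (A \<chi>) * \<phi>)"
      using fin by (simp add: sum.delta)
    also have "\<dots> = of_real (\<phi> * S)"
      by (simp add: S_def sum_distrib_left flip: complex_norm_square of_real_power of_real_mult)
         (simp add: mult_ac)
    finally show ?thesis .
  qed
  have vw: "(\<Sum>a<q. v a * cnj (w a)) = of_real S"
  proof -
    have "(\<Sum>a<q. v a * cnj (w a)) = (\<Sum>a<q. \<Sum>\<chi>\<in>X. cnj (A \<chi>) * (v a * \<chi> a))"
      unfolding w_def cnj_sum sum_distrib_left by (simp add: mult_ac)
    also have "\<dots> = (\<Sum>\<chi>\<in>X. cnj (A \<chi>) * A \<chi>)"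
      unfolding A_def[of _] sum_distrib_left by (subst sum.swap) (simp add: sum_distrib_left)
    also have "\<dots> = of_real S"
      by (simp add: S_def mult.commute[of "cnj _"] flip: complex_norm_square)
    finally show ?thesis .
  qed
  have exp: "norm (\<phi> * x - y) ^ 2 = \<phi>\<^sup>2 * norm x ^ 2 - 2 * \<phi> * Re (x * cnj y) + Re (y * cnj y)" for x y :: complex
    by (simp add: cmod_power2) (simp add: power2_eq_square algebra_simps)
  have "0 \<le> (\<Sum>a<q. norm (\<phi> * v a - w a) ^ 2)" by (intro sum_nonneg) auto
  also have "\<dots> = \<phi>\<^sup>2 * (\<Sum>a<q. norm (v a) ^ 2) - 2 * \<phi> * Re (\<Sum>a<q. v a * cnj (w a))
                 + Re (\<Sum>a<q. w a * cnj (w a))"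
    unfolding exp by (simp only: sum.distrib sum_subtractf sum_distrib_left Re_sum)
  also have "\<dots> = \<phi> * (\<phi> * (\<Sum>a<q. norm (v a) ^ 2) - S)"
    unfolding ww vw by (simp add: power2_eq_square algebra_simps)
  finally have "0 \<le> \<phi> * (\<phi> * (\<Sum>a<q. norm (v a) ^ 2) - S)" .
  moreover have "\<phi> > 0" using q by (simp add: \<phi>_def)
  ultimately have "S \<le> \<phi> * (\<Sum>a<q. norm (v a) ^ 2)" by (simp add: zero_le_mult_iff)
  thus ?thesis by (simp add: S_def A_def X_def \<phi>_def)
qed

text \<open>Bessel's inequality for the indicator of the residue class of 1: every character takes
  the value 1 there, so the left side counts characters. Writing \<open>1 mod q\<close> covers q =
  1.\<close>

lemma card_dirichlet_chars_le:
  assumes q: "q > 0"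
  shows "card {\<chi>. dirichlet_char q \<chi>} \<le> totient q"
proof -
  have *: "(\<Sum>a<q. (if a = 1 mod q then 1 else 0) * \<chi> a) = (1::complex)" if "dirichlet_char q \<chi>" for \<chi>
  proof -
    have "(\<Sum>a<q. (if a = 1 mod q then 1 else 0) * \<chi> a) = (\<Sum>a<q. if a = 1 mod q then \<chi> a else 0)"
      by (intro sum.cong) auto
    also have "\<dots> = \<chi> (1 mod q)" using q by (subst sum.delta) auto
    also have "\<dots> = 1" using dirichlet_char_mod[OF that, of 1] dirichlet_char_1[OF that] by simp
    finally show ?thesis .
  qed
  have "real (card {\<chi>. dirichlet_char q \<chi>}) =
      (\<Sum>\<chi> | dirichlet_char q \<chi>. norm (\<Sum>a<q. (if a = 1 mod q then 1 else 0) * \<chi> a) ^ 2)"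
    by (subst sum.cong[OF refl, of _ _ "\<lambda>_. 1"]) (auto simp only: * mem_Collect_eq norm_one power_one, simp)
  also have "\<dots> \<le> totient q * (\<Sum>a<q. norm (if a = 1 mod q then 1 else 0 :: complex) ^ 2)"
    by (rule bessel_dirichlet_chars[OF q])
  also have "(\<Sum>a<q. norm (if a = 1 mod q then 1 else 0 :: complex) ^ 2) = (\<Sum>a<q. if a = 1 mod q then 1 else 0)"
    by (intro sum.cong) auto
  also have "\<dots> = 1" using q by (subst sum.delta) auto
  finally show ?thesis by simp
qed

section \<open>Sums over products, grouped by residue class\<close>

lemma card_residue_class_le:
  assumes q: "q > (0::nat)"
  shows "card {m\<in>{..X}. m mod q = a} \<le> X div q + 1"
proof -
  have "card {m\<in>{..X}. m mod q = a} \<le> card {..X div q}"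
  proof (rule card_inj_on_le)
    show "inj_on (\<lambda>m. m div q) {m\<in>{..X}. m mod q = a}"
      by (rule inj_onI) (metis (mono_tags, lifting) div_mult_mod_eq mem_Collect_eq)
    show "(\<lambda>m. m div q) ` {m\<in>{..X}. m mod q = a} \<subseteq> {..X div q}"
      by (auto intro: div_le_mono)
  qed auto
  thus ?thesis by simp
qed

text \<open>Terms are collected by \<open>p f mod q\<close> before Bessel's inequality is applied. A
  residue class contains at most X/q + 1 values up to \<open>X\<close>, each taken at most
  \<open>T\<close> times, so the squared class sizes add up to at most (X/q + 1) * T times
  \<open>card I\<close>. The part X/q accounts for different products that collide modulo q.\<close>

lemma large_sieve_dirichlet_chars:
  fixes c :: "'i \<Rightarrow> complex" and p :: "'i \<Rightarrow> nat"
  assumes q: "q > 0" and fin: "finite I" and \<kappa>: "\<And>f. f \<in> I \<Longrightarrow> norm (c f) \<le> \<kappa>"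
    and X: "\<And>f. f \<in> I \<Longrightarrow> p f \<le> X" and T: "\<And>m. card {f\<in>I. p f = m} \<le> T"
  shows "(\<Sum>\<chi> | dirichlet_char q \<chi>. norm (\<Sum>f\<in>I. c f * \<chi> (p f)) ^ 2)
           \<le> totient q * (\<kappa>\<^sup>2 * ((X / q + 1) * T * card I))"
proof -
  define v where "v a = (\<Sum>f\<in>{f\<in>I. p f mod q = a}. c f)" for a
  define n where "n a = card {f\<in>I. p f mod q = a}" for a
  have *: "(\<Sum>f\<in>I. c f * \<chi> (p f)) = (\<Sum>a<q. v a * \<chi> a)" if "dirichlet_char q \<chi>" for \<chi>
  proof -
    have "(\<Sum>f\<in>I. c f * \<chi> (p f)) = (\<Sum>a<q. \<Sum>f\<in>{f\<in>I. p f mod q = a}. c f * \<chi> (p f))"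
      using q fin by (subst sum.group) auto
    also have "\<dots> = (\<Sum>a<q. \<Sum>f\<in>{f\<in>I. p f mod q = a}. c f * \<chi> a)"
      by (intro sum.cong refl) (use dirichlet_char_mod[OF that] in force)
    finally show ?thesis by (simp add: v_def sum_distrib_right)
  qed
  have nv: "norm (v a) \<le> \<kappa> * n a" for a
    unfolding v_def n_def using sum_norm_bound[of "{f\<in>I. p f mod q = a}" c \<kappa>] \<kappa> by (simp add: mult.commute)
  have n_le: "real (n a) \<le> (X / q + 1) * T" for a
  proof -
    have "{f\<in>I. p f mod q = a} = (\<Union>m\<in>{m\<in>{..X}. m mod q = a}. {f\<in>I. p f = m})"
      using X by auto
    hence "n a \<le> (\<Sum>m\<in>{m\<in>{..X}. m mod q = a}. card {f\<in>I. p f = m})"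
      unfolding n_def by (simp only:) (rule card_UN_le, simp)
    also have "\<dots> \<le> card {m\<in>{..X}. m mod q = a} * T"
      using sum_bounded_above[of "{m\<in>{..X}. m mod q = a}" "\<lambda>m. card {f\<in>I. p f = m}" T] T by simp
    also have "\<dots> \<le> (X div q + 1) * T"
      by (intro mult_right_mono card_residue_class_le q) auto
    finally have "real (n a) \<le> real ((X div q + 1) * T)" by (simp only: of_nat_le_iff)
    also have "\<dots> = (real (X div q) + 1) * T" by (simp add: algebra_simps)
    also have "\<dots> \<le> (X / q + 1) * T"
      by (intro mult_right_mono add_right_mono of_nat_div_le_of_nat) auto
    finally show ?thesis .
  qed
  have sum_n: "(\<Sum>a<q. real (n a)) = card I"
  proof -
    have "(\<Sum>a<q. n a) = (\<Sum>a<q. \<Sum>f\<in>{f\<in>I. p f mod q = a}. 1)" by (simp add: n_def)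
    also have "\<dots> = (\<Sum>f\<in>I. 1)" using q fin by (subst sum.group) auto
    finally show ?thesis by (simp flip: of_nat_sum)
  qed
  have "(\<Sum>a<q. norm (v a) ^ 2) \<le> (\<Sum>a<q. \<kappa>\<^sup>2 * ((X / q + 1) * T) * n a)"
  proof (rule sum_mono)
    fix a
    have "norm (v a) ^ 2 \<le> (\<kappa> * n a) ^ 2" by (intro power_mono nv) auto
    also have "\<dots> = \<kappa>\<^sup>2 * (n a * n a)" by (simp add: power2_eq_square)
    also have "\<dots> \<le> \<kappa>\<^sup>2 * (((X / q + 1) * T) * n a)"
      using mult_right_mono[OF n_le[of a], of "real (n a)"] by (intro mult_left_mono) auto
    finally show "norm (v a) ^ 2 \<le> \<kappa>\<^sup>2 * ((X / q + 1) * T) * n a" by (simp add: mult.assoc)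
  qed
  also have "\<dots> = \<kappa>\<^sup>2 * ((X / q + 1) * T) * card I"
    by (simp only: sum_n flip: sum_distrib_left)
  finally have **: "(\<Sum>a<q. norm (v a) ^ 2) \<le> \<kappa>\<^sup>2 * ((X / q + 1) * T) * card I" .
  have "(\<Sum>\<chi> | dirichlet_char q \<chi>. norm (\<Sum>f\<in>I. c f * \<chi> (p f)) ^ 2)
      = (\<Sum>\<chi> | dirichlet_char q \<chi>. norm (\<Sum>a<q. v a * \<chi> a) ^ 2)"
    by (simp add: *)
  also have "\<dots> \<le> totient q * (\<Sum>a<q. norm (v a) ^ 2)" by (rule bessel_dirichlet_chars[OF q])
  also have "\<dots> \<le> totient q * (\<kappa>\<^sup>2 * ((X / q + 1) * T) * card I)"
    by (intro mult_left_mono **) auto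
  finally show ?thesis by (simp add: mult.assoc)
qed

section \<open>Factorizations of rough numbers\<close>

text \<open>Each prime of \<open>m\<close> multiplies the number of factorizations by at most \<open>r \<le> p\<^bsup>1/4\<^esup>\<close>.\<close>

lemma factorization_tuples_card:
  fixes m r :: nat
  assumes "m > 0" "\<And>p. prime p \<Longrightarrow> p dvd m \<Longrightarrow> r ^ 4 \<le> p"
  shows "finite {f \<in> {..<r} \<rightarrow>\<^sub>E (UNIV::nat set). (\<Prod>i<r. f i) = m} \<and>
         card {f \<in> {..<r} \<rightarrow>\<^sub>E (UNIV::nat set). (\<Prod>i<r. f i) = m} ^ 4 \<le> m"
  using assms
proof (induction m rule: prime_divisors_induct)
  case zero
  thus ?case by simp
next
  case (unit x)
  have "{f \<in> {..<r} \<rightarrow>\<^sub>E (UNIV::nat set). (\<Prod>i<r. f i) = x} \<subseteq> {\<lambda>i\<in>{..<r}. 1}"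
  proof
    fix f assume "f \<in> {f \<in> {..<r} \<rightarrow>\<^sub>E (UNIV::nat set). (\<Prod>i<r. f i) = x}"
    hence f: "f \<in> {..<r} \<rightarrow>\<^sub>E UNIV" "(\<Prod>i<r. f i) = 1" using unit by auto
    have "f i = 1" if "i < r" for i
      using f(2) that dvd_prodI[of "{..<r}" i f] by simp
    thus "f \<in> {\<lambda>i\<in>{..<r}. 1}" using f(1) by (auto simp: PiE_def extensional_def fun_eq_iff)
  qed
  from finite_subset[OF this] card_mono[OF _ this] unit show ?case
    using power_le_one[of "card {f \<in> {..<r} \<rightarrow>\<^sub>E (UNIV::nat set). (\<Prod>i<r. f i) = x}" 4] by simp
next
  case (factor p x)
  define D where "D m = {f \<in> {..<r} \<rightarrow>\<^sub>E (UNIV::nat set). (\<Prod>i<r. f i) = m}" for m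
  have p: "p > 0" "x > 0" using factor.prems(1) by auto
  have IH: "finite (D x)" "card (D x) ^ 4 \<le> x"
    using factor.IH[OF p(2)] factor.prems(2) unfolding D_def by auto
  \<comment> \<open>A prime dividing the product divides some coordinate, and dividing that
    coordinate by \<open>p\<close> leaves a factorization of \<open>x\<close>. So \<open>r\<close>
    modified copies of \<open>D x\<close> cover \<open>D (p * x)\<close>.\<close>
  have sub: "D (p * x) \<subseteq> (\<Union>i<r. (\<lambda>f. f(i := p * f i)) ` D x)"
  proof
    fix f assume f: "f \<in> D (p * x)"
    hence "p dvd (\<Prod>i<r. f i)" by (simp add: D_def)
    then obtain i where i: "i < r" "p dvd f i"
      using factor.hyps by (auto simp: prime_dvd_prod_iff)
    define g where "g = f(i := f i div p)"
    have g: "f = g(i := p * g i)" using i by (simp add: g_def)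
    have "(\<Prod>j<r. f j) = f i * (\<Prod>j\<in>{..<r}-{i}. f j)"
      using i by (subst prod.remove[of _ i]) auto
    also have "(\<Prod>j\<in>{..<r}-{i}. f j) = (\<Prod>j\<in>{..<r}-{i}. g j)"
      by (intro prod.cong) (auto simp: g_def)
    also have "f i = p * g i" using i by (simp add: g_def)
    also have "p * g i * (\<Prod>j\<in>{..<r}-{i}. g j) = p * (\<Prod>j<r. g j)"
      using i by (subst prod.remove[of _ i]) auto
    finally have "(\<Prod>j<r. g j) = x" using f p by (simp add: D_def)
    moreover have "g \<in> {..<r} \<rightarrow>\<^sub>E UNIV"
      using f i by (auto simp: g_def D_def PiE_def extensional_def)
    ultimately have "g \<in> D x" by (simp add: D_def)
    with g i show "f \<in> (\<Union>i<r. (\<lambda>f. f(i := p * f i)) ` D x)" by blast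
  qed
  have fin: "finite (\<Union>i<r. (\<lambda>f. f(i := p * f i)) ` D x)" using IH by auto
  have "card (D (p * x)) \<le> card (\<Union>i<r. (\<lambda>f. f(i := p * f i)) ` D x)"
    by (rule card_mono[OF fin sub])
  also have "\<dots> \<le> (\<Sum>i<r. card ((\<lambda>f. f(i := p * f i)) ` D x))"
    by (rule card_UN_le) auto
  also have "\<dots> \<le> (\<Sum>i<r. card (D x))"
    by (intro sum_mono card_image_le IH)
  finally have "card (D (p * x)) \<le> r * card (D x)" by simp
  hence "card (D (p * x)) ^ 4 \<le> (r * card (D x)) ^ 4" by (rule power_mono) auto
  also have "\<dots> = r ^ 4 * card (D x) ^ 4" by (simp add: power_mult_distrib)
  also have "\<dots> \<le> p * x"
    using factor.prems(2)[OF factor.hyps] by (intro mult_mono IH) auto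
  finally show ?case using finite_subset[OF sub fin] by (simp add: D_def)
qed

section \<open>Reciprocals of smooth numbers\<close>

lemma prod_primes_dvd:
  fixes m :: nat
  assumes "finite P" "\<And>p. p \<in> P \<Longrightarrow> prime p" "\<And>p. p \<in> P \<Longrightarrow> p dvd m"
  shows "\<Prod>P dvd m"
  using assms
proof (induction P rule: finite_induct)
  case (insert p P)
  have "coprime p (\<Prod>P)"
    using insert by (intro prod_coprime_right primes_coprime) auto
  with insert show ?case by (simp add: divides_mult)
qed simp

text \<open>Every prime in (n, 2n] divides (2n)! but not n!, hence divides the central binomial
  coefficient, which is at most 4^n. The product of these primes is at least the left side.\<close>

lemma power_card_primes_le:
  fixes n :: nat
  shows "n ^ card {p. prime p \<and> n < p \<and> p \<le> 2 * n} \<le> 4 ^ n"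
proof -
  define P where "P = {p. prime p \<and> n < p \<and> p \<le> 2 * n}"
  have fin: "finite P" by (rule finite_subset[of _ "{..2*n}"]) (auto simp: P_def)
  have dvd: "p dvd (2 * n choose n)" if "p \<in> P" for p
  proof -
    have "p dvd fact (2 * n)" using that by (simp add: P_def prime_dvd_fact_iff)
    also have "fact (2 * n) = fact n * fact n * (2 * n choose n)"
      using binomial_fact_lemma[of n "2 * n"] by simp
    finally show ?thesis
      using that by (auto simp: P_def prime_dvd_mult_iff prime_dvd_fact_iff)
  qed
  have "n ^ card P \<le> \<Prod>P"
    using prod_mono[of P "\<lambda>_. n" "\<lambda>p. p"] by (auto simp: P_def)
  also have "\<dots> \<le> (2 * n choose n)"
    using prod_primes_dvd[OF fin _ dvd] by (intro dvd_imp_le) (auto simp: P_def)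
  also have "\<dots> \<le> (\<Sum>k\<le>2*n. 2 * n choose k)"
    by (rule member_le_sum) auto
  also have "\<dots> = 4 ^ n" by (simp add: choose_row_sum power_mult)
  finally show ?thesis by (simp add: P_def)
qed

lemma card_dyadic_primes_le: "j * card {p::nat. prime p \<and> 2 ^ j < p \<and> p \<le> 2 ^ Suc j} \<le> 2 ^ Suc j"
proof -
  have "2 ^ (j * card {p::nat. prime p \<and> 2 ^ j < p \<and> p \<le> 2 ^ Suc j}) \<le> (4::nat) ^ (2 ^ j)"
    using power_card_primes_le[of "2 ^ j"] by (simp add: power_mult)
  also have "(4::nat) ^ (2 ^ j) = 2 ^ (2 ^ Suc j)" by (simp add: power_mult)
  finally show ?thesis by (subst (asm) power_increasing_iff) auto
qed

section \<open>Euler products over smooth numbers\<close>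

definition smooth_upto :: "nat \<Rightarrow> nat \<Rightarrow> nat set" where
  "smooth_upto y X = {a\<in>{1..X}. \<forall>p. prime p \<longrightarrow> p dvd a \<longrightarrow> p \<le> y}"

text \<open>A finite Euler product built up one prime at a time: the part of \<open>a\<close> prime
  to \<open>p\<close> is composed of primes in \<open>P\<close>, and the powers of \<open>p\<close>
  contribute the geometric series p/(p - 1) = 1 + 1/(p - 1).\<close>

lemma sum_inverse_smooth_le_prod:
  fixes P :: "nat set"
  assumes "finite P" "\<And>p. p \<in> P \<Longrightarrow> prime p"
  shows "(\<Sum>a\<in>{a\<in>{1..X}. \<forall>p. prime p \<longrightarrow> p dvd a \<longrightarrow> p \<in> P}. 1 / real a) \<le> (\<Prod>p\<in>P. 1 + 1 / (real p - 1))"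
  using assms
proof (induction P rule: finite_induct)
  case empty
  have "{a\<in>{1..X}. \<forall>p. prime p \<longrightarrow> p dvd a \<longrightarrow> p \<in> {}} \<subseteq> {1}"
    using prime_factor_nat by auto
  from sum_mono2[OF _ this, of "\<lambda>a. 1 / real a"] show ?case by simp
next
  case (insert p P)
  define S where "S P = {a\<in>{1..X}. \<forall>p. prime p \<longrightarrow> p dvd a \<longrightarrow> p \<in> P}" for P
  have fin: "finite (S P)" for P by (simp add: S_def)
  have p: "prime p" "p > 1" using insert.prems prime_gt_1_nat by auto
  have sub: "S (insert p P) \<subseteq> (\<lambda>(i, a). p ^ i * a) ` ({..X} \<times> S P)"
  proof
    fix a assume a: "a \<in> S (insert p P)"
    hence a0: "a \<noteq> 0" "a \<le> X" by (auto simp: S_def)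
    obtain b where b: "a = p ^ multiplicity p a * b" "\<not> p dvd b"
      using multiplicity_decompose'[of a p] a0 p by auto
    define i where "i = multiplicity p a"
    have b0: "b > 0" using a0 b by (metis gr0I mult_0_right)
    \<comment> \<open>The crude range \<open>{..X}\<close> for the exponents is enough, because the
      geometric series is bounded by its infinite sum anyway.\<close>
    have "i < p ^ i" using p by (simp add: power_gt_expt)
    also have "\<dots> \<le> p ^ i * b" using b0 by simp
    also have "\<dots> \<le> X" using b a0 by (simp add: i_def)
    finally have "i \<le> X" by simp
    moreover have "b \<in> S P"
    proof -
      have "b \<le> p ^ i * b" using p by simp
      hence "b \<le> X" using b a0 by (simp add: i_def)
      moreover have "r \<in> P" if "prime r" "r dvd b" for r
      proof -
        have "r \<in> insert p P" using that a b by (auto simp: S_def intro: dvd_mult)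
          (metis (no_types, lifting) b(1) dvd_mult)
        thus ?thesis using that b by auto
      qed
      ultimately show ?thesis using b0 by (auto simp: S_def)
    qed
    ultimately have "(i, b) \<in> {..X} \<times> S P" by simp
    thus "a \<in> (\<lambda>(i, a). p ^ i * a) ` ({..X} \<times> S P)"
      using b(1) by (force simp: i_def)
  qed
  have "(\<Sum>a\<in>S (insert p P). 1 / real a) \<le> (\<Sum>a\<in>(\<lambda>(i, a). p ^ i * a) ` ({..X} \<times> S P). 1 / real a)"
    using sub fin by (intro sum_mono2) auto
  also have "\<dots> \<le> (\<Sum>(i,a)\<in>{..X} \<times> S P. 1 / real (p ^ i * a))"
    using fin by (intro order.trans[OF sum_image_le]) (auto simp: o_def case_prod_unfold)
  also have "\<dots> = (\<Sum>i\<le>X. (1 / real p) ^ i) * (\<Sum>a\<in>S P. 1 / real a)"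
    by (simp add: sum_product sum.cartesian_product power_divide)
  also have "\<dots> \<le> (1 + 1 / (real p - 1)) * (\<Prod>p\<in>P. 1 + 1 / (real p - 1))"
  proof (rule mult_mono)
    have "(\<Sum>i\<le>X. (1 / real p) ^ i) \<le> (\<Sum>i. (1 / real p) ^ i)"
      using p by (intro sum_le_suminf summable_geometric) auto
    also have "\<dots> = 1 / (1 - 1 / real p)" using p by (intro suminf_geometric) auto
    also have "\<dots> = 1 + 1 / (real p - 1)" using p by (simp add: field_simps)
    finally show "(\<Sum>i\<le>X. (1 / real p) ^ i) \<le> 1 + 1 / (real p - 1)" .
    show "(\<Sum>a\<in>S P. 1 / real a) \<le> (\<Prod>p\<in>P. 1 + 1 / (real p - 1))"
      using insert unfolding S_def by auto
  qed (use p in \<open>auto intro!: sum_nonneg\<close>)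
  finally show ?case using insert by (simp add: S_def)
qed

text \<open>The primes between \<open>2\<^sup>J\<close> and \<open>2\<^sup>J\<^sup>+\<^sup>1\<close> contribute at most \<open>exp (2 / J)\<close>, and
  \<open>exp (2 / J) \<le> (J / (J - 1))\<^sup>2\<close> makes the product telescope.\<close>

lemma prod_primes_le:
  assumes "J \<ge> 2"
  shows "(\<Prod>p | prime p \<and> p \<le> 2 ^ J. 1 + 1 / (real p - 1)) \<le> 3 * (real J - 1) ^ 2"
  using assms
proof (induction J rule: dec_induct)
  case base
  \<comment> \<open>For J = 2 the product is (1 + 1)(1 + 1/2) = 3, which fixes the constant
    3.\<close>
  have "{p::nat. prime p \<and> p \<le> 2\<^sup>2} = {2, 3}"
  proof -
    have "p \<in> {2, 3}" if "prime p" "p \<le> 4" for p :: nat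
    proof -
      have "p \<noteq> 4" using that(1) prime_nat_iff[of 4] by (auto dest: spec[of _ 2])
      thus ?thesis using that prime_ge_2_nat[of p] by auto
    qed
    thus ?thesis by auto
  qed
  thus ?case by simp
next
  case (step J)
  define P where "P J = {p::nat. prime p \<and> p \<le> 2 ^ J}" for J
  define Q where "Q = {p::nat. prime p \<and> 2 ^ J < p \<and> p \<le> 2 ^ Suc J}"
  have fin: "finite (P J)" for J by (rule finite_subset[of _ "{..2^J}"]) (auto simp: P_def)
  have finQ: "finite Q" by (rule finite_subset[of _ "{..2^Suc J}"]) (auto simp: Q_def)
  have PQ: "P (Suc J) = P J \<union> Q" "P J \<inter> Q = {}" by (auto simp: P_def Q_def)
  have card: "real (card Q) / 2 ^ J \<le> 2 / J"
  proof -
    have "real (J * card Q) \<le> real (2 ^ Suc J)"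
      unfolding Q_def by (intro of_nat_mono card_dyadic_primes_le)
    thus ?thesis using step.hyps by (simp add: field_simps)
  qed
  have "(\<Prod>p\<in>Q. 1 + 1 / (real p - 1)) \<le> (\<Prod>p\<in>Q. exp (1 / 2 ^ J))"
  proof (rule prod_mono)
    fix p assume "p \<in> Q"
    hence "real (2 ^ J + 1) \<le> real p" by (intro of_nat_mono) (auto simp: Q_def)
    hence p: "real p - 1 \<ge> 2 ^ J" by simp
    moreover have "(0::real) < 2 ^ J" by simp
    ultimately have "1 / (real p - 1) \<le> 1 / 2 ^ J" by (intro divide_left_mono mult_pos_pos) linarith+
    also have "1 + 1 / 2 ^ J \<le> exp (1 / 2 ^ J :: real)" by (rule exp_ge_add_one_self)
    finally show "0 \<le> 1 + 1 / (real p - 1) \<and> 1 + 1 / (real p - 1) \<le> exp (1 / 2 ^ J)"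
      using p order.trans[of 0 "2^J" "real p - 1"] by auto
  qed
  also have "\<dots> = exp (card Q / 2 ^ J)" by (simp flip: exp_of_nat_mult)
  also have "\<dots> \<le> exp (2 / J)" using card by simp
  also have "\<dots> = inverse (exp (- (1 / J))) ^ 2" by (simp flip: exp_minus exp_of_nat_mult)
  also have "\<dots> \<le> inverse (1 - 1 / J) ^ 2"
    using step.hyps exp_ge_add_one_self[of "-(1/real J)"]
    by (intro power_mono le_imp_inverse_le) auto
  also have "\<dots> = (J / (J - 1)) ^ 2" using step.hyps by (simp add: field_simps)
  finally have Q: "(\<Prod>p\<in>Q. 1 + 1 / (real p - 1)) \<le> (J / (real J - 1)) ^ 2" using step.hyps by (simp add: of_nat_diff)
  have "(\<Prod>p\<in>P (Suc J). 1 + 1 / (real p - 1)) = (\<Prod>p\<in>P J. 1 + 1 / (real p - 1)) * (\<Prod>p\<in>Q. 1 + 1 / (real p - 1))"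
    using PQ fin finQ by (simp add: prod.union_disjoint)
  also have "\<dots> \<le> (3 * (real J - 1) ^ 2) * (J / (real J - 1)) ^ 2"
    using step.IH Q by (intro mult_mono prod_nonneg) (auto simp: P_def Q_def dest: prime_gt_1_nat)
  also have "\<dots> = 3 * (real (Suc J) - 1) ^ 2" using step.hyps by (simp add: power_divide)
  finally show ?case by (simp add: P_def)
qed

lemma sum_inverse_smooth_le:
  assumes "J \<ge> 2"
  shows "(\<Sum>a\<in>smooth_upto (2 ^ J) X. 1 / real a) \<le> 3 * real J ^ 2"
proof -
  have fin: "finite {p::nat. prime p \<and> p \<le> 2 ^ J}" by (rule finite_subset[of _ "{..2^J}"]) auto
  have "(\<Sum>a\<in>smooth_upto (2 ^ J) X. 1 / real a)
      = (\<Sum>a\<in>{a\<in>{1..X}. \<forall>p. prime p \<longrightarrow> p dvd a \<longrightarrow> p \<in> {p. prime p \<and> p \<le> 2 ^ J}}. 1 / real a)"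
    unfolding smooth_upto_def by (rule sum.cong) auto
  also have "\<dots> \<le> (\<Prod>p | prime p \<and> p \<le> 2 ^ J. 1 + 1 / (real p - 1))"
    using fin by (intro sum_inverse_smooth_le_prod) auto
  also have "\<dots> \<le> 3 * (real J - 1) ^ 2" by (rule prod_primes_le[OF assms])
  also have "\<dots> \<le> 3 * real J ^ 2" using assms by (intro mult_left_mono power_mono) auto
  finally show ?thesis .
qed

section \<open>Moments of exponential sums over rough numbers\<close>

lemma norm_one_minus_cis: "norm (1 - cis t) = 2 * \<bar>sin (t / 2)\<bar>"
proof -
  have "norm (1 - cis t) ^ 2 = (1 - cos t) ^ 2 + sin t ^ 2"
    by (simp add: cmod_power2)
  also have "\<dots> = 2 - 2 * cos (2 * (t / 2))"
    using sin_cos_squared_add[of t] by (simp add: power2_eq_square algebra_simps)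
  also have "\<dots> = (2 * sin (t / 2)) ^ 2"
    unfolding cos_double_sin by (simp add: power2_eq_square)
  finally have "norm (1 - cis t) ^ 2 = (2 * \<bar>sin (t / 2)\<bar>) ^ 2" by (simp add: power_mult_distrib)
  thus ?thesis by (rule power2_eq_imp_eq) auto
qed

lemma norm_cis_diff_le: "norm (cis s - cis t) \<le> \<bar>s - t\<bar>"
proof -
  have "cis s - cis t = cis s * (1 - cis (t - s))"
    by (simp only: right_diff_distrib cis_mult) simp
  hence "norm (cis s - cis t) = norm (1 - cis (t - s))"
    by (simp add: norm_mult)
  also have "\<dots> = 2 * \<bar>sin ((t - s) / 2)\<bar>" by (rule norm_one_minus_cis)
  also have "\<dots> \<le> 2 * \<bar>(t - s) / 2\<bar>" by (intro mult_left_mono abs_sin_x_le_abs_x) auto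
  finally show ?thesis by simp
qed

lemma cis_2pi_mult_int_add: "cis (2 * pi * (real b * (\<beta> + of_int n))) = cis (2 * pi * (real b * \<beta>))"
proof -
  have "cis (2 * pi * (real b * (\<beta> + of_int n))) = cis (2 * pi * (real b * \<beta>)) * cis (2 * pi * (real_of_int (int b * n)))"
    by (simp add: cis_mult algebra_simps)
  also have "cis (2 * pi * real_of_int (int b * n)) = 1"
    by (rule cis_multiple_2pi) (rule Ints_of_int)
  finally show ?thesis by simp
qed

lemma sixteen_power: "(16::'a::comm_semiring_1) ^ n = (2 ^ n) ^ 4"
proof -
  have "((2::'a) ^ n) ^ 4 = (2 ^ 4) ^ n" by (metis power_mult mult.commute)
  thus ?thesis by simp
qed

text \<open>The r-th power is expanded over tuples in \<open>R\<close>, so that \<chi> is evaluated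
  at r-fold products. These are at most 16^((j+1)r), each is represented at most 2^((j+1)r) times
  because its primes exceed \<open>16 ^ l\<close>, and the coefficients are at most
  \<open>\<kappa>\<close>; then \<open>large_sieve_dirichlet_chars\<close> applies.\<close>

lemma block_moment:
  fixes w :: "nat \<Rightarrow> complex"
  assumes q: "q > 0" and r: "r \<le> 2 ^ l" and R: "R \<subseteq> {16 ^ j<..16 ^ (j+1)}"
    and rough: "\<And>b p. b \<in> R \<Longrightarrow> prime p \<Longrightarrow> p dvd b \<Longrightarrow> 16 ^ l < p"
    and w: "\<And>b. b \<in> R \<Longrightarrow> norm (w b) \<le> 1 / real b"
  shows "(\<Sum>\<chi> | dirichlet_char q \<chi>. norm (\<Sum>b\<in>R. w b * \<chi> b) ^ (2 * r)) \<le>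
    totient q * ((16 ^ ((j+1)*r) / q + 1) * 2 ^ ((j+1)*r) * 16 ^ ((j+1)*r) / 16 ^ (2*j*r))"
proof -
  have finR: "finite R" using R finite_subset by blast
  define I where "I = ({..<r} \<rightarrow>\<^sub>E R)"
  define \<kappa> :: real where "\<kappa> = (1 / 16 ^ j) ^ r"
  have finI: "finite I" unfolding I_def by (intro finite_PiE finR) auto
  have cardR: "card R \<le> 16 ^ (j+1)"
  proof -
    have "R \<subseteq> {1..16 ^ (j+1)}" using R by force
    from card_mono[OF _ this] show ?thesis by simp
  qed
  have cardI: "real (card I) \<le> 16 ^ ((j+1)*r)"
  proof -
    have "card I = card R ^ r" by (simp add: I_def card_PiE)
    also have "\<dots> \<le> (16 ^ (j+1)) ^ r" by (intro power_mono cardR) auto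
    finally have "real (card I) \<le> real ((16 ^ (j+1)) ^ r)" by (simp only: of_nat_le_iff)
    also have "\<dots> = 16 ^ ((j+1)*r)" by (simp only: of_nat_power power_mult) simp
    finally show ?thesis .
  qed
  have pw: "norm (\<Sum>b\<in>R. w b * \<chi> b) ^ (2 * r) = norm (\<Sum>f\<in>I. (\<Prod>i<r. w (f i)) * \<chi> (\<Prod>i<r. f i)) ^ 2"
    if \<chi>: "dirichlet_char q \<chi>" for \<chi>
  proof -
    have \<chi>_prod: "\<chi> (\<Prod>i<n. f i) = (\<Prod>i<n. \<chi> (f i))" for f :: "nat \<Rightarrow> nat" and n
      by (induction n) (use dirichlet_char_1[OF \<chi>] in \<open>auto simp: dirichlet_char_mult[OF \<chi>]\<close>)
    have "(\<Sum>b\<in>R. w b * \<chi> b) ^ r = (\<Prod>i<r. \<Sum>b\<in>R. w b * \<chi> b)" by simp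
    also have "\<dots> = (\<Sum>f\<in>I. \<Prod>i<r. w (f i) * \<chi> (f i))"
      unfolding I_def using finR by (intro prod_sum_PiE) auto
    also have "\<dots> = (\<Sum>f\<in>I. (\<Prod>i<r. w (f i)) * \<chi> (\<Prod>i<r. f i))"
      by (simp add: \<chi>_prod prod.distrib)
    finally have "norm (\<Sum>b\<in>R. w b * \<chi> b) ^ r = norm (\<Sum>f\<in>I. (\<Prod>i<r. w (f i)) * \<chi> (\<Prod>i<r. f i))"
      by (metis norm_power)
    thus ?thesis by (simp add: mult.commute[of 2] power_mult)
  qed
  have "(\<Sum>\<chi> | dirichlet_char q \<chi>. norm (\<Sum>b\<in>R. w b * \<chi> b) ^ (2 * r))
      = (\<Sum>\<chi> | dirichlet_char q \<chi>. norm (\<Sum>f\<in>I. (\<Prod>i<r. w (f i)) * \<chi> (\<Prod>i<r. f i)) ^ 2)"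
    by (intro sum.cong refl) (use pw in auto)
  also have "\<dots> \<le> totient q * (\<kappa>\<^sup>2 * ((real (16 ^ ((j+1)*r)) / q + 1) * real (2 ^ ((j+1)*r)) * card I))"
  proof (rule large_sieve_dirichlet_chars[OF q finI])
    fix f assume f: "f \<in> I"
    have "norm (w (f i)) \<le> 1 / 16 ^ j" if "i < r" for i
    proof -
      have fi: "f i \<in> R" using f that by (auto simp: I_def)
      hence "norm (w (f i)) \<le> 1 / real (f i)" by (rule w)
      also have "real (16 ^ j) \<le> real (f i)" using fi R by (intro of_nat_mono) auto
      hence "1 / real (f i) \<le> 1 / 16 ^ j" using fi R by (intro divide_left_mono) auto
      finally show ?thesis .
    qed
    hence "(\<Prod>i<r. norm (w (f i))) \<le> (\<Prod>i<r. 1 / 16 ^ j)"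
      by (intro prod_mono) auto
    thus "norm (\<Prod>i<r. w (f i)) \<le> \<kappa>" by (simp add: \<kappa>_def prod_norm)
    have "(\<Prod>i<r. f i) \<le> (\<Prod>i<r. 16 ^ (j+1))"
      using f R by (intro prod_mono) (force simp: I_def)
    thus "(\<Prod>i<r. f i) \<le> 16 ^ ((j+1)*r)" by (simp only: prod_constant card_lessThan power_mult)
  next
    fix m
    show "card {f\<in>I. (\<Prod>i<r. f i) = m} \<le> 2 ^ ((j+1)*r)"
    proof (cases "{f\<in>I. (\<Prod>i<r. f i) = m} = {}")
      case True
      show ?thesis unfolding True by simp
    next
      case False
      then obtain f where f: "f \<in> I" "(\<Prod>i<r. f i) = m" by blast
      have fR: "f i \<in> R" if "i < r" for i using f that by (auto simp: I_def)
      have m0: "m > 0" using f(2) fR R by (auto intro!: prod_pos) force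
      have m_le: "m \<le> 16 ^ ((j+1)*r)"
      proof -
        have "(\<Prod>i<r. f i) \<le> (\<Prod>i<r. 16 ^ (j+1))"
          using fR R by (intro prod_mono) force
        thus ?thesis by (simp only: prod_constant card_lessThan power_mult f)
      qed
      have big: "r ^ 4 \<le> p" if "prime p" "p dvd m" for p
      proof -
        have "p dvd (\<Prod>i<r. f i)" using that f(2) by simp
        then obtain i where "i < r" "p dvd f i"
          using prime_dvd_prod_iff[of "{..<r}" p f] \<open>prime p\<close> by auto
        hence "16 ^ l < p" using rough fR that by blast
        moreover have "r ^ 4 \<le> (2 ^ l) ^ 4" by (intro power_mono r) auto
        ultimately show ?thesis unfolding sixteen_power by linarith
      qed
      have "{f\<in>I. (\<Prod>i<r. f i) = m} \<subseteq> {f \<in> {..<r} \<rightarrow>\<^sub>E UNIV. (\<Prod>i<r. f i) = m}"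
        by (auto simp: I_def)
      hence "card {f\<in>I. (\<Prod>i<r. f i) = m} ^ 4 \<le> card {f \<in> {..<r} \<rightarrow>\<^sub>E (UNIV::nat set). (\<Prod>i<r. f i) = m} ^ 4"
        using factorization_tuples_card[OF m0 big] by (intro power_mono card_mono) auto
      also have "\<dots> \<le> m" using factorization_tuples_card[OF m0 big] by blast
      also have "\<dots> \<le> 16 ^ ((j+1)*r)" by (rule m_le)
      also have "(16::nat) ^ ((j+1)*r) = (2 ^ ((j+1)*r)) ^ 4"
        by (rule sixteen_power)
      finally show ?thesis by (subst (asm) power_mono_iff) auto
    qed
  qed
  also have "\<dots> \<le> totient q * (\<kappa>\<^sup>2 * ((real (16 ^ ((j+1)*r)) / q + 1) * real (2 ^ ((j+1)*r)) * 16 ^ ((j+1)*r)))"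
    by (intro mult_left_mono cardI) auto
  also have "\<kappa>\<^sup>2 = 1 / 16 ^ (2*j*r)"
    by (simp add: \<kappa>_def power_divide power_mult[symmetric] mult_ac)
  finally show ?thesis by (simp add: mult_ac)
qed

text \<open>A net of \<open>32\<^sup>j = (16\<^sup>j)\<^bsup>5/4\<^esup>\<close> points is fine enough for errors that are summable over \<open>j\<close>, and small
  enough not to destroy the saving of the fourth moment.\<close>

lemma block_net:
  fixes u :: "nat \<Rightarrow> complex"
  assumes R: "R \<subseteq> {16 ^ j<..16 ^ (j+1)}" and u: "\<And>b. b \<in> R \<Longrightarrow> norm (u b) \<le> 1 / real b"
    and c: "\<And>b. norm (c b) \<le> 1"
  obtains i where "i < 32 ^ j"
    "norm (\<Sum>b\<in>R. u b * c b * cis (2 * pi * (real b * \<beta>)))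
       \<le> norm (\<Sum>b\<in>R. u b * c b * cis (2 * pi * (real b * (real i / 32 ^ j)))) + 128 / 2 ^ j"
proof
  \<comment> \<open>The sum has period 1 in the frequency, so \<open>frac \<beta>\<close> may
    replace \<open>\<beta>\<close>; \<open>i / 32 ^ j\<close> is the net point just below
    it.\<close>
  define i where "i = nat \<lfloor>32 ^ j * frac \<beta>\<rfloor>"
  have frac: "0 \<le> frac \<beta>" "frac \<beta> < 1" by (auto simp: frac_lt_1)
  have i: "real i \<le> 32 ^ j * frac \<beta>" "32 ^ j * frac \<beta> \<le> real i + 1"
    using frac unfolding i_def by auto
  have "real i < 32 ^ j"
    using i(1) frac by (smt (verit) mult_less_cancel_left2 zero_less_power)
  thus "i < 32 ^ j" by (metis of_nat_less_iff of_nat_numeral of_nat_power)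
  have finR: "finite R" using R finite_subset by blast
  have cardR: "real (card R) \<le> 16 ^ (j+1)"
  proof -
    have "R \<subseteq> {1..16 ^ (j+1)}" using R by force
    from card_mono[OF _ this] have "real (card R) \<le> real (16 ^ (j+1))" by (intro of_nat_mono) simp
    thus ?thesis by simp
  qed
  define F where "F x = (\<Sum>b\<in>R. u b * c b * cis (2 * pi * (real b * x)))" for x
  have d: "\<bar>frac \<beta> - real i / 32 ^ j\<bar> \<le> 1 / 32 ^ j"
  proof -
    have "frac \<beta> - real i / 32 ^ j = (32 ^ j * frac \<beta> - real i) / 32 ^ j" by (simp add: diff_divide_distrib)
    thus ?thesis using i by (simp add: divide_right_mono)
  qed
  have "norm (F (frac \<beta>) - F (real i / 32 ^ j)) \<le> (\<Sum>b\<in>R. 2 * pi / 32 ^ j)"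
    unfolding F_def sum_subtractf[symmetric]
  proof (rule sum_norm_le)
    fix b assume b: "b \<in> R"
    hence b0: "b > 0" using R by force
    have "norm (u b * c b * cis (2 * pi * (real b * frac \<beta>)) - u b * c b * cis (2 * pi * (real b * (real i / 32 ^ j))))
        = norm (u b) * norm (c b) * norm (cis (2 * pi * (real b * frac \<beta>)) - cis (2 * pi * (real b * (real i / 32 ^ j))))"
      by (simp flip: right_diff_distrib norm_mult)
    also have "\<dots> \<le> (1 / real b) * 1 * \<bar>2 * pi * (real b * frac \<beta>) - 2 * pi * (real b * (real i / 32 ^ j))\<bar>"
      by (intro mult_mono u b c norm_cis_diff_le) auto
    also have "2 * pi * (real b * frac \<beta>) - 2 * pi * (real b * (real i / 32 ^ j)) = (2 * pi * real b) * (frac \<beta> - real i / 32 ^ j)"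
      by (simp add: algebra_simps)
    also have "(1 / real b) * 1 * \<bar>\<dots>\<bar> = 2 * pi * \<bar>frac \<beta> - real i / 32 ^ j\<bar>"
      using b0 by (simp add: abs_mult)
    also have "\<dots> \<le> 2 * pi * (1 / 32 ^ j)" by (intro mult_left_mono d) auto
    finally show "norm (u b * c b * cis (2 * pi * (real b * frac \<beta>)) - u b * c b * cis (2 * pi * (real b * (real i / 32 ^ j)))) \<le> 2 * pi / 32 ^ j"
      by simp
  qed
  also have "\<dots> = card R * (2 * pi / 32 ^ j)" by simp
  \<comment> \<open>At most 16^(j+1) terms move, each by at most 2 pi / 32^j; with pi < 4 the total
    is 128 / 2^j.\<close>
  also have "\<dots> \<le> 16 ^ (j+1) * (2 * 4 / 32 ^ j)"
    using pi_less_4 by (intro mult_mono cardR divide_right_mono) auto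
  also have "16 ^ (j+1) * (2 * 4 / 32 ^ j) = 128 / (2::real) ^ j"
  proof -
    have "(32::real) ^ j = 16 ^ j * 2 ^ j" by (simp flip: power_mult_distrib)
    thus ?thesis by simp
  qed
  finally have "norm (F (frac \<beta>)) \<le> norm (F (real i / 32 ^ j)) + 128 / 2 ^ j"
    using norm_triangle_ineq2[of "F (frac \<beta>)" "F (real i / 32 ^ j)"] by linarith
  moreover have "F \<beta> = F (frac \<beta>)"
    unfolding F_def using cis_2pi_mult_int_add[of _ "frac \<beta>" "\<lfloor>\<beta>\<rfloor>"] by (simp add: frac_def)
  ultimately show "norm (F \<beta>) \<le> norm (F (real i / 32 ^ j)) + 128 / 2 ^ j" by simp
qed

section \<open>Frequencies that depend on the character\<close>

lemma power_add_le:
  fixes x y :: real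
  assumes "x \<ge> 0" "y \<ge> 0"
  shows "(x + y) ^ p \<le> 2 ^ p * (x ^ p + y ^ p)"
proof -
  have "(x + y) ^ p \<le> (2 * max x y) ^ p" using assms by (intro power_mono) auto
  also have "\<dots> = 2 ^ p * max x y ^ p" by (simp add: power_mult_distrib)
  also have "max x y ^ p \<le> x ^ p + y ^ p" using assms by (auto simp: max_def)
  finally show ?thesis by simp
qed

text \<open>Jensen's inequality for the convex function x^p, after the weights are normalized by
  their sum.\<close>

lemma weighted_power_mean:
  fixes w x :: "'a \<Rightarrow> real"
  assumes fin: "finite I" and w: "\<And>i. i \<in> I \<Longrightarrow> w i \<ge> 0" and p: "even p" "p > 0"
  shows "(\<Sum>i\<in>I. w i * x i) ^ p \<le> (\<Sum>i\<in>I. w i) ^ (p - 1) * (\<Sum>i\<in>I. w i * x i ^ p)"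
proof (cases "(\<Sum>i\<in>I. w i) = 0")
  case True
  hence "w i = 0" if "i \<in> I" for i using sum_nonneg_eq_0_iff[OF fin w] that by auto
  thus ?thesis using p by (simp add: power_0_left)
next
  case False
  define W where "W = (\<Sum>i\<in>I. w i)"
  have W: "W > 0" using False w by (simp add: W_def sum_nonneg less_le)
  have "(\<Sum>i\<in>I. (w i / W) *\<^sub>R x i) ^ p \<le> (\<Sum>i\<in>I. (w i / W) * x i ^ p)"
  proof (rule convex_on_sum[OF fin _ convex_power_even[OF p(1)]])
    show "I \<noteq> {}" using False by auto
    show "(\<Sum>i\<in>I. w i / W) = 1" using W by (simp add: W_def flip: sum_divide_distrib)
  qed (use w W in auto)
  hence "(\<Sum>i\<in>I. w i * x i) ^ p / W ^ p \<le> (\<Sum>i\<in>I. w i * x i ^ p) / W"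
    by (simp add: power_divide flip: sum_divide_distrib)
  moreover have "W ^ p = W * W ^ (p - 1)" using p by (metis power_minus_mult mult.commute)
  ultimately show ?thesis using W by (simp add: W_def field_simps)
qed

text \<open>Each character has its own net point. Summing over all net points dominates that one
  value and makes the frequency independent of \<chi>, at the cost of the size of the net. The last
  term is the 2k-th power of the net error 128 / 2^j, where 16384 = 128^2.\<close>

lemma block_sup:
  fixes u :: "nat \<Rightarrow> complex"
  assumes q: "q > 0" and R: "R \<subseteq> {16 ^ j<..16 ^ (j+1)}" and u: "\<And>b. b \<in> R \<Longrightarrow> norm (u b) \<le> 1 / real b"
  defines "F \<equiv> (\<lambda>\<chi> x. \<Sum>b\<in>R. u b * \<chi> b * cis (2 * pi * (real b * x)))"
  shows "(\<Sum>\<chi> | dirichlet_char q \<chi>. norm (F \<chi> (\<beta> \<chi>)) ^ (2 * k)) \<le>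
    4 ^ k * ((\<Sum>i<32^j. \<Sum>\<chi> | dirichlet_char q \<chi>. norm (F \<chi> (real i / 32 ^ j)) ^ (2 * k)) +
             totient q * (16384 ^ k / 4 ^ (j * k)))"
proof -
  define X where "X = {\<chi>. dirichlet_char q \<chi>}"
  have "(\<Sum>\<chi>\<in>X. norm (F \<chi> (\<beta> \<chi>)) ^ (2 * k)) \<le>
        (\<Sum>\<chi>\<in>X. 4 ^ k * ((\<Sum>i<32^j. norm (F \<chi> (real i / 32 ^ j)) ^ (2 * k)) + 16384 ^ k / 4 ^ (j * k)))"
  proof (rule sum_mono)
    fix \<chi> assume "\<chi> \<in> X"
    hence \<chi>: "dirichlet_char q \<chi>" by (simp add: X_def)
    obtain i where i: "i < 32 ^ j" "norm (F \<chi> (\<beta> \<chi>)) \<le> norm (F \<chi> (real i / 32 ^ j)) + 128 / 2 ^ j"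
      unfolding F_def
      by (rule block_net[OF R u norm_dirichlet_char_le_1[OF \<chi>], where \<beta> = "\<beta> \<chi>"]) (assumption | rule that)+
    have "norm (F \<chi> (\<beta> \<chi>)) ^ (2 * k) \<le> (norm (F \<chi> (real i / 32 ^ j)) + 128 / 2 ^ j) ^ (2 * k)"
      by (intro power_mono i) auto
    also have "\<dots> \<le> 2 ^ (2 * k) * (norm (F \<chi> (real i / 32 ^ j)) ^ (2 * k) + (128 / 2 ^ j) ^ (2 * k))"
      by (rule power_add_le) auto
    also have "(128 / 2 ^ j :: real) ^ (2 * k) = 16384 ^ k / 4 ^ (j * k)"
    proof -
      have "(128 / 2 ^ j :: real) ^ (2 * k) = (128 ^ 2) ^ k / ((2 ^ 2) ^ j) ^ k"
        by (simp only: power_divide power_mult[symmetric] mult_ac)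
      thus ?thesis by (simp add: power_mult)
    qed
    also have "(2::real) ^ (2 * k) = 4 ^ k" by (simp add: power_mult)
    also have "norm (F \<chi> (real i / 32 ^ j)) ^ (2 * k) \<le> (\<Sum>i<32^j. norm (F \<chi> (real i / 32 ^ j)) ^ (2 * k))"
      using i(1) by (intro member_le_sum) auto
    finally show "norm (F \<chi> (\<beta> \<chi>)) ^ (2 * k) \<le> 4 ^ k * ((\<Sum>i<32^j. norm (F \<chi> (real i / 32 ^ j)) ^ (2 * k)) + 16384 ^ k / 4 ^ (j * k))"
      by simp
  qed
  also have "\<dots> = 4 ^ k * ((\<Sum>i<32^j. \<Sum>\<chi>\<in>X. norm (F \<chi> (real i / 32 ^ j)) ^ (2 * k)) + card X * (16384 ^ k / 4 ^ (j * k)))"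
    by (subst sum.swap) (simp add: sum.distrib flip: sum_distrib_left)
  also have "\<dots> \<le> 4 ^ k * ((\<Sum>i<32^j. \<Sum>\<chi>\<in>X. norm (F \<chi> (real i / 32 ^ j)) ^ (2 * k)) + totient q * (16384 ^ k / 4 ^ (j * k)))"
    using card_dirichlet_chars_le[OF q] by (intro mult_left_mono add_left_mono mult_right_mono) (auto simp: X_def)
  finally show ?thesis by (simp add: X_def)
qed

text \<open>At a frequency common to all characters the twist has modulus 1 and is absorbed into the
  coefficients.\<close>

lemma block_moment_net:
  fixes u :: "nat \<Rightarrow> complex"
  assumes q: "q > 0" and r: "r \<le> 2 ^ l" and R: "R \<subseteq> {16 ^ j<..16 ^ (j+1)}"
    and rough: "\<And>b p. b \<in> R \<Longrightarrow> prime p \<Longrightarrow> p dvd b \<Longrightarrow> 16 ^ l < p"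
    and u: "\<And>b. b \<in> R \<Longrightarrow> norm (u b) \<le> 1 / real b"
  shows "(\<Sum>\<chi> | dirichlet_char q \<chi>. norm (\<Sum>b\<in>R. u b * \<chi> b * cis (2 * pi * (real b * x))) ^ (2 * r)) \<le>
    totient q * ((16 ^ ((j+1)*r) / q + 1) * 2 ^ ((j+1)*r) * 16 ^ ((j+1)*r) / 16 ^ (2*j*r))"
proof -
  have eq: "(\<Sum>b\<in>R. u b * \<chi> b * cis (2 * pi * (real b * x))) = (\<Sum>b\<in>R. (u b * cis (2 * pi * (real b * x))) * \<chi> b)" for \<chi>
    by (simp add: mult_ac)
  show ?thesis unfolding eq
    by (rule block_moment[OF q r R rough]) (use u in \<open>auto simp: norm_mult\<close>)
qed

text \<open>All k-fold products are at most q here, so X/q + 1 <= 2 and collisions modulo q cost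
  only a constant. At one net point the moment is of order 8^(-jk), up to a constant to the power k;
  the factor 32^j for the net still leaves 2^(-jk).\<close>

lemma block_head:
  fixes u :: "nat \<Rightarrow> complex"
  assumes q: "q > 0" and k: "k \<ge> 3" "k \<le> 2 ^ l" and R: "R \<subseteq> {16 ^ j<..16 ^ (j+1)}"
    and rough: "\<And>b p. b \<in> R \<Longrightarrow> prime p \<Longrightarrow> p dvd b \<Longrightarrow> 16 ^ l < p"
    and u: "\<And>b. b \<in> R \<Longrightarrow> norm (u b) \<le> 1 / real b" and j: "16 ^ ((j+1)*k) \<le> q"
  shows "(\<Sum>\<chi> | dirichlet_char q \<chi>. norm (\<Sum>b\<in>R. u b * \<chi> b * cis (2 * pi * (real b * \<beta> \<chi>))) ^ (2 * k))
           \<le> totient q * ((2 ^ 18) ^ k / 2 ^ (j * k))"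
proof -
  define \<phi> where "\<phi> = real (totient q)"
  have \<phi>: "\<phi> \<ge> 0" by (simp add: \<phi>_def)
  have num: "32 ^ j * (2 * 2 ^ ((j+1)*k) * 16 ^ ((j+1)*k) / 16 ^ (2*j*k)) \<le> (2 * 32 ^ k / 2 ^ (j*k) :: real)"
  proof -
    have "32 ^ j * (2 * 2 ^ ((j+1)*k) * 16 ^ ((j+1)*k) / 16 ^ (2*j*k)) = (2 * 32 ^ k * (32 * 2 ^ k) ^ j / 16 ^ (j * k) :: real)"
    proof -
      have "(2::real) ^ ((j+1)*k) * 16 ^ ((j+1)*k) = 32 ^ k * 2 ^ (j*k) * 16 ^ (j*k)"
        by (simp add: power_add flip: power_mult_distrib)
      moreover have "(16::real) ^ (2*j*k) = 16 ^ (j*k) * 16 ^ (j*k)"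
        by (simp only: mult_2 distrib_right power_add)
      moreover have "(32 * 2 ^ k :: real) ^ j = 32 ^ j * 2 ^ (j * k)"
        by (simp add: power_mult_distrib mult.commute flip: power_mult)
      moreover have "32 ^ j * (2 * x * y / d) = 32 ^ j * 2 * (x * y) / d" for x y d :: real by simp
      ultimately show ?thesis by (simp only:) simp
    qed
    also have "\<dots> \<le> 2 * 32 ^ k * (8 ^ k) ^ j / 16 ^ (j * k)"
    proof -
      \<comment> \<open>The net is paid for here: 32 <= 4^k.\<close>
      have "(4::real) ^ 3 \<le> 4 ^ k" by (intro power_increasing k) auto
      hence "32 * 2 ^ k \<le> 4 ^ k * (2 ^ k :: real)" by simp
      also have "\<dots> = 8 ^ k" by (simp flip: power_mult_distrib)
      finally show ?thesis by (intro divide_right_mono mult_left_mono power_mono) auto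
    qed
    also have "((8::real) ^ k) ^ j = 8 ^ (j * k)" by (simp add: mult.commute flip: power_mult)
    also have "(16::real) ^ (j*k) = 8 ^ (j*k) * 2 ^ (j*k)" by (simp flip: power_mult_distrib)
    finally show ?thesis by simp
  qed
  have net: "(\<Sum>\<chi> | dirichlet_char q \<chi>. norm (\<Sum>b\<in>R. u b * \<chi> b * cis (2 * pi * (real b * x))) ^ (2 * k))
           \<le> \<phi> * (2 * 2 ^ ((j+1)*k) * 16 ^ ((j+1)*k) / 16 ^ (2*j*k))" for x
  proof -
    have "real (16 ^ ((j+1)*k)) \<le> real q" using j by (simp only: of_nat_le_iff)
    hence "16 ^ ((j+1)*k) / real q + 1 \<le> 2" using q by (simp add: field_simps)
    hence "\<phi> * ((16 ^ ((j+1)*k) / q + 1) * 2 ^ ((j+1)*k) * 16 ^ ((j+1)*k) / 16 ^ (2*j*k))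
        \<le> \<phi> * (2 * 2 ^ ((j+1)*k) * 16 ^ ((j+1)*k) / 16 ^ (2*j*k))"
      by (intro mult_left_mono[OF _ \<phi>] divide_right_mono mult_right_mono) auto
    moreover have "(\<Sum>\<chi> | dirichlet_char q \<chi>. norm (\<Sum>b\<in>R. u b * \<chi> b * cis (2 * pi * (real b * x))) ^ (2 * k))
        \<le> \<phi> * ((16 ^ ((j+1)*k) / q + 1) * 2 ^ ((j+1)*k) * 16 ^ ((j+1)*k) / 16 ^ (2*j*k))"
      unfolding \<phi>_def by (rule block_moment_net[OF q k(2) R]) (use rough u in auto)
    ultimately show ?thesis by (rule order.trans[rotated])
  qed
  have "(\<Sum>\<chi> | dirichlet_char q \<chi>. norm (\<Sum>b\<in>R. u b * \<chi> b * cis (2 * pi * (real b * \<beta> \<chi>))) ^ (2 * k))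
     \<le> 4 ^ k * ((\<Sum>i<(32::nat)^j. \<phi> * (2 * 2 ^ ((j+1)*k) * 16 ^ ((j+1)*k) / 16 ^ (2*j*k))) + \<phi> * (16384 ^ k / 4 ^ (j * k)))"
    unfolding \<phi>_def
    by (rule order.trans[OF block_sup[OF q R u]], assumption)
       (intro mult_left_mono add_right_mono sum_mono net[unfolded \<phi>_def], simp)
  also have "\<dots> = \<phi> * (4 ^ k * (32 ^ j * (2 * 2 ^ ((j+1)*k) * 16 ^ ((j+1)*k) / 16 ^ (2*j*k)) + 16384 ^ k / 4 ^ (j * k)))"
    by (simp add: algebra_simps)
  also have "\<dots> \<le> \<phi> * (4 ^ k * (2 * 32 ^ k / 2 ^ (j*k) + 16384 ^ k / 2 ^ (j * k)))"
    by (intro mult_left_mono[OF _ \<phi>] mult_left_mono add_mono num divide_left_mono power_mono) auto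
  also have "4 ^ k * (2 * 32 ^ k / 2 ^ (j*k) + 16384 ^ k / 2 ^ (j * k)) \<le> ((2 ^ 18) ^ k / 2 ^ (j * k) :: real)"
  proof -
    \<comment> \<open>The constant is 4 * 4 * 16384 = 2^18, the leading 4 being absorbed into
      4^k.\<close>
    have "2 * 32 ^ k + 16384 ^ k \<le> (4 * 16384 ^ k :: real)"
    proof -
      have "(32::real) ^ k \<le> 16384 ^ k" by (intro power_mono) auto
      moreover have "(0::real) < 16384 ^ k" by simp
      ultimately show ?thesis by linarith
    qed
    also have "(4 :: real) \<le> 4 ^ k" using k power_increasing[of 1 k "4::real"] by simp
    finally have "4 ^ k * (2 * 32 ^ k + 16384 ^ k) \<le> 4 ^ k * (4 ^ k * 16384 ^ k :: real)" by simp
    also have "\<dots> = (2 ^ 18) ^ k" by (simp flip: power_mult_distrib)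
    finally show ?thesis by (simp add: divide_right_mono flip: add_divide_distrib)
  qed
  finally show ?thesis using \<phi> by (simp add: mult_left_mono \<phi>_def)
qed

text \<open>Four of the 2k factors are estimated in mean, the others by the trivial bound 16. Over
  the whole net, the diagonal part of the fourth moment is of order 32^j * 4^j / 256^j = 2^(-j); the
  part carrying 1/q has a further factor 256^j and becomes 128^j / q.\<close>

lemma block_tail:
  fixes u :: "nat \<Rightarrow> complex"
  assumes q: "q > 0" and k: "k \<ge> 3" "k \<le> 2 ^ l" and R: "R \<subseteq> {16 ^ j<..16 ^ (j+1)}"
    and rough: "\<And>b p. b \<in> R \<Longrightarrow> prime p \<Longrightarrow> p dvd b \<Longrightarrow> 16 ^ l < p"
    and u: "\<And>b. b \<in> R \<Longrightarrow> norm (u b) \<le> 1 / real b"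
  shows "(\<Sum>\<chi> | dirichlet_char q \<chi>. norm (\<Sum>b\<in>R. u b * \<chi> b * cis (2 * pi * (real b * \<beta> \<chi>))) ^ (2 * k))
           \<le> totient q * ((2 ^ 32) ^ k * (1 / 2 ^ j + 128 ^ j / q))"
proof -
  define \<phi> where "\<phi> = real (totient q)"
  have \<phi>: "\<phi> \<ge> 0" by (simp add: \<phi>_def)
  define Q where "Q = 1 / 2 ^ j + 128 ^ j / real q"
  have num: "32 ^ j * ((16 ^ ((j+1)*2) / real q + 1) * 2 ^ ((j+1)*2) * 16 ^ ((j+1)*2) / 16 ^ (2*j*2)) \<le> 2 ^ 18 * Q"
  proof -
    have e: "(16::real) ^ ((j+1)*2) = 256 * 256 ^ j" "(2::real) ^ ((j+1)*2) = 4 * 4 ^ j" "(16::real) ^ (2*j*2) = 256 ^ j * 256 ^ j"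
      by (simp_all add: power_mult power_add mult.commute[of _ 2] flip: power_mult_distrib)
    have "32 ^ j * ((16 ^ ((j+1)*2) / real q + 1) * 2 ^ ((j+1)*2) * 16 ^ ((j+1)*2) / 16 ^ (2*j*2))
       = 1024 * (256 * 256 ^ j / real q + 1) * (32 ^ j * 4 ^ j / 256 ^ j)"
      unfolding e by (simp add: field_simps)
    also have "32 ^ j * 4 ^ j / 256 ^ j = (1 / 2 ^ j :: real)"
      by (simp add: power_one_over flip: power_mult_distrib power_divide)
    also have "1024 * (256 * 256 ^ j / real q + 1) * (1 / 2 ^ j) \<le> 1024 * (256 * 256 ^ j / real q + 256) * (1 / 2 ^ j)"
      by (intro mult_right_mono mult_left_mono) auto
    also have "\<dots> = 2 ^ 18 * (1 / 2 ^ j + (256 ^ j / 2 ^ j) / real q)" by (simp add: field_simps)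
    also have "256 ^ j / 2 ^ j = (128 ^ j :: real)" by (simp flip: power_divide)
    finally show ?thesis by (simp add: Q_def)
  qed
  have bd: "norm (\<Sum>b\<in>R. u b * \<chi> b * cis (2 * pi * (real b * x))) \<le> 16" if "dirichlet_char q \<chi>" for \<chi> x
  proof -
    have "norm (\<Sum>b\<in>R. u b * \<chi> b * cis (2 * pi * (real b * x))) \<le> (\<Sum>b\<in>R. 1 / 16 ^ j)"
    proof (rule sum_norm_le)
      fix b assume b: "b \<in> R"
      have "norm (u b * \<chi> b * cis (2 * pi * (real b * x))) \<le> (1 / real b) * 1 * 1"
        unfolding norm_mult by (intro mult_mono u b norm_dirichlet_char_le_1[OF that]) auto
      moreover have "real (16 ^ j) \<le> real b" using b R by (intro of_nat_mono) auto
      hence "1 / real b \<le> 1 / 16 ^ j" using b R by (intro divide_left_mono) auto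
      ultimately show "norm (u b * \<chi> b * cis (2 * pi * (real b * x))) \<le> 1 / 16 ^ j" by simp
    qed
    also have "\<dots> = card R / 16 ^ j" by simp
    also have "real (card R) \<le> real (16 ^ (j+1))"
    proof -
      have "R \<subseteq> {1..16 ^ (j+1)}" using R by force
      from card_mono[OF _ this] show ?thesis by (intro of_nat_mono) simp
    qed
    hence "card R / 16 ^ j \<le> (16::real)" by (simp add: field_simps)
    finally show ?thesis .
  qed
  have net: "(\<Sum>\<chi> | dirichlet_char q \<chi>. norm (\<Sum>b\<in>R. u b * \<chi> b * cis (2 * pi * (real b * x))) ^ (2 * k))
           \<le> 256 ^ k * (\<phi> * ((16 ^ ((j+1)*2) / q + 1) * 2 ^ ((j+1)*2) * 16 ^ ((j+1)*2) / 16 ^ (2*j*2)))" for x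
  proof -
    have "(\<Sum>\<chi> | dirichlet_char q \<chi>. norm (\<Sum>b\<in>R. u b * \<chi> b * cis (2 * pi * (real b * x))) ^ (2 * k))
       \<le> (\<Sum>\<chi> | dirichlet_char q \<chi>. 256 ^ k * norm (\<Sum>b\<in>R. u b * \<chi> b * cis (2 * pi * (real b * x))) ^ (2 * 2))"
    proof (rule sum_mono)
      fix \<chi> assume "\<chi> \<in> {\<chi>. dirichlet_char q \<chi>}"
      hence \<chi>: "dirichlet_char q \<chi>" by simp
      define y where "y = norm (\<Sum>b\<in>R. u b * \<chi> b * cis (2 * pi * (real b * x)))"
      have y: "0 \<le> y" "y \<le> 16" using bd[OF \<chi>] by (auto simp: y_def)
      have "y ^ (2 * k) = y ^ (2 * k - 4) * y ^ 4" using k by (simp flip: power_add)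
      also have "\<dots> \<le> 16 ^ (2 * k - 4) * y ^ 4" using y by (intro mult_right_mono power_mono) auto
      also have "\<dots> \<le> 16 ^ (2 * k) * y ^ 4" by (intro mult_right_mono power_increasing) auto
      finally show "y ^ (2 * k) \<le> 256 ^ k * y ^ (2 * 2)" by (simp add: power_mult)
    qed
    also have "\<dots> \<le> 256 ^ k * (\<phi> * ((16 ^ ((j+1)*2) / q + 1) * 2 ^ ((j+1)*2) * 16 ^ ((j+1)*2) / 16 ^ (2*j*2)))"
      unfolding \<phi>_def sum_distrib_left[symmetric]
      by (intro mult_left_mono block_moment_net[OF q _ R rough u]) (use k in auto)
    finally show ?thesis .
  qed
  have "(\<Sum>\<chi> | dirichlet_char q \<chi>. norm (\<Sum>b\<in>R. u b * \<chi> b * cis (2 * pi * (real b * \<beta> \<chi>))) ^ (2 * k))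
     \<le> 4 ^ k * ((\<Sum>i<(32::nat)^j. 256 ^ k * (\<phi> * ((16 ^ ((j+1)*2) / q + 1) * 2 ^ ((j+1)*2) * 16 ^ ((j+1)*2) / 16 ^ (2*j*2)))) + \<phi> * (16384 ^ k / 4 ^ (j * k)))"
    unfolding \<phi>_def
    by (rule order.trans[OF block_sup[OF q R u]], assumption)
       (intro mult_left_mono add_right_mono sum_mono net[unfolded \<phi>_def], simp)
  also have "4 ^ k * ((\<Sum>i<(32::nat)^j. 256 ^ k * (\<phi> * A)) + \<phi> * B) = \<phi> * (4 ^ k * (256 ^ k * (32 ^ j * A) + B))" for A B
    by (simp add: algebra_simps)
  also have "\<phi> * (4 ^ k * (256 ^ k * (32 ^ j * ((16 ^ ((j+1)*2) / q + 1) * 2 ^ ((j+1)*2) * 16 ^ ((j+1)*2) / 16 ^ (2*j*2))) + 16384 ^ k / 4 ^ (j * k)))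
     \<le> \<phi> * (4 ^ k * (256 ^ k * (2 ^ 18 * Q) + 16384 ^ k * Q))"
  proof (intro mult_left_mono[OF _ \<phi>] mult_left_mono add_mono num)
    have "(2::real) ^ j \<le> 4 ^ (j * k)"
      using k by (intro order.trans[OF power_mono[of 2 4 j]] power_increasing) auto
    hence "1 / 4 ^ (j * k) \<le> (1 / 2 ^ j :: real)" by (intro divide_left_mono) auto
    also have "\<dots> \<le> Q" by (simp add: Q_def)
    finally have "16384 ^ k * (1 / 4 ^ (j * k)) \<le> 16384 ^ k * Q" by (intro mult_left_mono) auto
    thus "16384 ^ k / 4 ^ (j * k) \<le> 16384 ^ k * Q" by simp
  qed auto
  also have "\<dots> = \<phi> * ((4 ^ k * (256 ^ k * 2 ^ 18 + 16384 ^ k)) * Q)" by (simp add: algebra_simps)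
  also have "\<dots> \<le> \<phi> * ((2 ^ 32) ^ k * Q)"
  proof (intro mult_left_mono[OF _ \<phi>] mult_right_mono)
    \<comment> \<open>All constants are turned into k-th powers: 64^3 <= 64^k and 2 <= 65536^k, with
      4 * 65536 * 16384 = 2^32.\<close>
    have "(2::real) ^ 18 = 64 ^ 3" by simp
    also have "\<dots> \<le> 64 ^ k" using k by (intro power_increasing) auto
    finally have "256 ^ k * 2 ^ 18 + 16384 ^ k \<le> 256 ^ k * 64 ^ k + (16384 ^ k :: real)" by simp
    also have "\<dots> = 2 * 16384 ^ k" by (simp flip: power_mult_distrib)
    also have "(2::real) \<le> 65536 ^ k" using k power_increasing[of 1 k "65536::real"] by simp
    finally have "4 ^ k * (256 ^ k * 2 ^ 18 + 16384 ^ k) \<le> 4 ^ k * (65536 ^ k * 16384 ^ k :: real)" by simp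
    also have "\<dots> = (2 ^ 32) ^ k" by (simp flip: power_mult_distrib)
    finally show "4 ^ k * (256 ^ k * 2 ^ 18 + 16384 ^ k) \<le> ((2 ^ 32) ^ k :: real)" .
    show "Q \<ge> 0" by (simp add: Q_def)
  qed
  finally show ?thesis by (simp add: \<phi>_def Q_def)
qed

section \<open>Separating smooth and rough factors\<close>

definition rough_upto :: "nat \<Rightarrow> nat \<Rightarrow> nat set" where
  "rough_upto y X = {b\<in>{1..X}. \<forall>p. prime p \<longrightarrow> p dvd b \<longrightarrow> y < p}"

lemma smooth_rough_decomposition:
  fixes n y :: nat
  assumes "n > 0"
  shows "\<exists>a b. n = a * b \<and> (\<forall>p. prime p \<longrightarrow> p dvd a \<longrightarrow> p \<le> y) \<and> (\<forall>p. prime p \<longrightarrow> p dvd b \<longrightarrow> y < p)"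
  using assms
proof (induction n rule: prime_divisors_induct)
  case (unit n)
  thus ?case by (intro exI[of _ 1]) (auto dest: prime_gt_1_nat)
next
  case (factor p n)
  then obtain a b where ab: "n = a * b" "\<forall>p. prime p \<longrightarrow> p dvd a \<longrightarrow> p \<le> y" "\<forall>p. prime p \<longrightarrow> p dvd b \<longrightarrow> y < p"
    by (metis gr0I mult_0_right)
  show ?case
  proof (cases "p \<le> y")
    case True
    have "\<forall>r. prime r \<longrightarrow> r dvd p * a \<longrightarrow> r \<le> y"
      using ab(2) True factor.hyps by (auto simp: prime_dvd_mult_iff dest: primes_dvd_imp_eq)
    thus ?thesis using ab by (intro exI[of _ "p * a"] exI[of _ b]) auto
  next
    case False
    have "\<forall>r. prime r \<longrightarrow> r dvd p * b \<longrightarrow> y < r"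
      using ab(3) False factor.hyps by (auto simp: prime_dvd_mult_iff dest: primes_dvd_imp_eq)
    thus ?thesis using ab by (intro exI[of _ a] exI[of _ "p * b"]) auto
  qed
qed simp

text \<open>A smooth number and a rough number share no prime, so \<open>a\<close> divides
  \<open>a'\<close> and conversely.\<close>

lemma smooth_rough_unique:
  fixes a b a' b' y :: nat
  assumes eq: "a * b = a' * b'" and pos: "a > 0" "b > 0" "a' > 0"
    and smooth: "\<And>p. prime p \<Longrightarrow> p dvd a \<Longrightarrow> p \<le> y" "\<And>p. prime p \<Longrightarrow> p dvd a' \<Longrightarrow> p \<le> y"
    and rough: "\<And>p. prime p \<Longrightarrow> p dvd b \<Longrightarrow> y < p" "\<And>p. prime p \<Longrightarrow> p dvd b' \<Longrightarrow> y < p"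
  shows "a = a' \<and> b = b'"
proof -
  have "coprime a b'"
    using smooth(1) rough(2) by (metis coprime_iff_gcd_eq_1 dvd_trans gcd_dvd1 gcd_dvd2 leD prime_factor_nat)
  moreover have "a dvd a' * b'" by (metis eq dvd_triv_left)
  ultimately have 1: "a dvd a'" using coprime_dvd_mult_left_iff by blast
  have "coprime a' b"
    using smooth(2) rough(1) by (metis coprime_iff_gcd_eq_1 dvd_trans gcd_dvd1 gcd_dvd2 leD prime_factor_nat)
  moreover have "a' dvd a * b" by (metis eq dvd_triv_left)
  ultimately have 2: "a' dvd a" using coprime_dvd_mult_left_iff by blast
  have "a = a'" using 1 2 by (rule dvd_antisym)
  thus ?thesis using eq pos by simp
qed

lemma sum_smooth_rough:
  fixes f :: "nat \<Rightarrow> 'a::comm_monoid_add"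
  shows "(\<Sum>n\<in>{1..N}. f n) = (\<Sum>a\<in>smooth_upto y N. \<Sum>b\<in>rough_upto y (N div a). f (a * b))"
proof -
  define D where "D = Sigma (smooth_upto y N) (\<lambda>a. rough_upto y (N div a))"
  have fin: "finite (smooth_upto y N)" "finite (rough_upto y X)" for X
    by (auto simp: smooth_upto_def rough_upto_def)
  have memD: "(a, b) \<in> D \<longleftrightarrow> a > 0 \<and> b > 0 \<and> a * b \<le> N \<and> (\<forall>p. prime p \<longrightarrow> p dvd a \<longrightarrow> p \<le> y) \<and> (\<forall>p. prime p \<longrightarrow> p dvd b \<longrightarrow> y < p)" for a b
  proof -
    have "b \<le> N div a \<longleftrightarrow> a * b \<le> N" if "a > 0"
      using that by (simp add: less_eq_div_iff_mult_less_eq mult.commute)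
    moreover have "a \<le> N" if "a * b \<le> N" "b > 0"
      using that by (metis Suc_leI le_trans mult.right_neutral mult_le_mono2 One_nat_def)
    ultimately show ?thesis by (auto simp: D_def smooth_upto_def rough_upto_def)
  qed
  have "bij_betw (\<lambda>(a, b). a * b) D {1..N}"
  proof (rule bij_betw_imageI)
    show "inj_on (\<lambda>(a, b). a * b) D"
    proof (rule inj_onI, clarify)
      fix a b a' b' assume "(a, b) \<in> D" "(a', b') \<in> D" "a * b = a' * b'"
      thus "a = a' \<and> b = b'" by (intro smooth_rough_unique[of a b a' b' y]) (auto simp: memD)
    qed
    show "(\<lambda>(a, b). a * b) ` D = {1..N}"
    proof (intro equalityI subsetI)
      fix n assume "n \<in> (\<lambda>(a, b). a * b) ` D"
      thus "n \<in> {1..N}" by (auto simp: memD)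
    next
      fix n assume n: "n \<in> {1..N}"
      obtain a b where ab: "n = a * b" "\<forall>p. prime p \<longrightarrow> p dvd a \<longrightarrow> p \<le> y" "\<forall>p. prime p \<longrightarrow> p dvd b \<longrightarrow> y < p"
        using smooth_rough_decomposition[of n y] n by auto
      hence "(a, b) \<in> D" using n by (auto simp: memD intro!: Nat.gr0I)
      thus "n \<in> (\<lambda>(a, b). a * b) ` D" using ab by force
    qed
  qed
  hence "(\<Sum>n\<in>{1..N}. f n) = (\<Sum>(a, b)\<in>D. f (a * b))"
    by (subst sum.reindex_bij_betw[symmetric]) (auto simp: case_prod_unfold)
  thus ?thesis unfolding D_def by (subst sum.Sigma) (use fin in auto)
qed

text \<open>A rough b > 1 has a prime factor above \<open>16 ^ l\<close>, so only blocks with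
  \<open>l \<le> j\<close> occur. \<open>g b\<close> is the index of the block containing
  \<open>b\<close>. Since j < 16^j, the range of \<open>j\<close> can be cut at \<open>X\<close>,
  which makes the index set visibly finite.\<close>

lemma sum_rough_blocks:
  fixes f :: "nat \<Rightarrow> 'a::comm_monoid_add"
  shows "(\<Sum>b\<in>rough_upto (16 ^ l) X - {1}. f b)
       = (\<Sum>j\<in>{j\<in>{l..<X}. 16 ^ j < X}. \<Sum>b\<in>{b\<in>rough_upto (16 ^ l) X. 16 ^ j < b \<and> b \<le> 16 ^ (j+1)}. f b)"
proof -
  define g where "g b = (LEAST j. b \<le> 16 ^ (j+1))" for b :: nat
  have g: "g b = j \<longleftrightarrow> 16 ^ j < b \<and> b \<le> 16 ^ (j+1)" if b: "b > 1" "16 ^ l < b" for b j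
  proof
    assume j: "16 ^ j < b \<and> b \<le> 16 ^ (j+1)"
    show "g b = j" unfolding g_def
    proof (rule Least_equality)
      show "b \<le> 16 ^ (j+1)" using j by simp
      fix i assume "b \<le> 16 ^ (i+1)"
      hence "(16::nat) ^ j < 16 ^ (i+1)" using j by linarith
      thus "j \<le> i" by (simp add: power_strict_increasing_iff del: power_Suc)
    qed
  next
    assume j: "g b = j"
    have "b \<le> 16 ^ (b+1)" using power_gt_expt[of 16 "b+1"] by simp
    hence 1: "b \<le> 16 ^ (g b + 1)" unfolding g_def by (rule LeastI)
    have "16 ^ j < b"
    proof (cases j)
      case 0
      thus ?thesis using b by simp
    next
      case (Suc i)
      hence "\<not> b \<le> 16 ^ (i+1)" using not_less_Least[of i "\<lambda>j. b \<le> 16 ^ (j+1)"] j by (simp add: g_def)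
      thus ?thesis using Suc by simp
    qed
    thus "16 ^ j < b \<and> b \<le> 16 ^ (j+1)" using 1 j by simp
  qed
  define S where "S = rough_upto (16 ^ l) X - {1}"
  have fin: "finite S" by (simp add: S_def rough_upto_def)
  have big: "b > 1 \<and> 16 ^ l < b" if "b \<in> S" for b
  proof -
    have "b > 1" using that by (auto simp: S_def rough_upto_def)
    then obtain p where "prime p" "p dvd b" using prime_factor_nat[of b] by auto
    hence "16 ^ l < p" "p \<le> b" using that \<open>b > 1\<close> by (auto simp: S_def rough_upto_def intro: dvd_imp_le)
    thus ?thesis using \<open>b > 1\<close> by linarith
  qed
  have img: "g ` S \<subseteq> {j\<in>{l..<X}. 16 ^ j < X}"
  proof
    fix j assume "j \<in> g ` S"
    then obtain b where b: "b \<in> S" "g b = j" by blast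
    hence j: "16 ^ j < b" "b \<le> 16 ^ (j+1)" "16 ^ l < b" using g[of b j] big by auto
    have "b \<le> X" using b by (auto simp: S_def rough_upto_def)
    have "(16::nat) ^ l < 16 ^ (j+1)" using j by linarith
    hence "l \<le> j" by (simp add: power_strict_increasing_iff del: power_Suc)
    moreover have "j < 16 ^ j" by (rule power_gt_expt) simp
    ultimately show "j \<in> {j\<in>{l..<X}. 16 ^ j < X}" using j \<open>b \<le> X\<close> by simp
  qed
  have "(\<Sum>b\<in>S. f b) = (\<Sum>j\<in>{j\<in>{l..<X}. 16 ^ j < X}. \<Sum>b\<in>{b\<in>S. g b = j}. f b)"
    by (rule sum.group[symmetric, OF fin _ img]) simp
  also have "\<dots> = (\<Sum>j\<in>{j\<in>{l..<X}. 16 ^ j < X}. \<Sum>b\<in>{b\<in>rough_upto (16 ^ l) X. 16 ^ j < b \<and> b \<le> 16 ^ (j+1)}. f b)"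
  proof (intro sum.cong refl)
    fix j
    \<comment> \<open>The strict lower end of a block excludes b = 1 even for j = 0.\<close>
    have "b \<noteq> 1" if "(16::nat) ^ j < b" for b using that by (metis less_irrefl one_le_power le_less_trans one_le_numeral order.strict_trans2)
    thus "{b\<in>S. g b = j} = {b\<in>rough_upto (16 ^ l) X. 16 ^ j < b \<and> b \<le> 16 ^ (j+1)}"
      using g big by (auto simp: S_def)
  qed
  finally show ?thesis by (simp add: S_def)
qed

section \<open>A bound uniform over the blocks\<close>

lemma sum_inverse_squares_le: "(\<Sum>j\<in>{1..<n}. 1 / real j ^ 2) \<le> 2"
proof (cases "n \<ge> 2")
  case True
  hence "(\<Sum>j\<in>{1..<n}. 1 / real j ^ 2) \<le> 2 - 1 / (real n - 1)"
  proof (induction n rule: dec_induct)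
    case (step n)
    have "1 / real n ^ 2 \<le> 1 / (real n * (real n - 1))"
      using step.hyps by (intro divide_left_mono) (auto simp: power2_eq_square)
    also have "\<dots> = 1 / (real n - 1) - 1 / real n"
      using step.hyps by (simp add: field_simps)
    finally show ?case using step by simp
  qed (simp add: numeral_2_eq_2)
  also have "\<dots> \<le> 2" using True by simp
  finally show ?thesis .
qed simp

text \<open>The blocks will carry a weight j^2, whose 2k-th power (j^4)^k has to be absorbed by the
  saving 2^(jk) of \<open>block_head\<close>. From j = 6 on, passing to j + 1 at most doubles
  j^4.\<close>

lemma fourth_power_le: "j ^ 4 \<le> 32 * (2::nat) ^ j"
proof (cases "j \<ge> 6")
  case True
  thus ?thesis
  proof (induction j rule: dec_induct)
    case (step j)
    obtain i where i: "j = 6 + i" using step.hyps le_Suc_ex by blast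
    have "Suc j ^ 4 \<le> 2 * j ^ 4" unfolding i by (simp add: power4_eq_xxxx algebra_simps)
    with step.IH show ?case by simp
  qed simp
next
  case False
  hence "j \<in> {0, 1, 2, 3, 4, 5}" by auto
  thus ?thesis by auto
qed

lemma tail_limit:
  fixes a :: real
  assumes "a > 0"
  shows "((\<lambda>x::real. x powr (-a) * ln x ^ p) \<longlongrightarrow> 0) at_top"
  using assms by real_asymp

text \<open>The condition \<open>q < 16 ^ ((j+1)*k)\<close> bounds 2^(-j) by 2 q^(-1/(4k)), and 16^j
  <= q^0.55 keeps 128^j below q^0.9625. Both terms save a power of q, which beats j^(4k) <= (log
  q)^(4k). The threshold depends on \<open>k\<close> alone.\<close>

lemma tail_small:
  assumes k: "k \<ge> 1"
  shows "\<exists>D. \<forall>q\<ge>D. \<forall>j N. 16 ^ j < N \<longrightarrow> real N \<le> real q powr 0.55 \<longrightarrow> q < 16 ^ ((j+1)*k) \<longrightarrow>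
           (2 ^ 32) ^ k * (1 / 2 ^ j + 128 ^ j / real q) * real j ^ (4 * k) \<le> 1"
proof -
  \<comment> \<open>The exponent comes from 16^((j+1)k) = (2^(j+1))^(4k).\<close>
  define c where "c = 1 / (4 * real k)"
  have c: "c > 0" using k by (simp add: c_def)
  define B where "B x = (2 ^ 32) ^ k * (2 * (x powr (-c) * ln x ^ (4 * k)) + x powr (-0.0375) * ln x ^ (4 * k))" for x :: real
  have "(B \<longlongrightarrow> (2 ^ 32) ^ k * (2 * 0 + 0)) at_top"
    unfolding B_def by (intro tendsto_intros tail_limit c) auto
  hence "eventually (\<lambda>x. B x < 1) at_top" using order_tendstoD(2)[of B 0 at_top 1] by simp
  hence "eventually (\<lambda>q::nat. B (real q) < 1) at_top"
    using filterlim_real_sequentially by (rule eventually_compose_filterlim)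
  then obtain D where D: "\<And>q. q \<ge> D \<Longrightarrow> B (real q) < 1"
    by (auto simp: eventually_at_top_linorder)
  show ?thesis
  proof (intro exI[of _ "max D 1"] allI impI)
    fix q j N :: nat
    assume q: "q \<ge> max D 1" and N: "16 ^ j < N" "real N \<le> real q powr 0.55" and big: "q < 16 ^ ((j+1)*k)"
    have q1: "real q \<ge> 1" using q by simp
    have "16 ^ j < real N" using N(1) by (metis of_nat_less_iff of_nat_numeral of_nat_power)
    hence jq: "16 ^ j \<le> real q powr 0.55" using N(2) by linarith
    have t1: "1 / 2 ^ j \<le> 2 * real q powr (-c)"
    proof -
      have "(16::real) ^ ((j+1)*k) = (2 ^ (j+1)) ^ (4 * k)"
        using sixteen_power[where 'a = real, of "(j+1)*k"] by (simp only: mult.commute[of 4] power_mult)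
      moreover have "real q \<le> 16 ^ ((j+1)*k)"
        using big by (metis less_imp_le of_nat_le_iff of_nat_numeral of_nat_power)
      ultimately have "real q powr c \<le> ((2 ^ (j+1)) ^ (4 * k)) powr c"
        using q1 c by (intro powr_mono2) auto
      also have "\<dots> = 2 ^ (j+1)"
      proof -
        have *: "(x ^ (4 * k)) powr c = x" if "x > 0" for x :: real
        proof -
          have "(x ^ (4 * k)) powr c = x powr (real (4 * k) * c)"
            using that by (simp only: powr_powr powr_realpow[symmetric])
          also have "real (4 * k) * c = 1" using k by (simp add: c_def)
          finally show ?thesis using that by simp
        qed
        show ?thesis by (rule *) simp
      qed
      finally have "real q powr c \<le> 2 * 2 ^ j" by simp
      thus ?thesis using q1 by (simp add: powr_minus field_simps)
    qed
    have t2: "128 ^ j / real q \<le> real q powr (-0.0375)"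
    proof -
      \<comment> \<open>128^4 = 2^28 = 16^7, and 0.55 * 7 = 4 * 0.9625.\<close>
      have "((128::real) ^ j) ^ 4 = (16 ^ j) ^ 7"
      proof -
        have "(x ^ j) ^ n = (x ^ n) ^ j" for x :: real and n by (metis power_mult mult.commute)
        from this[of 128 4] this[of 16 7] show ?thesis by simp
      qed
      also have "\<dots> \<le> (real q powr 0.55) ^ 7" by (intro power_mono jq) auto
      also have "\<dots> = (real q powr 0.9625) ^ 4"
        using q1 by (simp add: powr_powr flip: powr_realpow)
      finally have "128 ^ j \<le> real q powr 0.9625" by (subst (asm) power_mono_iff) auto
      hence "128 ^ j / real q \<le> real q powr 0.9625 / real q powr 1" using q1 by (simp add: divide_right_mono)
      also have "\<dots> = real q powr (-0.0375)" by (subst powr_diff[symmetric]) simp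
      finally show ?thesis .
    qed
    have t3: "real j \<le> ln (real q)"
    proof -
      have "exp (real j) = exp 1 ^ j" by (simp flip: exp_of_nat_mult)
      also have "\<dots> \<le> 16 ^ j" using exp_le by (intro power_mono) auto
      also have "\<dots> \<le> real q powr 0.55" by (rule jq)
      also have "\<dots> \<le> real q powr 1" using q1 by (intro powr_mono) auto
      finally show ?thesis using q1 by (simp add: ln_ge_iff)
    qed
    have "(2 ^ 32) ^ k * (1 / 2 ^ j + 128 ^ j / real q) * real j ^ (4 * k)
        \<le> (2 ^ 32) ^ k * (2 * real q powr (-c) + real q powr (-0.0375)) * ln (real q) ^ (4 * k)"
      using q1 by (intro mult_mono mult_left_mono add_mono t1 t2 power_mono t3) auto
    also have "\<dots> = B (real q)" by (simp add: B_def algebra_simps)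
    also have "\<dots> < 1" using D q by simp
    finally show "(2 ^ 32) ^ k * (1 / 2 ^ j + 128 ^ j / real q) * real j ^ (4 * k) \<le> 1" by simp
  qed
qed

text \<open>Head and tail blocks are merged into one bound, including the weight j^2 that later
  makes the sum over \<open>j\<close> converge. The threshold precedes all other quantifiers: the
  bound is applied at once to every smooth part and every block. The constant is 2^23 = 2^18 *
  32.\<close>

lemma block_combined:
  fixes k :: nat
  assumes k: "k \<ge> 3"
  shows "\<exists>D. \<forall>q\<ge>D. \<forall>l j N R u \<beta>. k \<le> 2 ^ l \<longrightarrow> 16 ^ j < N \<longrightarrow> real N \<le> real q powr 0.55 \<longrightarrow>
    R \<subseteq> {16 ^ j<..16 ^ (j+1)} \<longrightarrow> (\<forall>b\<in>R. \<forall>p. prime p \<longrightarrow> p dvd b \<longrightarrow> 16 ^ l < p) \<longrightarrow>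
    (\<forall>b\<in>R. norm (u b) \<le> 1 / real b) \<longrightarrow>
    (\<Sum>\<chi> | dirichlet_char q \<chi>. (real j ^ 2 * norm (\<Sum>b\<in>R. u b * \<chi> b * cis (2 * pi * (real b * \<beta> \<chi>)))) ^ (2 * k))
      \<le> real (totient q) * (2 ^ 23) ^ k"
proof -
  obtain D where D: "\<And>q j N. q \<ge> D \<Longrightarrow> 16 ^ j < N \<Longrightarrow> real N \<le> real q powr 0.55 \<Longrightarrow> q < 16 ^ ((j+1)*k) \<Longrightarrow>
           (2 ^ 32) ^ k * (1 / 2 ^ j + 128 ^ j / real q) * real j ^ (4 * k) \<le> 1"
    using tail_small[of k] k by auto
  show ?thesis
  proof (intro exI[of _ "max D 1"] allI impI)
    fix q l j N :: nat and R :: "nat set" and u :: "nat \<Rightarrow> complex" and \<beta> :: "(nat \<Rightarrow> complex) \<Rightarrow> real"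
    assume q: "q \<ge> max D 1" and l: "k \<le> 2 ^ l" and N: "16 ^ j < N" "real N \<le> real q powr 0.55"
      and R: "R \<subseteq> {16 ^ j<..16 ^ (j+1)}" and rough: "\<forall>b\<in>R. \<forall>p. prime p \<longrightarrow> p dvd b \<longrightarrow> 16 ^ l < p"
      and u: "\<forall>b\<in>R. norm (u b) \<le> 1 / real b"
    have q0: "q > 0" using q by simp
    define S where "S = (\<Sum>\<chi> | dirichlet_char q \<chi>. norm (\<Sum>b\<in>R. u b * \<chi> b * cis (2 * pi * (real b * \<beta> \<chi>))) ^ (2 * k))"
    have eq: "(\<Sum>\<chi> | dirichlet_char q \<chi>. (real j ^ 2 * norm (\<Sum>b\<in>R. u b * \<chi> b * cis (2 * pi * (real b * \<beta> \<chi>)))) ^ (2 * k)) = S * real j ^ (4 * k)"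
      unfolding S_def sum_distrib_right
      by (intro sum.cong refl) (simp add: power_mult_distrib mult.commute flip: power_mult)
    have "S * real j ^ (4 * k) \<le> real (totient q) * (2 ^ 23) ^ k"
    proof (cases "16 ^ ((j+1)*k) \<le> q")
      case True
      have S: "S \<le> real (totient q) * ((2 ^ 18) ^ k / 2 ^ (j * k))"
        unfolding S_def by (rule block_head[OF q0 k l R _ _ True]) (use rough u in auto)
      have "real (j ^ 4) \<le> real (32 * 2 ^ j)" by (intro of_nat_mono fourth_power_le)
      hence "(real j ^ 4) ^ k \<le> (32 * 2 ^ j) ^ k" by (intro power_mono) auto
      hence "S * real j ^ (4 * k) \<le> (real (totient q) * ((2 ^ 18) ^ k / 2 ^ (j * k))) * (32 * 2 ^ j) ^ k"
        unfolding power_mult by (intro mult_mono S[unfolded power_mult]) auto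
      also have "\<dots> = real (totient q) * ((2 ^ 18) ^ k * 32 ^ k)"
        by (simp add: power_mult_distrib flip: power_mult)
      also have "(2 ^ 18) ^ k * 32 ^ k = ((2 ^ 23) ^ k :: real)" by (simp flip: power_mult_distrib)
      finally show ?thesis .
    next
      case False
      have S: "S \<le> real (totient q) * ((2 ^ 32) ^ k * (1 / 2 ^ j + 128 ^ j / q))"
        unfolding S_def by (rule block_tail[OF q0 k l R]) (use rough u in auto)
      have "S * real j ^ (4 * k) \<le> (real (totient q) * ((2 ^ 32) ^ k * (1 / 2 ^ j + 128 ^ j / q))) * real j ^ (4 * k)"
        by (intro mult_right_mono S) auto
      also have "\<dots> = real (totient q) * ((2 ^ 32) ^ k * (1 / 2 ^ j + 128 ^ j / q) * real j ^ (4 * k))"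
        by (simp only: mult_ac)
      also have "\<dots> \<le> real (totient q) * 1"
        using D[of q j N] q N False by (intro mult_left_mono) auto
      also have "\<dots> \<le> real (totient q) * (2 ^ 23) ^ k"
        by (intro mult_left_mono one_le_power) auto
      finally show ?thesis .
    qed
    thus "(\<Sum>\<chi> | dirichlet_char q \<chi>. (real j ^ 2 * norm (\<Sum>b\<in>R. u b * \<chi> b * cis (2 * pi * (real b * \<beta> \<chi>)))) ^ (2 * k))
      \<le> real (totient q) * (2 ^ 23) ^ k" unfolding eq .
  qed
qed

text \<open>Pulling out the smooth part \<open>a\<close> turns the frequency into
  \<open>a * \<alpha> \<chi>\<close>, which is harmless because blocks admit any frequency depending
  on \<chi>. Jensen's inequality then replaces the sum over the pairs (a, j) by an average, so a
  single uniform bound for one block suffices and the total weight enters as W^(2k).\<close>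

lemma exponential_sum_moment_smooth:
  fixes k l :: nat
  assumes k: "k \<ge> 3" and l: "k \<le> 2 ^ l"
  shows "\<exists>D. \<forall>q\<ge>D. \<forall>N v \<alpha>. real N \<le> real q powr 0.55 \<longrightarrow> (\<forall>h\<ge>1. norm (v h) \<le> 1 / real h) \<longrightarrow>
    (\<Sum>\<chi> | dirichlet_char q \<chi>. norm (\<Sum>h\<in>{1..N}. v h * \<chi> h * cis (2 * pi * (real h * \<alpha> \<chi>))) ^ (2 * k))
      \<le> real (totient q) * (2 ^ 40 * real l ^ 4) ^ k"
proof -
  have l1: "l \<ge> 1" using k l by (cases l) auto
  show ?thesis
  proof (rule exE[OF block_combined[OF k]], goal_cases)
    case (1 D)
    note D = this[rule_format]
    show ?case
    proof (intro exI[of _ "max D 1"] allI impI)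
      fix q N :: nat and v :: "nat \<Rightarrow> complex" and \<alpha> :: "(nat \<Rightarrow> complex) \<Rightarrow> real"
      assume q: "q \<ge> max D 1" and N: "real N \<le> real q powr 0.55" and v: "\<forall>h\<ge>1. norm (v h) \<le> 1 / real h"
      have q0: "q > 0" using q by simp
      define y :: nat where "y = 16 ^ l"
      define A where "A = smooth_upto y N"
      define J where "J = {j\<in>{l..<N}. 16 ^ j < N}"
      define R where "R a j = {b\<in>rough_upto y (N div a). 16 ^ j < b \<and> b \<le> 16 ^ (j+1)}" for a j
      \<comment> \<open>Scaled by \<open>a\<close> so that the bound 1/(ab) for \<open>v\<close>
        becomes 1/b.\<close>
      define u where "u a b = of_nat a * v (a * b)" for a b
      define F where "F a j \<chi> = norm (\<Sum>b\<in>R a j. u a b * \<chi> b * cis (2 * pi * (real b * (real a * \<alpha> \<chi>))))" for a j \<chi>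
      define V where "V \<chi> = (\<Sum>h\<in>{1..N}. v h * \<chi> h * cis (2 * pi * (real h * \<alpha> \<chi>)))" for \<chi>
      define L where "L = (\<Sum>a\<in>A. 1 / real a)"
      \<comment> \<open>The factor 1/j^2 makes the weights summable over the blocks; it is paid back
        by the j^2 in \<open>block_combined\<close>.\<close>
      define w where "w p = 1 / (real (fst p) * real (snd p) ^ 2)" for p :: "nat \<times> nat"
      define X where "X = {\<chi>. dirichlet_char q \<chi>}"
      have fin: "finite A" "finite J" "finite (A \<times> J)" "finite X"
        by (auto simp: A_def J_def smooth_upto_def X_def finite_dirichlet_chars)
      have A1: "a \<ge> 1" if "a \<in> A" for a using that by (simp add: A_def smooth_upto_def)
      have J1: "j \<ge> 1" if "j \<in> J" for j using that l1 by (simp add: J_def)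
      have nonneg: "w p \<ge> 0" for p by (simp add: w_def)
      have u_le: "norm (u a b) \<le> 1 / real b" if "a \<ge> 1" "b \<ge> 1" for a b
      proof -
        have "norm (u a b) \<le> real a * (1 / real (a * b))"
          unfolding u_def norm_mult norm_of_nat
          using that v[rule_format, of "a * b"] by (intro mult_left_mono) auto
        thus ?thesis using that by simp
      qed
      have L: "0 \<le> L" "L \<le> 48 * real l ^ 2"
      proof -
        \<comment> \<open>Smoothness up to 2^(4l) gives 3 (4l)^2 = 48 l^2.\<close>
        have "y = 2 ^ (4 * l)" by (simp add: y_def power_mult)
        hence "L \<le> 3 * real (4 * l) ^ 2"
          unfolding L_def A_def using l1 by (simp only:) (rule sum_inverse_smooth_le, simp)
        thus "L \<le> 48 * real l ^ 2" by (simp add: power_mult_distrib)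
      qed (auto simp: L_def intro: sum_nonneg)
      have W: "(\<Sum>p\<in>A \<times> J. w p) \<le> 2 * L"
      proof -
        have "(\<Sum>p\<in>A \<times> J. w p) = L * (\<Sum>j\<in>J. 1 / real j ^ 2)"
          by (simp add: L_def w_def sum_product sum.cartesian_product case_prod_unfold)
        also have "\<dots> \<le> L * 2"
        proof (intro mult_left_mono L)
          have "(\<Sum>j\<in>J. 1 / real j ^ 2) \<le> (\<Sum>j\<in>{1..<N}. 1 / real j ^ 2)"
            using l1 by (intro sum_mono2) (auto simp: J_def)
          also have "\<dots> \<le> 2" by (rule sum_inverse_squares_le)
          finally show "(\<Sum>j\<in>J. 1 / real j ^ 2) \<le> 2" .
        qed
        finally show ?thesis by simp
      qed
      have V_le: "norm (V \<chi>) \<le> L + (\<Sum>p\<in>A \<times> J. w p * (real (snd p) ^ 2 * F (fst p) (snd p) \<chi>))"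
        if \<chi>: "\<chi> \<in> X" for \<chi>
      proof -
        have \<chi>': "dirichlet_char q \<chi>" using \<chi> by (simp add: X_def)
        define T where "T a b = u a b * \<chi> b * cis (2 * pi * (real b * (real a * \<alpha> \<chi>)))" for a b
        have inner: "norm (\<Sum>b\<in>rough_upto y (N div a). T a b) \<le> 1 + (\<Sum>j\<in>J. F a j \<chi>)" if a: "a \<in> A" for a
        proof -
          have a1: "a \<ge> 1" "N div a \<ge> 1"
            using a by (auto simp: A_def smooth_upto_def div_greater_zero_iff Suc_le_eq)
          have finr: "finite (rough_upto y (N div a))" by (simp add: rough_upto_def)
          have one: "1 \<in> rough_upto y (N div a)"
            using a1 by (auto simp: rough_upto_def)
          have "(\<Sum>b\<in>rough_upto y (N div a). T a b) = T a 1 + (\<Sum>b\<in>rough_upto y (N div a) - {1}. T a b)"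
            by (rule sum.remove[OF finr one])
          also have "(\<Sum>b\<in>rough_upto y (N div a) - {1}. T a b)
              = (\<Sum>j\<in>{j\<in>{l..<N div a}. 16 ^ j < N div a}. \<Sum>b\<in>R a j. T a b)"
            unfolding y_def R_def by (rule sum_rough_blocks)
          finally have eq: "(\<Sum>b\<in>rough_upto y (N div a). T a b) = T a 1 + \<dots>" .
          \<comment> \<open>The term b = 1 lies in no block; summed over \<open>a\<close> with
            weight 1/a it yields the separate \<open>L\<close>.\<close>
          have "norm (T a 1) \<le> 1 * 1 * 1"
            unfolding T_def norm_mult
            using u_le[OF a1(1), of 1] by (intro mult_mono norm_dirichlet_char_le_1[OF \<chi>']) auto
          moreover have "norm (\<Sum>j\<in>{j\<in>{l..<N div a}. 16 ^ j < N div a}. \<Sum>b\<in>R a j. T a b)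
              \<le> (\<Sum>j\<in>{j\<in>{l..<N div a}. 16 ^ j < N div a}. F a j \<chi>)"
            unfolding F_def T_def by (rule norm_sum)
          \<comment> \<open>The range of blocks depends on \<open>a\<close> through
            \<open>N div a\<close>. Enlarging it to \<open>J\<close> only adds nonnegative terms and
            makes the index set a product.\<close>
          moreover have "\<dots> \<le> (\<Sum>j\<in>J. F a j \<chi>)"
            by (intro sum_mono2 fin) (auto simp: J_def F_def intro: less_le_trans[OF _ div_le_dividend])
          ultimately show ?thesis unfolding eq
            by (intro order.trans[OF norm_triangle_ineq]) linarith
        qed
        have "V \<chi> = (\<Sum>a\<in>A. \<Sum>b\<in>rough_upto y (N div a). v (a * b) * \<chi> (a * b) * cis (2 * pi * (real (a * b) * \<alpha> \<chi>)))"
          unfolding V_def A_def by (rule sum_smooth_rough)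
        also have "\<dots> = (\<Sum>a\<in>A. of_real (1 / real a) * \<chi> a * (\<Sum>b\<in>rough_upto y (N div a). T a b))"
          unfolding sum_distrib_left
        proof (intro sum.cong refl)
          fix a b assume "a \<in> A"
          hence "a \<noteq> 0" using A1 by force
          thus "v (a * b) * \<chi> (a * b) * cis (2 * pi * (real (a * b) * \<alpha> \<chi>)) = of_real (1 / real a) * \<chi> a * T a b"
            by (simp add: T_def u_def dirichlet_char_mult[OF \<chi>'] mult_ac)
        qed
        also have "norm \<dots> \<le> (\<Sum>a\<in>A. 1 / real a * (1 + (\<Sum>j\<in>J. F a j \<chi>)))"
        proof (rule sum_norm_le)
          fix a assume a: "a \<in> A"
          have "norm (of_real (1 / real a) * \<chi> a * (\<Sum>b\<in>rough_upto y (N div a). T a b))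
              \<le> 1 / real a * 1 * (1 + (\<Sum>j\<in>J. F a j \<chi>))"
            unfolding norm_mult norm_of_real
            by (intro mult_mono inner a norm_dirichlet_char_le_1[OF \<chi>']) auto
          thus "norm (of_real (1 / real a) * \<chi> a * (\<Sum>b\<in>rough_upto y (N div a). T a b))
              \<le> 1 / real a * (1 + (\<Sum>j\<in>J. F a j \<chi>))" by simp
        qed
        also have "\<dots> = L + (\<Sum>a\<in>A. \<Sum>j\<in>J. 1 / real a * F a j \<chi>)"
          by (simp add: L_def distrib_left sum.distrib sum_distrib_left)
        also have "(\<Sum>a\<in>A. \<Sum>j\<in>J. 1 / real a * F a j \<chi>)
            = (\<Sum>p\<in>A \<times> J. w p * (real (snd p) ^ 2 * F (fst p) (snd p) \<chi>))"
          unfolding sum.cartesian_product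
        proof (intro sum.cong refl)
          fix p assume "p \<in> A \<times> J"
          hence "snd p \<noteq> 0" using J1 by force
          thus "(case p of (a, j) \<Rightarrow> 1 / real a * F a j \<chi>) = w p * (real (snd p) ^ 2 * F (fst p) (snd p) \<chi>)"
            by (simp add: case_prod_unfold w_def)
        qed
        finally show ?thesis .
      qed
      define W where "W = (\<Sum>p\<in>A \<times> J. w p)"
      have W: "0 \<le> W" "W \<le> 2 * L" using W nonneg by (auto simp: W_def intro: sum_nonneg)
      define \<phi> where "\<phi> = real (totient q)"
      have \<phi>: "\<phi> \<ge> 0" by (simp add: \<phi>_def)
      have "(\<Sum>\<chi>\<in>X. norm (V \<chi>) ^ (2 * k)) \<le>
        (\<Sum>\<chi>\<in>X. 2 ^ (2*k) * (L ^ (2*k) + W ^ (2*k-1) * (\<Sum>p\<in>A \<times> J. w p * (real (snd p) ^ 2 * F (fst p) (snd p) \<chi>) ^ (2 * k))))"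
      proof (rule sum_mono)
        fix \<chi> assume \<chi>: "\<chi> \<in> X"
        have Fn: "0 \<le> F a j \<chi>" for a j by (simp add: F_def)
        have "norm (V \<chi>) ^ (2 * k) \<le> (L + (\<Sum>p\<in>A \<times> J. w p * (real (snd p) ^ 2 * F (fst p) (snd p) \<chi>))) ^ (2 * k)"
          by (intro power_mono V_le \<chi>) auto
        also have "\<dots> \<le> 2 ^ (2*k) * (L ^ (2*k) + (\<Sum>p\<in>A \<times> J. w p * (real (snd p) ^ 2 * F (fst p) (snd p) \<chi>)) ^ (2*k))"
          by (intro power_add_le L sum_nonneg mult_nonneg_nonneg nonneg Fn) auto
        also have "(\<Sum>p\<in>A \<times> J. w p * (real (snd p) ^ 2 * F (fst p) (snd p) \<chi>)) ^ (2*k)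
            \<le> W ^ (2*k-1) * (\<Sum>p\<in>A \<times> J. w p * (real (snd p) ^ 2 * F (fst p) (snd p) \<chi>) ^ (2 * k))"
          unfolding W_def using k by (intro weighted_power_mean fin nonneg) auto
        finally show "norm (V \<chi>) ^ (2 * k) \<le> 2 ^ (2*k) * (L ^ (2*k) + W ^ (2*k-1) * (\<Sum>p\<in>A \<times> J. w p * (real (snd p) ^ 2 * F (fst p) (snd p) \<chi>) ^ (2 * k)))"
          by simp
      qed
      also have "\<dots> = 2 ^ (2*k) * (card X * L ^ (2*k) + W ^ (2*k-1) * (\<Sum>p\<in>A \<times> J. w p * (\<Sum>\<chi>\<in>X. (real (snd p) ^ 2 * F (fst p) (snd p) \<chi>) ^ (2 * k))))"
        unfolding sum_distrib_left[symmetric] sum.distrib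
        by (subst sum.swap) (simp add: sum_distrib_left)
      also have "\<dots> \<le> 2 ^ (2*k) * (\<phi> * L ^ (2*k) + W ^ (2*k-1) * (\<Sum>p\<in>A \<times> J. w p * (\<phi> * (2 ^ 23) ^ k)))"
      proof (intro mult_left_mono add_mono mult_right_mono sum_mono)
        show "real (card X) \<le> \<phi>" using card_dirichlet_chars_le[OF q0] by (simp add: X_def \<phi>_def)
        fix p assume p: "p \<in> A \<times> J"
        obtain a j where p_eq: "p = (a, j)" by (cases p)
        have aj: "a \<in> A" "j \<in> J" using p p_eq by auto
        show "(\<Sum>\<chi>\<in>X. (real (snd p) ^ 2 * F (fst p) (snd p) \<chi>) ^ (2 * k)) \<le> \<phi> * (2 ^ 23) ^ k"
          unfolding p_eq fst_conv snd_conv F_def X_def \<phi>_def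
        proof (rule D[where l = l and N = N])
          show "R a j \<subseteq> {16 ^ j<..16 ^ (j+1)}" by (auto simp: R_def)
          show "16 ^ l < p" if "b \<in> R a j" "prime p" "p dvd b" for b p
            using that by (auto simp: R_def rough_upto_def y_def)
          show "norm (u a b) \<le> 1 / real b" if "b \<in> R a j" for b
            using that u_le[OF A1[OF aj(1)]] by (auto simp: R_def rough_upto_def)
        qed (use q N aj l in \<open>auto simp: J_def\<close>)
      qed (use L W nonneg in auto)
      also have "W ^ (2*k-1) * (\<Sum>p\<in>A \<times> J. w p * (\<phi> * (2 ^ 23) ^ k)) = W ^ (2*k) * (\<phi> * (2 ^ 23) ^ k)"
      proof -
        have "W ^ (2*k) = W ^ (2*k-1) * W" using k by (metis power_minus_mult mult_pos_pos zero_less_numeral not_gr0 not_numeral_le_zero)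
        thus ?thesis by (simp add: W_def sum_distrib_right)
      qed
      also have "2 ^ (2*k) * (\<phi> * L ^ (2*k) + W ^ (2*k) * (\<phi> * (2 ^ 23) ^ k))
          \<le> 2 ^ (2*k) * (\<phi> * (48 * real l ^ 2) ^ (2*k) + (2 * (48 * real l ^ 2)) ^ (2*k) * (\<phi> * (2 ^ 23) ^ k))"
        using L W \<phi> by (intro mult_left_mono add_mono mult_right_mono power_mono) auto
      also have "2 ^ (2*k) * (\<phi> * z ^ (2*k) + (2 * z) ^ (2*k) * (\<phi> * c)) = \<phi> * (z ^ (2*k) * (2 ^ (2*k) * (1 + 2 ^ (2*k) * c)))" for z c
        by (simp only: power_mult_distrib) (simp add: algebra_simps)
      \<comment> \<open>Rounding 48 up to 64 gives the constant 64^2 * 2^28 = 2^40.\<close>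
      also have "\<phi> * ((48 * real l ^ 2) ^ (2*k) * (2 ^ (2*k) * (1 + 2 ^ (2*k) * (2 ^ 23) ^ k))) \<le> \<phi> * ((64 * real l ^ 2) ^ (2*k) * (2 ^ 28) ^ k)"
      proof (intro mult_left_mono[OF _ \<phi>] mult_mono power_mono)
        have e: "(2::real) ^ (2 * k) = 4 ^ k" by (simp add: power_mult)
        have "(1::real) \<le> 4 ^ k * (2 ^ 23) ^ k" by (simp flip: power_mult_distrib)
        hence "4 ^ k * (1 + 4 ^ k * (2 ^ 23) ^ k) \<le> 4 ^ k * (2 * (4 ^ k * (2 ^ 23) ^ k :: real))"
          by (intro mult_left_mono) auto
        also have "(2::real) \<le> 2 ^ k" using k power_increasing[of 1 k "2::real"] by simp
        hence "4 ^ k * (2 * (4 ^ k * (2 ^ 23) ^ k)) \<le> 4 ^ k * (2 ^ k * (4 ^ k * (2 ^ 23) ^ k :: real))"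
          by (intro mult_left_mono mult_right_mono) auto
        also have "\<dots> = (2 ^ 28) ^ k" by (simp flip: power_mult_distrib)
        finally show "2 ^ (2*k) * (1 + 2 ^ (2*k) * (2 ^ 23) ^ k) \<le> ((2 ^ 28) ^ k :: real)" unfolding e .
      qed auto
      also have "(64 * real l ^ 2) ^ (2*k) * (2 ^ 28) ^ k = (2 ^ 40 * real l ^ 4) ^ k"
      proof -
        have "(64 * real l ^ 2) ^ (2*k) * (2 ^ 28) ^ k = ((64 * real l ^ 2) ^ 2 * 2 ^ 28) ^ k"
          by (simp only: power_mult_distrib power_mult)
        also have "(64 * real l ^ 2) ^ 2 * 2 ^ 28 = 2 ^ 40 * real l ^ 4"
          by (simp add: power_mult_distrib)
        finally show ?thesis .
      qed
      finally show "(\<Sum>\<chi> | dirichlet_char q \<chi>. norm (\<Sum>h\<in>{1..N}. v h * \<chi> h * cis (2 * pi * (real h * \<alpha> \<chi>))) ^ (2 * k))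
        \<le> real (totient q) * (2 ^ 40 * real l ^ 4) ^ k"
        by (simp add: V_def X_def \<phi>_def)
    qed
  qed
qed

section \<open>A smoothed Polya inequality for primitive characters\<close>

text \<open>Jordan's inequality: the sine is concave on this interval and lies above its
  chord.\<close>

lemma sin_ge_linear:
  assumes "0 \<le> t" "t \<le> pi / 2"
  shows "2 * t / pi \<le> sin t"
proof -
  have conv: "convex_on {0..pi/2} (\<lambda>x. - sin x)"
  proof (rule f''_ge0_imp_convex)
    fix x :: real assume x: "x \<in> {0..pi/2}"
    show "((\<lambda>x. - sin x) has_real_derivative - cos x) (at x)" by (auto intro!: derivative_eq_intros)
    show "((\<lambda>x. - cos x) has_real_derivative sin x) (at x)" by (auto intro!: derivative_eq_intros)
    show "sin x \<ge> 0" using x by (intro sin_ge_zero) auto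
  qed auto
  define c where "c = 2 * t / pi"
  have l: "0 \<le> c" "c \<le> 1" using assms by (auto simp: c_def field_simps)
  have "- sin ((1 - c) *\<^sub>R 0 + c *\<^sub>R (pi / 2)) \<le> (1 - c) * (- sin 0) + c * (- sin (pi / 2))"
    using l by (intro convex_onD[OF conv]) auto
  moreover have "c * (pi / 2) = t" by (simp add: c_def)
  ultimately show ?thesis by (simp add: c_def)
qed

text \<open>\<open>min h (q - h) / q\<close> is the distance from h/q to the nearest integer, at
  most 1/2, so Jordan's inequality bounds 2 |sin (pi h / q)| from below.\<close>

lemma norm_one_minus_cis_ge:
  fixes q h :: nat
  assumes "h < q"
  shows "4 * real (min h (q - h)) / real q \<le> norm (1 - cis (- (2 * pi * (real h / real q))))"
proof -
  define m where "m = min h (q - h)"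
  define t where "t = pi * (real m / real q)"
  have m: "2 * real m \<le> real q" using assms by (auto simp: m_def min_def)
  have t: "0 \<le> t" "t \<le> pi / 2" using m assms by (auto simp: t_def field_simps)
  have "\<bar>sin (- (2 * pi * (real h / real q)) / 2)\<bar> = \<bar>sin t\<bar>"
  proof (cases "h \<le> q - h")
    case True
    thus ?thesis by (simp add: t_def m_def)
  next
    case False
    have "sin t = sin (pi - pi * (real h / real q))"
      using False assms by (simp add: t_def m_def min_def field_simps of_nat_diff)
    also have "\<dots> = sin (pi * (real h / real q))" by simp
    finally show ?thesis by simp
  qed
  hence "norm (1 - cis (- (2 * pi * (real h / real q)))) = 2 * \<bar>sin t\<bar>"
    by (simp only: norm_one_minus_cis)
  moreover have "2 * t / pi \<le> sin t" by (rule sin_ge_linear[OF t])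
  moreover have "2 * (2 * t / pi) = 4 * real m / real q" by (simp add: t_def)
  ultimately show ?thesis unfolding m_def by linarith
qed

section \<open>Gauss sums and the Fourier expansion of primitive characters\<close>

lemma cis_2pi_mod:
  assumes "q > (0::nat)"
  shows "cis (2 * pi * (real (n mod q) / real q)) = cis (2 * pi * (real n / real q))"
proof -
  have "real n = real q * real (n div q) + real (n mod q)"
    by (metis mult_div_mod_eq of_nat_add of_nat_mult)
  hence "2 * pi * (real n / real q) = 2 * pi * (real (n mod q) / real q) + 2 * pi * real_of_int (int (n div q))"
    using assms by (simp add: field_simps)
  hence "cis (2 * pi * (real n / real q)) = cis (2 * pi * (real (n mod q) / real q)) * cis (2 * pi * real_of_int (int (n div q)))"
    by (simp only: cis_mult)
  also have "cis (2 * pi * real_of_int (int (n div q))) = 1"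
    by (rule cis_multiple_2pi) (rule Ints_of_int)
  finally show ?thesis by simp
qed

definition gauss_sum :: "nat \<Rightarrow> (nat \<Rightarrow> complex) \<Rightarrow> nat \<Rightarrow> complex" where
  "gauss_sum q \<chi> h = (\<Sum>n<q. \<chi> n * cis (2 * pi * (real (h * n) / real q)))"

text \<open>The vanishing of the Gauss sums at non-units characterizes primitivity and is the only
  consequence of it needed below.\<close>

definition primitive_char :: "nat \<Rightarrow> (nat \<Rightarrow> complex) \<Rightarrow> bool" where
  "primitive_char q \<chi> \<longleftrightarrow> dirichlet_char q \<chi> \<and> (\<forall>h. \<not> coprime h q \<longrightarrow> gauss_sum q \<chi> h = 0)"

lemma sum_mult_mod:
  fixes f :: "nat \<Rightarrow> complex"
  assumes q: "q > 0" and cop: "coprime a q"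
  shows "(\<Sum>n<q. f ((a * n) mod q)) = (\<Sum>n<q. f n)"
proof -
  have inj: "inj_on (\<lambda>n. (a * n) mod q) {..<q}"
  proof (rule inj_onI)
    fix x y assume xy: "x \<in> {..<q}" "y \<in> {..<q}" "(a * x) mod q = (a * y) mod q"
    have "[a * x = a * y] (mod q)" using xy(3) by (simp add: unique_euclidean_semiring_class.cong_def)
    hence "[x = y] (mod q)" using cop cong_mult_lcancel_nat by blast
    thus "x = y" using xy by (simp add: unique_euclidean_semiring_class.cong_def)
  qed
  have img: "(\<lambda>n. (a * n) mod q) ` {..<q} = {..<q}"
    by (rule endo_inj_surj[OF _ _ inj]) (use q in auto)
  show ?thesis using sum.reindex[OF inj, of f] img by (simp add: o_def)
qed

text \<open>Multiplication by the unit \<open>a\<close> permutes the residues over which the Gauss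
  sum runs.\<close>

lemma gauss_sum_mult:
  assumes \<chi>: "dirichlet_char q \<chi>" and cop: "coprime a q"
  shows "\<chi> a * gauss_sum q \<chi> (h * a) = gauss_sum q \<chi> h"
proof -
  have q: "q > 0" using dirichlet_char_pos[OF \<chi>] .
  have "gauss_sum q \<chi> h = (\<Sum>n<q. \<chi> ((a * n) mod q) * cis (2 * pi * (real (h * ((a * n) mod q)) / real q)))"
    unfolding gauss_sum_def by (rule sum_mult_mod[OF q cop, symmetric])
  also have "\<dots> = (\<Sum>n<q. \<chi> a * (\<chi> n * cis (2 * pi * (real (h * a * n) / real q))))"
  proof (intro sum.cong refl)
    fix n
    have "cis (2 * pi * (real (h * ((a * n) mod q)) / real q)) = cis (2 * pi * (real ((h * ((a * n) mod q)) mod q) / real q))"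
      by (rule cis_2pi_mod[OF q, symmetric])
    also have "(h * ((a * n) mod q)) mod q = (h * a * n) mod q" by (simp add: mod_mult_right_eq mult.assoc)
    also have "cis (2 * pi * (real ((h * a * n) mod q) / real q)) = cis (2 * pi * (real (h * a * n) / real q))"
      by (rule cis_2pi_mod[OF q])
    finally show "\<chi> ((a * n) mod q) * cis (2 * pi * (real (h * ((a * n) mod q)) / real q)) = \<chi> a * (\<chi> n * cis (2 * pi * (real (h * a * n) / real q)))"
      by (simp add: dirichlet_char_mod[OF \<chi>] dirichlet_char_mult[OF \<chi>])
  qed
  also have "\<dots> = \<chi> a * gauss_sum q \<chi> (h * a)" by (simp add: gauss_sum_def sum_distrib_left)
  finally show ?thesis by simp
qed

text \<open>For a unit \<open>h\<close> this is \<open>gauss_sum_mult\<close>; otherwise both sides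
  vanish, the left one by primitivity.\<close>

lemma gauss_sum_primitive:
  assumes "primitive_char q \<chi>"
  shows "gauss_sum q \<chi> h = cnj (\<chi> h) * gauss_sum q \<chi> 1"
proof -
  have \<chi>: "dirichlet_char q \<chi>" using assms by (simp add: primitive_char_def)
  show ?thesis
  proof (cases "coprime h q")
    case True
    have "cnj (\<chi> h) * gauss_sum q \<chi> 1 = (\<chi> h * cnj (\<chi> h)) * gauss_sum q \<chi> (1 * h)"
      using gauss_sum_mult[OF \<chi> True, of 1] by (simp add: mult_ac)
    thus ?thesis using dirichlet_char_cnj_mult_self[OF \<chi>, of h] True by simp
  next
    case False
    thus ?thesis using assms dirichlet_char_eq_0_iff[OF \<chi>, of h] by (simp add: primitive_char_def)
  qed
qed

lemma sum_cis_orthogonality: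
  fixes m n q :: nat
  assumes "m < q" "n < q"
  shows "(\<Sum>h<q. cis (2 * pi * (real (h * m) / real q)) * cis (- (2 * pi * (real (h * n) / real q)))) = (if m = n then of_nat q else 0)"
proof (cases "m = n")
  case True
  thus ?thesis by (simp add: cis_mult)
next
  case False
  define z where "z = cis (2 * pi * (real m / real q)) * cis (- (2 * pi * (real n / real q)))"
  have z: "z = cis (2 * pi * ((real m - real n) / real q))"
    by (simp add: z_def cis_mult diff_divide_distrib right_diff_distrib)
  have "(\<Sum>h<q. cis (2 * pi * (real (h * m) / real q)) * cis (- (2 * pi * (real (h * n) / real q)))) = (\<Sum>h<q. z ^ h)"
    by (intro sum.cong refl) (simp add: z_def power_mult_distrib Complex.DeMoivre mult_ac)
  also have "\<dots> = (z ^ q - 1) / (z - 1)"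
  proof (rule geometric_sum)
    \<comment> \<open>1 - z has the same modulus as for the residue d = |m - n|, and the lower bound
      by the distance to the nearest integer shows that it does not vanish.\<close>
    define d where "d = (if m < n then n - m else m - n)"
    have d: "0 < d" "d < q" using assms False by (auto simp: d_def)
    have "0 < 4 * real (min d (q - d)) / real q" using d by auto
    hence nz: "norm (1 - cis (- (2 * pi * (real d / real q)))) > 0"
      using norm_one_minus_cis_ge[OF d(2)] by linarith
    have "norm (1 - z) = norm (1 - cis (- (2 * pi * (real d / real q))))"
    proof (cases "m < n")
      case True
      hence "2 * pi * ((real m - real n) / real q) = - (2 * pi * (real d / real q))"
        by (simp add: d_def of_nat_diff diff_divide_distrib right_diff_distrib)
      thus ?thesis unfolding z by (simp only:)
    next
      case False
      have "\<bar>sin (2 * pi * ((real m - real n) / real q) / 2)\<bar> = \<bar>sin (- (2 * pi * ((real m - real n) / real q)) / 2)\<bar>"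
        by simp
      thus ?thesis unfolding z using False by (simp add: d_def of_nat_diff norm_one_minus_cis)
    qed
    thus "z \<noteq> 1" using nz by auto
  qed
  also have "z ^ q = 1"
  proof -
    have "z ^ q = cis (2 * pi * real_of_int (int m - int n))"
      unfolding z using assms by (simp add: Complex.DeMoivre)
    also have "\<dots> = 1" by (rule cis_multiple_2pi) (rule Ints_of_int)
    finally show ?thesis .
  qed
  finally show ?thesis using False by simp
qed

text \<open>Fourier inversion on the residues, with g = \<tau>/q for the Gauss sum \<tau>. Only the
  modulus of \<open>g\<close> matters afterwards.\<close>

lemma primitive_char_expansion:
  assumes prim: "primitive_char q \<chi>" and q: "q > 1"
  obtains g where "norm g = 1 / sqrt (real q)"
    "\<And>n. \<chi> n = g * (\<Sum>h\<in>{1..<q}. cnj (\<chi> h) * cis (- (2 * pi * (real h / real q))) ^ n)"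
proof -
  have \<chi>: "dirichlet_char q \<chi>" using prim by (simp add: primitive_char_def)
  define \<tau> where "\<tau> = gauss_sum q \<chi> 1"
  define S where "S n = (\<Sum>h<q. cnj (\<chi> h) * cis (- (2 * pi * (real (h * n) / real q))))" for n
  have inv: "of_nat q * \<chi> n = \<tau> * S n" if n: "n < q" for n
  proof -
    have "\<tau> * S n = (\<Sum>h<q. gauss_sum q \<chi> h * cis (- (2 * pi * (real (h * n) / real q))))"
      unfolding S_def sum_distrib_left
    proof (intro sum.cong refl)
      fix h
      show "\<tau> * (cnj (\<chi> h) * cis (- (2 * pi * (real (h * n) / real q)))) = gauss_sum q \<chi> h * cis (- (2 * pi * (real (h * n) / real q)))"
        using gauss_sum_primitive[OF prim, of h] by (simp add: \<tau>_def mult_ac)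
    qed
    also have "\<dots> = (\<Sum>h<q. \<Sum>m<q. \<chi> m * (cis (2 * pi * (real (h * m) / real q)) * cis (- (2 * pi * (real (h * n) / real q)))))"
      unfolding gauss_sum_def sum_distrib_right by (simp only: mult.assoc)
    also have "\<dots> = (\<Sum>m<q. \<chi> m * (\<Sum>h<q. cis (2 * pi * (real (h * m) / real q)) * cis (- (2 * pi * (real (h * n) / real q)))))"
      unfolding sum_distrib_left by (rule sum.swap)
    also have "\<dots> = (\<Sum>m<q. \<chi> m * (if m = n then of_nat q else 0))"
      by (intro sum.cong refl) (use n in \<open>simp only: sum_cis_orthogonality lessThan_iff\<close>)
    also have "\<dots> = (\<Sum>m<q. if m = n then \<chi> m * of_nat q else 0)" by (intro sum.cong) auto
    also have "\<dots> = \<chi> n * of_nat q" using n by (subst sum.delta) auto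
    finally show ?thesis by (simp add: mult.commute)
  qed
  \<comment> \<open>Inversion at n = 1 reads q = \<tau> * cnj \<tau>, which gives |\<tau>| = sqrt
    q.\<close>
  have "S 1 = cnj \<tau>"
    by (simp add: S_def \<tau>_def gauss_sum_def cis_cnj)
  hence "of_nat q = \<tau> * cnj \<tau>" using inv[of 1] q dirichlet_char_1[OF \<chi>] by simp
  hence "complex_of_real (real q) = of_real (norm \<tau> ^ 2)" using complex_norm_square[of \<tau>] by simp
  hence "real q = norm \<tau> ^ 2" by (simp only: of_real_eq_iff)
  hence norm: "norm \<tau> = sqrt (real q)" by (metis norm_ge_zero real_sqrt_unique)
  show ?thesis
  proof
    show "norm (\<tau> / of_nat q) = 1 / sqrt (real q)"
      using q by (simp add: norm_divide norm real_div_sqrt field_simps)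
    fix n
    have cis_pow: "cis (- (2 * pi * (real h / real q))) ^ n = cis (- (2 * pi * (real (h * n) / real q)))" for h n
      by (simp add: Complex.DeMoivre mult_ac)
    have period: "cis (- (2 * pi * (real (h * (n mod q)) / real q))) = cis (- (2 * pi * (real (h * n) / real q)))" for h
      using cis_2pi_mod[of q "h * (n mod q)"] cis_2pi_mod[of q "h * n"] q unfolding cis_cnj[symmetric]
      by (simp only: mod_mult_right_eq)
    have "\<chi> n = \<chi> (n mod q)" using dirichlet_char_mod[OF \<chi>] by simp
    also have "\<dots> = (\<tau> / of_nat q) * S (n mod q)"
      using inv[of "n mod q"] q by (simp add: field_simps)
    also have "S (n mod q) = (\<Sum>h<q. cnj (\<chi> h) * cis (- (2 * pi * (real (h * n) / real q))))"
      unfolding S_def period ..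
    also have "\<dots> = (\<Sum>h\<in>{1..<q}. cnj (\<chi> h) * cis (- (2 * pi * (real (h * n) / real q))))"
    proof (rule sum.mono_neutral_right)
      show "\<forall>h\<in>{..<q} - {1..<q}. cnj (\<chi> h) * cis (- (2 * pi * (real (h * n) / real q))) = 0"
        using dirichlet_char_eq_0_iff[OF \<chi>, of 0] q by (auto simp: Suc_le_eq)
    qed auto
    finally show "\<chi> n = (\<tau> / of_nat q) * (\<Sum>h\<in>{1..<q}. cnj (\<chi> h) * cis (- (2 * pi * (real h / real q))) ^ n)"
      unfolding cis_pow .
  qed
qed

text \<open>The \<open>h\<close>-th Fourier coefficient after averaging over the translates by \<open>j < H\<close>. The average
  makes it decay like \<open>1 / h\<^sup>2\<close> instead of \<open>1 / h\<close>.\<close>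

definition polya_weight :: "nat \<Rightarrow> nat \<Rightarrow> nat \<Rightarrow> complex" where
  "polya_weight q H h = (let z = cis (- (2 * pi * (real h / real q))) in
     (\<Sum>j<H. z ^ j) / of_nat H * (z / (1 - z)))"

text \<open>The mean of \<open>H\<close> numbers of modulus 1 is at most 1, which gives the first
  bound; as a geometric sum it is also at most 2 / (H |1 - z|), which gives the second. Both use |1
  - z| >= 4m/q.\<close>

lemma polya_weight_bounds:
  assumes h: "1 \<le> h" "h < q" and H: "H > 0"
  defines "m \<equiv> real (min h (q - h))"
  shows "norm (polya_weight q H h) \<le> real q / (4 * m)"
    and "norm (polya_weight q H h) \<le> real q ^ 2 / (8 * real H * m ^ 2)"
proof -
  define z where "z = cis (- (2 * pi * (real h / real q)))"
  have m: "m > 0" using h by (simp add: m_def)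
  have q: "real q > 0" using h by simp
  have nz: "4 * m / real q \<le> norm (1 - z)"
    unfolding m_def z_def by (rule norm_one_minus_cis_ge[OF h(2)])
  have pos: "0 < 4 * m / real q" using m q by simp
  have z1: "z \<noteq> 1" using nz pos by auto
  have inv: "1 / norm (1 - z) \<le> 1 / (4 * m / real q)"
    using pos nz by (intro frac_le) auto
  have nw: "norm (polya_weight q H h) = norm (\<Sum>j<H. z ^ j) / real H * (1 / norm (1 - z))"
    by (simp add: polya_weight_def Let_def z_def norm_mult norm_divide)
  have "norm (\<Sum>j<H. z ^ j) \<le> (\<Sum>j<H. 1)"
    by (rule sum_norm_le) (simp add: z_def norm_power)
  hence "norm (\<Sum>j<H. z ^ j) / real H \<le> 1" using H by simp
  hence "norm (polya_weight q H h) \<le> 1 * (1 / norm (1 - z))"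
    unfolding nw by (intro mult_right_mono) auto
  also have "\<dots> \<le> 1 * (1 / (4 * m / real q))"
    using inv by simp
  finally show "norm (polya_weight q H h) \<le> real q / (4 * m)" by simp
  have "norm (\<Sum>j<H. z ^ j) \<le> 2 / norm (1 - z)"
  proof -
    have "(\<Sum>j<H. z ^ j) = (z ^ H - 1) / (z - 1)" by (rule geometric_sum[OF z1])
    hence "norm (\<Sum>j<H. z ^ j) = norm (z ^ H - 1) / norm (1 - z)"
      by (simp add: norm_divide norm_minus_commute)
    also have "norm (z ^ H - 1) \<le> norm (z ^ H) + norm (1::complex)" by (rule norm_triangle_ineq4)
    also have "\<dots> = 2" by (simp add: z_def norm_power)
    finally show ?thesis by (simp add: divide_right_mono)
  qed
  hence "norm (polya_weight q H h) \<le> 2 / norm (1 - z) / real H * (1 / norm (1 - z))"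
    unfolding nw by (intro mult_right_mono divide_right_mono) auto
  also have "\<dots> = 2 / real H * (1 / norm (1 - z)) ^ 2"
    by (simp add: power2_eq_square)
  also have "\<dots> \<le> 2 / real H * (1 / (4 * m / real q)) ^ 2"
    by (intro mult_left_mono power_mono inv) auto
  also have "\<dots> = real q ^ 2 / (8 * real H * m ^ 2)"
    using m q by (simp add: field_simps power2_eq_square)
  finally show "norm (polya_weight q H h) \<le> real q ^ 2 / (8 * real H * m ^ 2)" .
qed

lemma sum_inverse_squares_tail:
  assumes "N \<ge> 1"
  shows "(\<Sum>h\<in>{N<..<n}. 1 / real h ^ 2) \<le> 1 / real N"
proof (cases "N < n")
  case True
  have "(\<Sum>h\<in>{N<..<n}. 1 / real h ^ 2) \<le> 1 / real N - 1 / (real n - 1)" if "Suc N \<le> n" for n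
    using that
  proof (induction n rule: dec_induct)
    case base
    have "{N<..<Suc N} = {}" by auto
    thus ?case by simp
  next
    case (step n)
    have n: "real n > 1" using step.hyps assms by simp
    have "{N<..<Suc n} = insert n {N<..<n}" using step.hyps by auto
    hence "(\<Sum>h\<in>{N<..<Suc n}. 1 / real h ^ 2) = 1 / real n ^ 2 + (\<Sum>h\<in>{N<..<n}. 1 / real h ^ 2)" by simp
    also have "1 / real n ^ 2 \<le> 1 / (real n * (real n - 1))"
      using n by (intro divide_left_mono) (auto simp: power2_eq_square)
    also have "\<dots> = 1 / (real n - 1) - 1 / real n"
      using n by (simp add: field_simps)
    finally show ?case using step.IH by simp
  qed
  from this[of n] True have "(\<Sum>h\<in>{N<..<n}. 1 / real h ^ 2) \<le> 1 / real N - 1 / (real n - 1)" by simp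
  also have "\<dots> \<le> 1 / real N" using True by simp
  finally show ?thesis .
qed auto

section \<open>Averaging over translates and truncation\<close>

lemma char_sum_nat: "char_sum \<chi> (real T) = (\<Sum>n\<in>{1..T}. \<chi> n)"
  unfolding char_sum_def by (intro sum.cong) auto

text \<open>Each further shift drops one term and adds another.\<close>

lemma sum_shift_diff:
  fixes f :: "nat \<Rightarrow> complex"
  assumes "\<And>n. norm (f n) \<le> 1"
  shows "norm ((\<Sum>n\<in>{1..T}. f n) - (\<Sum>n\<in>{1..T}. f (n + j))) \<le> 2 * real j"
proof (induction j)
  case (Suc j)
  have "(\<Sum>n\<in>{1..T}. f (n + Suc j)) = (\<Sum>n\<in>{1..T}. f (n + j)) + f (Suc T + j) - f (Suc j)"
  proof (induction T)
    case (Suc T)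
    thus ?case by (simp add: algebra_simps)
  qed simp
  hence "(\<Sum>n\<in>{1..T}. f n) - (\<Sum>n\<in>{1..T}. f (n + Suc j))
      = ((\<Sum>n\<in>{1..T}. f n) - (\<Sum>n\<in>{1..T}. f (n + j))) + (f (Suc j) - f (Suc T + j))"
    by (simp add: algebra_simps)
  also have "norm \<dots> \<le> 2 * real j + (norm (f (Suc j)) + norm (f (Suc T + j)))"
    by (intro order.trans[OF norm_triangle_ineq] add_mono Suc.IH norm_triangle_ineq4)
  also have "\<dots> \<le> 2 * real j + (1 + 1)" by (intro add_mono assms order.refl)
  finally show ?case by simp
qed simp

text \<open>Replacing the sum by the mean of its translates by j < H costs at most 2H. After the
  expansion is inserted and the sums are interchanged, the mean over \<open>j\<close> becomes the
  first factor of \<open>polya_weight\<close> and the sum over \<open>n\<close> a geometric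
  sum.\<close>

lemma smoothed_char_sum:
  assumes prim: "primitive_char q \<chi>" and q: "q > 1" and H: "H > 0"
  shows "\<exists>g. norm g = 1 / sqrt (real q) \<and> (\<forall>T. norm ((\<Sum>n\<in>{1..T}. \<chi> n) -
           g * (\<Sum>h\<in>{1..<q}. cnj (\<chi> h) * (polya_weight q H h * (1 - cis (- (2 * pi * (real h / real q))) ^ T)))) \<le> 2 * real H)"
proof -
  have \<chi>: "dirichlet_char q \<chi>" using prim by (simp add: primitive_char_def)
  obtain g where g: "norm g = 1 / sqrt (real q)"
    "\<And>n. \<chi> n = g * (\<Sum>h\<in>{1..<q}. cnj (\<chi> h) * cis (- (2 * pi * (real h / real q))) ^ n)"
    using primitive_char_expansion[OF prim q] by blast
  define z where "z h = cis (- (2 * pi * (real h / real q)))" for h :: nat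
  have z1: "z h \<noteq> 1" if "h \<in> {1..<q}" for h
  proof -
    have "0 < 4 * real (min h (q - h)) / real q" using that by auto
    also have "\<dots> \<le> norm (1 - z h)"
      unfolding z_def by (rule norm_one_minus_cis_ge) (use that in auto)
    finally show ?thesis by auto
  qed
  have "norm ((\<Sum>n\<in>{1..T}. \<chi> n) -
           g * (\<Sum>h\<in>{1..<q}. cnj (\<chi> h) * (polya_weight q H h * (1 - z h ^ T)))) \<le> 2 * real H" for T
  proof -
    have geo: "(\<Sum>n\<in>{1..T}. z h ^ n) = z h / (1 - z h) * (1 - z h ^ T)" if "h \<in> {1..<q}" for h
    proof (induction T)
      case (Suc T)
      have "(\<Sum>n\<in>{1..Suc T}. z h ^ n) = z h / (1 - z h) * (1 - z h ^ T) + z h ^ Suc T"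
        using Suc.IH by simp
      also have "z h ^ Suc T = z h / (1 - z h) * ((1 - z h) * z h ^ T)"
        using z1[OF that] by simp
      also have "z h / (1 - z h) * (1 - z h ^ T) + z h / (1 - z h) * ((1 - z h) * z h ^ T)
          = z h / (1 - z h) * ((1 - z h ^ T) + (1 - z h) * z h ^ T)"
        by (rule distrib_left[symmetric])
      also have "(1 - z h ^ T) + (1 - z h) * z h ^ T = 1 - z h ^ Suc T"
        by (simp add: algebra_simps)
      finally show ?case .
    qed simp
    have weight: "polya_weight q H h * (1 - z h ^ T) = (\<Sum>j<H. z h ^ j) / of_nat H * (\<Sum>n\<in>{1..T}. z h ^ n)"
      if "h \<in> {1..<q}" for h
      unfolding geo[OF that] polya_weight_def Let_def z_def[symmetric] by (simp add: mult_ac)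
    have swap: "(\<Sum>h\<in>A. \<Sum>j\<in>B. \<Sum>n\<in>C. f h j n) = (\<Sum>j\<in>B. \<Sum>n\<in>C. \<Sum>h\<in>A. f h j n)"
      for f :: "nat \<Rightarrow> nat \<Rightarrow> nat \<Rightarrow> complex" and A B C
      by (subst sum.swap) (intro sum.cong refl sum.swap)
    have "g * (\<Sum>h\<in>{1..<q}. cnj (\<chi> h) * (polya_weight q H h * (1 - z h ^ T)))
        = g * (\<Sum>h\<in>{1..<q}. cnj (\<chi> h) * ((\<Sum>j<H. z h ^ j) / of_nat H * (\<Sum>n\<in>{1..T}. z h ^ n)))"
    proof -
      have "(\<Sum>h\<in>{1..<q}. cnj (\<chi> h) * (polya_weight q H h * (1 - z h ^ T)))
          = (\<Sum>h\<in>{1..<q}. cnj (\<chi> h) * ((\<Sum>j<H. z h ^ j) / of_nat H * (\<Sum>n\<in>{1..T}. z h ^ n)))"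
        by (intro sum.cong refl) (simp only: weight)
      thus ?thesis by (simp only:)
    qed
    also have "\<dots> = g * (\<Sum>h\<in>{1..<q}. \<Sum>j<H. \<Sum>n\<in>{1..T}. cnj (\<chi> h) * z h ^ (n + j) / of_nat H)"
      by (simp add: sum_product sum_distrib_left sum_divide_distrib power_add mult_ac)
    also have "\<dots> = g * (\<Sum>j<H. \<Sum>n\<in>{1..T}. \<Sum>h\<in>{1..<q}. cnj (\<chi> h) * z h ^ (n + j) / of_nat H)"
      by (rule arg_cong[OF swap])
    also have "\<dots> = (\<Sum>j<H. \<Sum>n\<in>{1..T}. g * (\<Sum>h\<in>{1..<q}. cnj (\<chi> h) * z h ^ (n + j)) / of_nat H)"
      by (simp add: sum_distrib_left sum_divide_distrib)
    also have "\<dots> = (\<Sum>j<H. (\<Sum>n\<in>{1..T}. \<chi> (n + j)) / of_nat H)"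
      unfolding z_def g(2)[symmetric] by (simp add: sum_divide_distrib)
    finally have eq: "g * (\<Sum>h\<in>{1..<q}. cnj (\<chi> h) * (polya_weight q H h * (1 - z h ^ T))) = (\<Sum>j<H. (\<Sum>n\<in>{1..T}. \<chi> (n + j)) / of_nat H)" .
    have "(\<Sum>n\<in>{1..T}. \<chi> n) = (\<Sum>j<H. (\<Sum>n\<in>{1..T}. \<chi> n) / of_nat H)" using H by simp
    hence "(\<Sum>n\<in>{1..T}. \<chi> n) - g * (\<Sum>h\<in>{1..<q}. cnj (\<chi> h) * (polya_weight q H h * (1 - z h ^ T)))
        = (\<Sum>j<H. ((\<Sum>n\<in>{1..T}. \<chi> n) - (\<Sum>n\<in>{1..T}. \<chi> (n + j))) / of_nat H)"
      unfolding eq diff_divide_distrib sum_subtractf by (simp only:)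
    also have "norm \<dots> \<le> (\<Sum>j<H. 2 * real H / real H)"
    proof (rule sum_norm_le)
      fix j assume "j \<in> {..<H}"
      hence "2 * real j \<le> 2 * real H" by simp
      hence "norm ((\<Sum>n\<in>{1..T}. \<chi> n) - (\<Sum>n\<in>{1..T}. \<chi> (n + j))) \<le> 2 * real H"
        using sum_shift_diff[of \<chi> T j, OF norm_dirichlet_char_le_1[OF \<chi>]] by linarith
      thus "norm (((\<Sum>n\<in>{1..T}. \<chi> n) - (\<Sum>n\<in>{1..T}. \<chi> (n + j))) / of_nat H) \<le> 2 * real H / real H"
        by (simp only: norm_divide norm_of_nat) (rule divide_right_mono, auto)
    qed
    also have "\<dots> = 2 * real H" using H by simp
    finally show ?thesis .
  qed
  thus ?thesis using g(1) unfolding z_def by blast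
qed

text \<open>This and \<open>polya_coeff2\<close> are the coefficients of the frequencies h and q -
  h, that is -h, for h <= N. The factor 4/q normalizes them to at most 1/h, and the value 0 beyond
  \<open>N\<close> makes this hold for every h >= 1, as the moment estimate requires.\<close>

definition polya_coeff1 :: "nat \<Rightarrow> nat \<Rightarrow> nat \<Rightarrow> nat \<Rightarrow> complex" where
  "polya_coeff1 q H N h = (if h \<le> N then of_real (4 / real q) * polya_weight q H h else 0)"

definition polya_coeff2 :: "nat \<Rightarrow> nat \<Rightarrow> nat \<Rightarrow> nat \<Rightarrow> complex" where
  "polya_coeff2 q H N h = (if h \<le> N then of_real (4 / real q) * polya_weight q H (q - h) else 0)"

lemma polya_coeff_bounds:
  assumes "2 * N < q" "H > 0" "h \<ge> 1"
  shows "norm (polya_coeff1 q H N h) \<le> 1 / real h" "norm (polya_coeff2 q H N h) \<le> 1 / real h"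
proof -
  have m: "min h (q - h) = h" "min (q - h) (q - (q - h)) = h" if "h \<le> N" using that assms by auto
  have "norm (of_real (4 / real q) * polya_weight q H h) \<le> 1 / real h" if "h \<le> N"
  proof -
    have "norm (polya_weight q H h) \<le> real q / (4 * real h)"
      using polya_weight_bounds(1)[of h q H] that assms m[OF that] by simp
    hence "4 / real q * norm (polya_weight q H h) \<le> 4 / real q * (real q / (4 * real h))"
      by (intro mult_left_mono) auto
    also have "\<dots> = 1 / real h" using assms by simp
    finally show ?thesis by (simp only: norm_mult norm_of_real) simp
  qed
  thus "norm (polya_coeff1 q H N h) \<le> 1 / real h" by (simp add: polya_coeff1_def)
  have "norm (of_real (4 / real q) * polya_weight q H (q - h)) \<le> 1 / real h" if "h \<le> N"
  proof -
    have "norm (polya_weight q H (q - h)) \<le> real q / (4 * real h)"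
      using polya_weight_bounds(1)[of "q - h" q H] that assms m[OF that] by simp
    hence "4 / real q * norm (polya_weight q H (q - h)) \<le> 4 / real q * (real q / (4 * real h))"
      by (intro mult_left_mono) auto
    also have "\<dots> = 1 / real h" using assms by simp
    finally show ?thesis by (simp only: norm_mult norm_of_real) simp
  qed
  thus "norm (polya_coeff2 q H N h) \<le> 1 / real h" by (simp add: polya_coeff2_def)
qed

text \<open>\<chi>(-h) = \<chi>(-1) \<chi>(h), with q - 1 in the role of -1.\<close>

lemma dirichlet_char_reflect:
  assumes \<chi>: "dirichlet_char q \<chi>" and h: "h \<le> q" "q > 1"
  shows "\<chi> (q - h) = \<chi> (q - 1) * \<chi> h"
proof -
  have "[(q - 1) * h = q - h] (mod q)"
  proof -
    have eq: "(q - 1) * h = (q - h) + q * (h - 1)" if h1: "h \<ge> 1"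
    proof -
      obtain h' where "h = Suc h'" using h1 by (cases h) auto
      thus ?thesis using h by (simp add: diff_mult_distrib algebra_simps)
    qed
    show ?thesis
    proof (cases "h \<ge> 1")
      case True
      show ?thesis
        unfolding unique_euclidean_semiring_class.cong_def eq[OF True] by (rule mod_mult_self2)
    next
      case False
      hence "h = 0" by simp
      thus ?thesis by (simp add: unique_euclidean_semiring_class.cong_def)
    qed
  qed
  thus ?thesis using dirichlet_char_cong[OF \<chi>] dirichlet_char_mult[OF \<chi>] by metis
qed

text \<open>Frequencies within \<open>N\<close> of 0 or q are kept, and the remaining ones are
  bounded by the 1/m^2 decay of the weights. In a kept part the factor 1 - z^T separates into
  frequency 0 and a frequency of modulus T/q, whence the four sums \<open>U\<close>. Reflection
  moves the frequencies near q back to 1, ..., N.\<close>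

lemma polya_inequality:
  assumes prim: "primitive_char q \<chi>" and N: "N \<ge> 1" "2 * N < q" and H: "H > 0"
  defines "U \<equiv> (\<lambda>v x. norm (\<Sum>h\<in>{1..N}. v h * cnj (\<chi> h) * cis (2 * pi * (real h * x))))"
  shows "norm (\<Sum>n\<in>{1..T}. \<chi> n) \<le> 2 * real H + real q * sqrt (real q) / (2 * real H * real N)
    + sqrt (real q) / 4 * (U (polya_coeff1 q H N) 0 + U (polya_coeff1 q H N) (- (real T / real q))
       + U (polya_coeff2 q H N) 0 + U (polya_coeff2 q H N) (real T / real q))"
proof -
  have \<chi>: "dirichlet_char q \<chi>" using prim by (simp add: primitive_char_def)
  have q: "q > 1" using N by simp
  define z where "z h = cis (- (2 * pi * (real h / real q)))" for h :: nat
  define W where "W = polya_weight q H"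
  define D where "D h = cnj (\<chi> h) * (W h * (1 - z h ^ T))" for h
  obtain g where g: "norm g = 1 / sqrt (real q)"
    "norm ((\<Sum>n\<in>{1..T}. \<chi> n) - g * (\<Sum>h\<in>{1..<q}. D h)) \<le> 2 * real H"
    using smoothed_char_sum[OF prim q H] unfolding D_def W_def z_def by blast
  have z_pow: "z h ^ T = cis (2 * pi * (real h * (- (real T / real q))))" for h
    by (simp add: z_def Complex.DeMoivre mult_ac)
  have z_refl: "z (q - h) ^ T = cis (2 * pi * (real h * (real T / real q)))" if "h \<le> q" for h
  proof -
    have "z (q - h) ^ T = cis (2 * pi * (real h * (real T / real q)) + 2 * pi * real_of_int (- int T))"
      unfolding z_def Complex.DeMoivre using that q by (intro arg_cong[of _ _ cis]) (simp add: of_nat_diff field_simps)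
    also have "\<dots> = cis (2 * pi * (real h * (real T / real q)))"
      by (simp only: cis_mult[symmetric] cis_multiple_2pi[OF Ints_of_int] mult_1_right)
    finally show ?thesis .
  qed
  have split: "(\<Sum>h\<in>{1..<q}. D h) = (\<Sum>h\<in>{1..N}. D h) + (\<Sum>h\<in>{N<..<q-N}. D h) + (\<Sum>h\<in>{1..N}. D (q - h))"
  proof -
    have eq: "{1..<q} = ({1..N} \<union> {N<..<q-N}) \<union> {q-N..<q}" using N by auto
    have "(\<Sum>h\<in>{1..<q}. D h) = (\<Sum>h\<in>{1..N} \<union> {N<..<q-N}. D h) + (\<Sum>h\<in>{q-N..<q}. D h)"
      unfolding eq by (rule sum.union_disjoint) (use N in auto)
    also have "(\<Sum>h\<in>{1..N} \<union> {N<..<q-N}. D h) = (\<Sum>h\<in>{1..N}. D h) + (\<Sum>h\<in>{N<..<q-N}. D h)"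
      by (rule sum.union_disjoint) auto
    also have "(\<Sum>h\<in>{q-N..<q}. D h) = (\<Sum>h\<in>{1..N}. D (q - h))"
      using N by (intro sum.reindex_bij_witness[of _ "\<lambda>h. q - h" "\<lambda>h. q - h"]) auto
    finally show ?thesis .
  qed
  have q4: "of_real (real q / 4) * (of_real (4 / real q) * x) = x" for x :: complex
    using q by (simp add: field_simps)
  have p1: "norm (\<Sum>h\<in>{1..N}. D h) \<le> real q / 4 * (U (polya_coeff1 q H N) 0 + U (polya_coeff1 q H N) (- (real T / real q)))"
  proof -
    have "(\<Sum>h\<in>{1..N}. D h) = of_real (real q / 4) * ((\<Sum>h\<in>{1..N}. polya_coeff1 q H N h * cnj (\<chi> h) * cis (2 * pi * (real h * 0)))
        - (\<Sum>h\<in>{1..N}. polya_coeff1 q H N h * cnj (\<chi> h) * cis (2 * pi * (real h * (- (real T / real q))))))"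
      unfolding sum_subtractf[symmetric] sum_distrib_left
    proof (intro sum.cong refl)
      fix h assume "h \<in> {1..N}"
      hence "of_real (real q / 4) * polya_coeff1 q H N h = W h" using q4 by (simp add: polya_coeff1_def W_def)
      hence "D h = (of_real (real q / 4) * polya_coeff1 q H N h) * (cnj (\<chi> h) * (1 - z h ^ T))"
        by (simp add: D_def mult_ac)
      thus "D h = of_real (real q / 4) * (polya_coeff1 q H N h * cnj (\<chi> h) * cis (2 * pi * (real h * 0))
          - polya_coeff1 q H N h * cnj (\<chi> h) * cis (2 * pi * (real h * (- (real T / real q)))))"
        unfolding z_pow by (simp add: algebra_simps)
    qed
    thus ?thesis unfolding U_def
      by (simp only: norm_mult norm_of_real) (intro mult_mono norm_triangle_ineq4, auto)
  qed
  have p2: "norm (\<Sum>h\<in>{1..N}. D (q - h)) \<le> real q / 4 * (U (polya_coeff2 q H N) 0 + U (polya_coeff2 q H N) (real T / real q))"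
  proof -
    have "(\<Sum>h\<in>{1..N}. D (q - h)) = cnj (\<chi> (q - 1)) * of_real (real q / 4) * ((\<Sum>h\<in>{1..N}. polya_coeff2 q H N h * cnj (\<chi> h) * cis (2 * pi * (real h * 0)))
        - (\<Sum>h\<in>{1..N}. polya_coeff2 q H N h * cnj (\<chi> h) * cis (2 * pi * (real h * (real T / real q)))))"
      unfolding sum_subtractf[symmetric] sum_distrib_left
    proof (intro sum.cong refl)
      fix h assume h: "h \<in> {1..N}"
      hence hq: "h \<le> q" using N by simp
      have "of_real (real q / 4) * polya_coeff2 q H N h = W (q - h)" using q4 h by (simp add: polya_coeff2_def W_def)
      hence "D (q - h) = (of_real (real q / 4) * polya_coeff2 q H N h) * (cnj (\<chi> (q - 1)) * cnj (\<chi> h) * (1 - z (q - h) ^ T))"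
        using dirichlet_char_reflect[OF \<chi> hq q] by (simp add: D_def mult_ac)
      thus "D (q - h) = cnj (\<chi> (q - 1)) * of_real (real q / 4) * (polya_coeff2 q H N h * cnj (\<chi> h) * cis (2 * pi * (real h * 0))
          - polya_coeff2 q H N h * cnj (\<chi> h) * cis (2 * pi * (real h * (real T / real q))))"
        unfolding z_refl[OF hq] by (simp add: algebra_simps)
    qed
    hence "norm (\<Sum>h\<in>{1..N}. D (q - h)) = norm (\<chi> (q - 1)) * (real q / 4) * norm ((\<Sum>h\<in>{1..N}. polya_coeff2 q H N h * cnj (\<chi> h) * cis (2 * pi * (real h * 0)))
        - (\<Sum>h\<in>{1..N}. polya_coeff2 q H N h * cnj (\<chi> h) * cis (2 * pi * (real h * (real T / real q)))))"
      by (simp only: norm_mult norm_of_real complex_mod_cnj abs_divide abs_numeral abs_of_nat)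
    also have "\<dots> \<le> 1 * (real q / 4) * (U (polya_coeff2 q H N) 0 + U (polya_coeff2 q H N) (real T / real q))"
      unfolding U_def by (intro mult_mono norm_triangle_ineq4 norm_dirichlet_char_le_1[OF \<chi>]) auto
    finally show ?thesis by simp
  qed
  have p3: "norm (\<Sum>h\<in>{N<..<q-N}. D h) \<le> real q ^ 2 / (2 * real H * real N)"
  proof -
    have "norm (\<Sum>h\<in>{N<..<q-N}. D h) \<le> (\<Sum>h\<in>{N<..<q-N}. real q ^ 2 / (4 * real H) * (1 / real h ^ 2 + 1 / real (q - h) ^ 2))"
    proof (rule sum_norm_le)
      fix h assume h: "h \<in> {N<..<q-N}"
      define m where "m = min h (q - h)"
      have "norm (W h) \<le> real q ^ 2 / (8 * real H * real m ^ 2)"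
        unfolding W_def m_def by (rule polya_weight_bounds(2)) (use h N H in auto)
      moreover have "norm (1 - z h ^ T) \<le> 2"
      proof -
        have "norm (1 - z h ^ T) \<le> norm (1::complex) + norm (z h ^ T)" by (rule norm_triangle_ineq4)
        thus ?thesis by (simp add: z_def norm_power)
      qed
      ultimately have "norm (D h) \<le> 1 * (real q ^ 2 / (8 * real H * real m ^ 2) * 2)"
        unfolding D_def norm_mult
        by (intro mult_mono) (auto simp: norm_dirichlet_char_le_1[OF \<chi>])
      also have "\<dots> = real q ^ 2 / (4 * real H) * (1 / real m ^ 2)" by simp
      \<comment> \<open>Bounding 1/m^2 by both reciprocals avoids splitting the range at q/2; the
        two resulting sums agree under h -> q - h.\<close>
      also have "\<dots> \<le> real q ^ 2 / (4 * real H) * (1 / real h ^ 2 + 1 / real (q - h) ^ 2)"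
        by (intro mult_left_mono) (auto simp: m_def min_def)
      finally show "norm (D h) \<le> real q ^ 2 / (4 * real H) * (1 / real h ^ 2 + 1 / real (q - h) ^ 2)" .
    qed
    also have "\<dots> = real q ^ 2 / (4 * real H) * ((\<Sum>h\<in>{N<..<q-N}. 1 / real h ^ 2) + (\<Sum>h\<in>{N<..<q-N}. 1 / real (q - h) ^ 2))"
      by (simp only: sum_distrib_left[symmetric] sum.distrib)
    also have "(\<Sum>h\<in>{N<..<q-N}. 1 / real (q - h) ^ 2) = (\<Sum>h\<in>{N<..<q-N}. 1 / real h ^ 2)"
      by (intro sum.reindex_bij_witness[of _ "\<lambda>h. q - h" "\<lambda>h. q - h"]) auto
    also have "real q ^ 2 / (4 * real H) * ((\<Sum>h\<in>{N<..<q-N}. 1 / real h ^ 2) + (\<Sum>h\<in>{N<..<q-N}. 1 / real h ^ 2))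
        \<le> real q ^ 2 / (4 * real H) * (1 / real N + 1 / real N)"
      by (intro mult_left_mono add_mono sum_inverse_squares_tail N) auto
    also have "\<dots> = real q ^ 2 / (2 * real H * real N)" by (simp add: field_simps)
    finally show ?thesis .
  qed
  define A where "A = U (polya_coeff1 q H N) 0 + U (polya_coeff1 q H N) (- (real T / real q))"
  define B where "B = U (polya_coeff2 q H N) 0 + U (polya_coeff2 q H N) (real T / real q)"
  have s: "1 / sqrt (real q) * real q = sqrt (real q)" by (simp add: real_div_sqrt)
  have alg: "c * (x / 4 * a + x ^ 2 / y + x / 4 * b) = x * (c * x) / y + (c * x) / 4 * (a + b)" for a b c x y :: real
    by (simp add: power2_eq_square distrib_left mult.left_commute)
  have "norm (\<Sum>h\<in>{1..<q}. D h) \<le> real q / 4 * A + real q ^ 2 / (2 * real H * real N) + real q / 4 * B"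
    unfolding split A_def B_def by (intro order.trans[OF norm_triangle_ineq] add_mono p1 p2 p3)
  hence "1 / sqrt (real q) * norm (\<Sum>h\<in>{1..<q}. D h)
      \<le> 1 / sqrt (real q) * (real q / 4 * A + real q ^ 2 / (2 * real H * real N) + real q / 4 * B)"
    by (intro mult_left_mono) auto
  hence "norm (g * (\<Sum>h\<in>{1..<q}. D h))
      \<le> real q * sqrt (real q) / (2 * real H * real N) + sqrt (real q) / 4 * (A + B)"
    unfolding alg s by (simp only: norm_mult g(1))
  moreover have "norm (\<Sum>n\<in>{1..T}. \<chi> n) \<le> 2 * real H + norm (g * (\<Sum>h\<in>{1..<q}. D h))"
    using g(2) norm_triangle_sub[of "\<Sum>n\<in>{1..T}. \<chi> n" "g * (\<Sum>h\<in>{1..<q}. D h)"] by linarith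
  ultimately have "norm (\<Sum>n\<in>{1..T}. \<chi> n) \<le> 2 * real H + real q * sqrt (real q) / (2 * real H * real N) + sqrt (real q) / 4 * (A + B)"
    by linarith
  thus ?thesis unfolding A_def B_def by (simp only: add.assoc)
qed

text \<open>The exponents only need \<open>0.47 < 1/2\<close>, \<open>0.47 + 0.55 > 1\<close> (both here) and \<open>0.55 < 4/7\<close>
  (in \<open>tail_small\<close>, where \<open>128\<^sup>j = (16\<^sup>j)\<^bsup>7/4\<^esup>\<close> has to be \<open>o(q)\<close>).\<close>

lemma polya_parameters:
  "eventually (\<lambda>q::nat. 1 \<le> nat \<lfloor>real q powr 0.55\<rfloor> \<and> 2 * nat \<lfloor>real q powr 0.55\<rfloor> < q \<and> 0 < nat \<lceil>real q powr 0.47\<rceil> \<and>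
     2 * real (nat \<lceil>real q powr 0.47\<rceil>) + real q * sqrt (real q) / (2 * real (nat \<lceil>real q powr 0.47\<rceil>) * real (nat \<lfloor>real q powr 0.55\<rfloor>))
       \<le> sqrt (real q)) at_top"
proof -
  have "eventually (\<lambda>x::real. x \<ge> 2 \<and> x powr 0.55 \<ge> 1 \<and> 2 * x powr 0.55 < x \<and>
      2 * (x powr 0.47 + 1) + x * sqrt x / (2 * x powr 0.47 * (x powr 0.55 - 1)) \<le> sqrt x \<and> x powr 0.55 > 1) at_top"
    by (intro eventually_conj; real_asymp)
  hence "eventually (\<lambda>q::nat. real q \<ge> 2 \<and> real q powr 0.55 \<ge> 1 \<and> 2 * real q powr 0.55 < real q \<and>
      2 * (real q powr 0.47 + 1) + real q * sqrt (real q) / (2 * real q powr 0.47 * (real q powr 0.55 - 1)) \<le> sqrt (real q) \<and> real q powr 0.55 > 1) at_top"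
    using filterlim_real_sequentially by (rule eventually_compose_filterlim)
  thus ?thesis
  proof eventually_elim
    case (elim q)
    define x where "x = real q powr 0.55"
    define y where "y = real q powr 0.47"
    have x: "x > 1" "2 * x < real q" using elim by (simp_all add: x_def)
    have y: "y > 0" using elim by (simp add: y_def)
    have N: "real (nat \<lfloor>x\<rfloor>) \<le> x" "x - 1 \<le> real (nat \<lfloor>x\<rfloor>)" "1 \<le> nat \<lfloor>x\<rfloor>"
      using x by linarith+
    have H: "real (nat \<lceil>y\<rceil>) \<le> y + 1" "y \<le> real (nat \<lceil>y\<rceil>)" "0 < nat \<lceil>y\<rceil>"
      using y by linarith+
    have A: "real q * sqrt (real q) / (2 * real (nat \<lceil>y\<rceil>) * real (nat \<lfloor>x\<rfloor>)) \<le> real q * sqrt (real q) / (2 * y * (x - 1))"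
      using x y N H by (intro divide_left_mono mult_mono mult_pos_pos) auto
    have "2 * real (nat \<lceil>y\<rceil>) + real q * sqrt (real q) / (2 * real (nat \<lceil>y\<rceil>) * real (nat \<lfloor>x\<rfloor>))
        \<le> 2 * (y + 1) + real q * sqrt (real q) / (2 * y * (x - 1))"
      by (intro add_mono A) (rule mult_left_mono[OF H(1)], simp)
    also have "\<dots> \<le> sqrt (real q)"
      using elim by (simp add: x_def y_def)
    finally have "2 * real (nat \<lceil>y\<rceil>) + real q * sqrt (real q) / (2 * real (nat \<lceil>y\<rceil>) * real (nat \<lfloor>x\<rfloor>)) \<le> sqrt (real q)" .
    moreover have "2 * nat \<lfloor>x\<rfloor> < q"
    proof -
      have "real (2 * nat \<lfloor>x\<rfloor>) < real q" using N x by linarith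
      thus ?thesis by (simp only: of_nat_less_iff)
    qed
    ultimately show ?case using N H by (simp add: x_def y_def)
  qed
qed

text \<open>The left base is at most twice the maximum of 1, a, b, c, d.\<close>

lemma power_average_le:
  fixes a b c d :: real
  assumes "a \<ge> 0" "b \<ge> 0" "c \<ge> 0" "d \<ge> 0"
  shows "(1 + (a + b + c + d) / 4) ^ p \<le> 2 ^ p * (1 + a ^ p + b ^ p + c ^ p + d ^ p)"
proof -
  define m where "m = Max {1, a, b, c, d}"
  have m: "1 \<le> m" "a \<le> m" "b \<le> m" "c \<le> m" "d \<le> m" by (auto simp: m_def)
  have "(1 + (a + b + c + d) / 4) ^ p \<le> (2 * m) ^ p"
  proof (rule power_mono)
    have "a + b + c + d \<le> 4 * m" using m by simp
    hence "(a + b + c + d) / 4 \<le> m" by simp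
    from add_mono[OF m(1) this] show "1 + (a + b + c + d) / 4 \<le> 2 * m" by (simp only: mult_2)
  qed (use assms in auto)
  also have "\<dots> = 2 ^ p * m ^ p" by (rule power_mult_distrib)
  also have "m ^ p \<le> 1 + a ^ p + b ^ p + c ^ p + d ^ p"
  proof -
    have "m \<in> {1, a, b, c, d}" unfolding m_def by (rule Max_in) auto
    moreover have "0 \<le> a ^ p" "0 \<le> b ^ p" "0 \<le> c ^ p" "0 \<le> d ^ p" using assms by auto
    ultimately show ?thesis by auto
  qed
  finally show ?thesis by simp
qed

text \<open>\<open>T\<close> may vary with \<chi>, since it enters the four exponential sums only
  through their frequencies. The parameters make the error terms at most sqrt q, whose 2k-th power
  is q^k.\<close>

lemma primitive_char_sum_moment:
  fixes k l :: nat
  assumes k: "k \<ge> 3" and l: "k \<le> 2 ^ l"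
  shows "\<exists>D. \<forall>q\<ge>D. \<forall>T. (\<Sum>\<chi> | primitive_char q \<chi>. norm (\<Sum>n\<in>{1..T \<chi>}. \<chi> n) ^ (2 * k))
           \<le> real (totient q) * real q ^ k * (2 ^ 45 * real l ^ 4) ^ k"
proof -
  have l1: "l \<ge> 1" using k l by (cases l) auto
  obtain D1 where D1: "\<And>q. q \<ge> D1 \<Longrightarrow> 1 \<le> nat \<lfloor>real q powr 0.55\<rfloor> \<and> 2 * nat \<lfloor>real q powr 0.55\<rfloor> < q \<and> 0 < nat \<lceil>real q powr 0.47\<rceil> \<and>
     2 * real (nat \<lceil>real q powr 0.47\<rceil>) + real q * sqrt (real q) / (2 * real (nat \<lceil>real q powr 0.47\<rceil>) * real (nat \<lfloor>real q powr 0.55\<rfloor>))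
       \<le> sqrt (real q)"
    using polya_parameters unfolding eventually_at_top_linorder by blast
  show ?thesis
  proof (rule exE[OF exponential_sum_moment_smooth[OF k l]], goal_cases)
    case (1 D)
    note D = this[rule_format]
    show ?case
    proof (intro exI[of _ "max D D1"] allI impI)
      fix q :: nat and T :: "(nat \<Rightarrow> complex) \<Rightarrow> nat"
      assume q: "q \<ge> max D D1"
      define N where "N = nat \<lfloor>real q powr 0.55\<rfloor>"
      define H where "H = nat \<lceil>real q powr 0.47\<rceil>"
      have NH: "1 \<le> N" "2 * N < q" "0 < H" and
        small: "2 * real H + real q * sqrt (real q) / (2 * real H * real N) \<le> sqrt (real q)"
        using D1[of q] q unfolding N_def H_def by auto
      have N_le: "real N \<le> real q powr 0.55" unfolding N_def by simp
      define \<phi> where "\<phi> = real (totient q)"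
      define Q where "Q = (2 ^ 40 * real l ^ 4) ^ k"
      define P where "P = {\<chi>. primitive_char q \<chi>}"
      define X where "X = {\<chi>. dirichlet_char q \<chi>}"
      define U where "U v x \<chi> = norm (\<Sum>h\<in>{1..N}. v h * cnj (\<chi> h) * cis (2 * pi * (real h * x)))"
        for v and x :: real and \<chi> :: "nat \<Rightarrow> complex"
      have finX: "finite X" unfolding X_def by (rule finite_dirichlet_chars)
      have PX: "P \<subseteq> X" by (auto simp: P_def X_def primitive_char_def)
      have finP: "finite P" using PX finX by (rule finite_subset)
      have mom: "(\<Sum>\<chi>\<in>P. U v (x \<chi>) \<chi> ^ (2 * k)) \<le> \<phi> * Q"
        if v: "\<And>h. h \<ge> 1 \<Longrightarrow> norm (v h) \<le> 1 / real h" for v x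
      proof -
        \<comment> \<open>The Polya inequality involves the conjugate character, the moment estimate
          the character itself. Conjugation is an involution on characters, and the frequency is
          carried along as \<open>x (c \<psi>)\<close>.\<close>
        define c where "c \<chi> = (\<lambda>n. cnj (\<chi> n))" for \<chi> :: "nat \<Rightarrow> complex"
        define G where "G \<psi> = norm (\<Sum>h\<in>{1..N}. v h * \<psi> h * cis (2 * pi * (real h * x (c \<psi>)))) ^ (2 * k)" for \<psi>
        have cc: "c (c \<chi>) = \<chi>" for \<chi> by (simp add: c_def)
        have "(\<Sum>\<chi>\<in>P. U v (x \<chi>) \<chi> ^ (2 * k)) = (\<Sum>\<chi>\<in>P. G (c \<chi>))"
          unfolding U_def G_def cc by (simp add: c_def)
        also have "\<dots> = (\<Sum>\<psi>\<in>c ` P. G \<psi>)"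
          by (subst sum.reindex) (auto intro!: inj_onI dest: arg_cong[of _ _ c] simp: cc)
        also have "\<dots> \<le> (\<Sum>\<psi>\<in>X. G \<psi>)"
        proof (rule sum_mono2[OF finX])
          show "c ` P \<subseteq> X" using PX dirichlet_char_cnj by (auto simp: X_def c_def)
        qed (simp add: G_def)
        also have "\<dots> \<le> \<phi> * Q"
          unfolding G_def X_def \<phi>_def Q_def by (rule D) (use q N_le v in auto)
        finally show ?thesis .
      qed
      define v1 where "v1 = polya_coeff1 q H N"
      define v2 where "v2 = polya_coeff2 q H N"
      have v: "norm (v1 h) \<le> 1 / real h" "norm (v2 h) \<le> 1 / real h" if "h \<ge> 1" for h
        unfolding v1_def v2_def using polya_coeff_bounds[OF NH(2,3) that] by auto
      define x where "x \<chi> = real (T \<chi>) / real q" for \<chi>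
      have "(\<Sum>\<chi>\<in>P. norm (\<Sum>n\<in>{1..T \<chi>}. \<chi> n) ^ (2 * k)) \<le>
            (\<Sum>\<chi>\<in>P. real q ^ k * (2 ^ (2*k) * (1 + U v1 0 \<chi> ^ (2*k) + U v1 (- x \<chi>) \<chi> ^ (2*k) + U v2 0 \<chi> ^ (2*k) + U v2 (x \<chi>) \<chi> ^ (2*k))))"
      proof (rule sum_mono)
        fix \<chi> assume "\<chi> \<in> P"
        hence prim: "primitive_char q \<chi>" by (simp add: P_def)
        have U0: "0 \<le> U v y \<chi>" for v y by (simp add: U_def)
        have "norm (\<Sum>n\<in>{1..T \<chi>}. \<chi> n) \<le> 2 * real H + real q * sqrt (real q) / (2 * real H * real N)
            + sqrt (real q) / 4 * (U v1 0 \<chi> + U v1 (- x \<chi>) \<chi> + U v2 0 \<chi> + U v2 (x \<chi>) \<chi>)"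
          unfolding U_def v1_def v2_def x_def by (rule polya_inequality[OF prim NH])
        also have "\<dots> \<le> sqrt (real q) + sqrt (real q) / 4 * (U v1 0 \<chi> + U v1 (- x \<chi>) \<chi> + U v2 0 \<chi> + U v2 (x \<chi>) \<chi>)"
          by (rule add_right_mono[OF small])
        also have "\<dots> = sqrt (real q) * (1 + (U v1 0 \<chi> + U v1 (- x \<chi>) \<chi> + U v2 0 \<chi> + U v2 (x \<chi>) \<chi>) / 4)"
          by (simp add: distrib_left)
        finally have "norm (\<Sum>n\<in>{1..T \<chi>}. \<chi> n) ^ (2 * k) \<le> (sqrt (real q) * (1 + (U v1 0 \<chi> + U v1 (- x \<chi>) \<chi> + U v2 0 \<chi> + U v2 (x \<chi>) \<chi>) / 4)) ^ (2 * k)"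
          by (rule power_mono) auto
        also have "\<dots> = real q ^ k * (1 + (U v1 0 \<chi> + U v1 (- x \<chi>) \<chi> + U v2 0 \<chi> + U v2 (x \<chi>) \<chi>) / 4) ^ (2 * k)"
          by (simp add: power_mult_distrib power_mult[of "sqrt (real q)"])
        also have "\<dots> \<le> real q ^ k * (2 ^ (2*k) * (1 + U v1 0 \<chi> ^ (2*k) + U v1 (- x \<chi>) \<chi> ^ (2*k) + U v2 0 \<chi> ^ (2*k) + U v2 (x \<chi>) \<chi> ^ (2*k)))"
          by (intro mult_left_mono power_average_le U0) auto
        finally show "norm (\<Sum>n\<in>{1..T \<chi>}. \<chi> n) ^ (2 * k) \<le> real q ^ k * (2 ^ (2*k) * (1 + U v1 0 \<chi> ^ (2*k) + U v1 (- x \<chi>) \<chi> ^ (2*k) + U v2 0 \<chi> ^ (2*k) + U v2 (x \<chi>) \<chi> ^ (2*k)))" .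
      qed
      also have "\<dots> = real q ^ k * (2 ^ (2*k) * (real (card P) + (\<Sum>\<chi>\<in>P. U v1 0 \<chi> ^ (2*k)) + (\<Sum>\<chi>\<in>P. U v1 (- x \<chi>) \<chi> ^ (2*k)) + (\<Sum>\<chi>\<in>P. U v2 0 \<chi> ^ (2*k)) + (\<Sum>\<chi>\<in>P. U v2 (x \<chi>) \<chi> ^ (2*k))))"
        by (simp only: sum_distrib_left[symmetric] sum.distrib) simp
      also have "\<dots> \<le> real q ^ k * (2 ^ (2*k) * (\<phi> + \<phi> * Q + \<phi> * Q + \<phi> * Q + \<phi> * Q))"
      proof (intro mult_left_mono add_mono mom v)
        have "card P \<le> card X" by (rule card_mono[OF finX PX])
        also have "\<dots> \<le> totient q" unfolding X_def using NH by (intro card_dirichlet_chars_le) simp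
        finally show "real (card P) \<le> \<phi>" by (simp add: \<phi>_def)
      qed auto
      also have "\<dots> \<le> real q ^ k * (2 ^ (2*k) * (\<phi> * (8 ^ k * Q)))"
      proof (intro mult_left_mono)
        have "(1::real) \<le> real l ^ 4" using l1 by (intro one_le_power) simp
        hence "(1::real) \<le> 2 ^ 40 * real l ^ 4" by simp
        hence Q1: "1 \<le> Q" unfolding Q_def by (rule one_le_power)
        \<comment> \<open>The factor 8^k absorbs the five summands, and 2^45 = 2^2 * 8 *
          2^40.\<close>
        have "(8::real) ^ 1 \<le> 8 ^ k" using k by (intro power_increasing) auto
        hence "5 * Q \<le> 8 ^ k * Q" using Q1 by (intro mult_right_mono) auto
        hence "1 + 4 * Q \<le> 8 ^ k * Q" using Q1 by linarith
        hence "\<phi> * (1 + 4 * Q) \<le> \<phi> * (8 ^ k * Q)" by (intro mult_left_mono) (auto simp: \<phi>_def)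
        thus "\<phi> + \<phi> * Q + \<phi> * Q + \<phi> * Q + \<phi> * Q \<le> \<phi> * (8 ^ k * Q)" by (simp add: algebra_simps)
      qed auto
      also have "\<dots> = \<phi> * real q ^ k * (2 ^ 45 * real l ^ 4) ^ k"
      proof -
        have "2 ^ (2*k) * (8 ^ k * Q) = ((2 ^ 2) * (8 * (2 ^ 40 * real l ^ 4))) ^ k"
          unfolding Q_def by (simp only: power_mult power_mult_distrib)
        also have "(2 ^ 2) * (8 * (2 ^ 40 * real l ^ 4)) = 2 ^ 45 * real l ^ 4" by simp
        finally have "2 ^ (2*k) * (8 ^ k * Q) = (2 ^ 45 * real l ^ 4) ^ k" .
        hence "\<phi> * real q ^ k * (2 ^ (2*k) * (8 ^ k * Q)) = \<phi> * real q ^ k * (2 ^ 45 * real l ^ 4) ^ k" by (simp only:)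
        thus ?thesis by (simp only: mult_ac)
      qed
      finally show "(\<Sum>\<chi> | primitive_char q \<chi>. norm (\<Sum>n\<in>{1..T \<chi>}. \<chi> n) ^ (2 * k))
           \<le> real (totient q) * real q ^ k * (2 ^ 45 * real l ^ 4) ^ k"
        by (simp add: P_def \<phi>_def)
    qed
  qed
qed

section \<open>Reduction to primitive characters\<close>

lemma not_coprime_common_prime:
  fixes m n :: nat
  assumes "\<not> coprime m n"
  obtains p where "prime p" "p dvd m" "p dvd n"
proof -
  have "gcd m n \<noteq> 1" using assms coprime_iff_gcd_eq_1 by blast
  then obtain p where p: "prime p" "p dvd gcd m n" using prime_factor_nat by blast
  show ?thesis by (rule that[OF p(1)]) (use p(2) in auto)
qed

text \<open>Units modulo d lift to units modulo q. To \<open>n\<close> one adds d times the product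
  of the primes of q not dividing n: a prime of q then divides exactly one of the two
  summands.\<close>

lemma coprime_lift:
  fixes n d q :: nat
  assumes "coprime n d" "d dvd q" "q > 0"
  shows "\<exists>m. m mod d = n mod d \<and> coprime m q"
proof -
  define S where "S = {p \<in> prime_factors q. \<not> p dvd n}"
  define m where "m = n + \<Prod>S * d"
  have finS: "finite S" by (simp add: S_def)
  have "coprime m q"
  proof (rule ccontr)
    assume "\<not> coprime m q"
    then obtain p where p: "prime p" "p dvd m" "p dvd q"
      by (rule not_coprime_common_prime)
    show False
    proof (cases "p dvd n")
      case True
      hence "\<not> p dvd d" using assms(1) p(1) by (metis coprime_common_divisor_nat not_prime_1)
      moreover have "p dvd \<Prod>S * d" using p(2) True unfolding m_def by (simp add: dvd_add_right_iff)
      ultimately have "p dvd \<Prod>S" using p(1) by (simp add: prime_dvd_mult_iff)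
      then obtain r where "r \<in> S" "p dvd r"
        using prime_dvd_prod_iff[OF finS p(1), of "\<lambda>x. x"] by auto
      hence "r = p" using p(1) by (auto simp: S_def intro: primes_dvd_imp_eq[symmetric] dest: in_prime_factors_imp_prime)
      thus False using \<open>r \<in> S\<close> True by (simp add: S_def)
    next
      case False
      hence "p \<in> S" using p assms(3) by (simp add: S_def in_prime_factors_iff)
      hence "p dvd \<Prod>S * d" using dvd_prodI[OF finS, of p "\<lambda>x. x"] by simp
      hence "p dvd n" using p(2) unfolding m_def by (simp add: dvd_add_left_iff)
      thus False using False by simp
    qed
  qed
  moreover have "m mod d = n mod d" by (simp add: m_def)
  ultimately show ?thesis by blast
qed

text \<open>Let the Gauss sum at a non-unit \<open>h\<close> be nonzero and let d = q / gcd(h, q).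
  If a unit c is 1 modulo d, then hc and h agree modulo q, so \<open>gauss_sum_mult\<close> forces
  \<chi>(c) = 1. Hence \<chi> on units depends only on the residue modulo d < q.\<close>

lemma imprimitive_char_reduce:
  assumes \<chi>: "dirichlet_char q \<chi>" and "\<not> primitive_char q \<chi>"
  shows "\<exists>d \<psi>. d dvd q \<and> d < q \<and> dirichlet_char d \<psi> \<and> (\<forall>n. \<chi> n = (if coprime n q then \<psi> n else 0))"
proof -
  have q: "q > 0" using dirichlet_char_pos[OF \<chi>] .
  obtain h where h: "\<not> coprime h q" "gauss_sum q \<chi> h \<noteq> 0"
    using assms by (auto simp: primitive_char_def)
  define g where "g = gcd h q"
  define d where "d = q div g"
  define h' where "h' = h div g"
  have g: "g > 1" using h(1) q unfolding g_def by (metis coprime_iff_gcd_eq_1 gcd_pos_nat less_one linorder_neqE_nat neq0_conv)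
  have qd: "q = d * g" and hh: "h = h' * g" by (simp_all add: d_def h'_def g_def)
  have d: "d dvd q" "d < q" "d > 0" using qd q g by auto
  have trivial: "\<chi> c = 1" if c: "coprime c q" "c mod d = 1 mod d" for c
  proof -
    have "gauss_sum q \<chi> (h * c) = gauss_sum q \<chi> h"
    proof -
      have "(h * c) mod q = h mod q"
      proof -
        have "(c * g) mod (d * g) = (1 * g) mod (d * g)"
          using c(2) by (simp only: mult_mod_left[symmetric])
        hence "(h' * (c * g)) mod q = (h' * (1 * g)) mod q"
          unfolding qd by (metis mod_mult_right_eq)
        thus ?thesis by (simp add: hh mult_ac)
      qed
      have "cis (2 * pi * (real (h * c * n) / real q)) = cis (2 * pi * (real (h * n) / real q))" for n
      proof -
        have "(h * c * n) mod q = (h * n) mod q" using \<open>(h * c) mod q = h mod q\<close> by (metis mod_mult_left_eq)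
        thus ?thesis using cis_2pi_mod[OF q, of "h * c * n"] cis_2pi_mod[OF q, of "h * n"] by simp
      qed
      thus ?thesis by (simp only: gauss_sum_def)
    qed
    hence "\<chi> c * gauss_sum q \<chi> h = gauss_sum q \<chi> h" using gauss_sum_mult[OF \<chi> c(1), of h] by simp
    thus ?thesis using h(2) by simp
  qed
  have well: "\<chi> a = \<chi> b" if ab: "coprime a q" "coprime b q" "a mod d = b mod d" for a b
  proof -
    \<comment> \<open>An inverse of \<open>b\<close> modulo q, by Euler's theorem.\<close>
    define c where "c = b ^ (totient q - 1)"
    have tq: "totient q > 0" using q by simp
    have bc: "b * c = b ^ totient q" using tq by (simp add: c_def flip: power_Suc)
    have e: "(b * c) mod q = 1 mod q" unfolding bc
      using euler_theorem[OF ab(2)] by (simp add: unique_euclidean_semiring_class.cong_def)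
    have cc: "coprime c q" using ab(2) by (simp add: c_def)
    have "\<chi> (b * c) = 1" unfolding bc using dirichlet_char_power[OF \<chi>] dirichlet_char_power_totient[OF \<chi> ab(2)] by simp
    moreover have "\<chi> (a * c) = 1"
    proof (rule trivial)
      show "coprime (a * c) q" using ab(1) cc by simp
      have "(a * c) mod d = (b * c) mod d" using ab(3) by (metis mod_mult_left_eq)
      also have "\<dots> = 1 mod d" using e d(1) by (metis mod_mod_cancel)
      finally show "(a * c) mod d = 1 mod d" .
    qed
    moreover have "\<chi> c \<noteq> 0" using dirichlet_char_eq_0_iff[OF \<chi>] cc by blast
    ultimately show ?thesis by (simp add: dirichlet_char_mult[OF \<chi>]) (metis mult_right_cancel)
  qed
  \<comment> \<open>By \<open>well\<close>, the value of \<chi> at the chosen unit does not depend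
    on the choice.\<close>
  define lift where "lift n = (SOME m. m mod d = n mod d \<and> coprime m q)" for n
  have lift: "lift n mod d = n mod d" "coprime (lift n) q" if "coprime n d" for n
    using someI_ex[OF coprime_lift[OF that d(1) q]] unfolding lift_def by auto
  define \<psi> where "\<psi> n = (if coprime n d then \<chi> (lift n) else 0)" for n
  have \<psi>_eq: "\<psi> n = \<chi> m" if "coprime m q" "m mod d = n mod d" for m n
  proof -
    have "coprime m d" using that(1) d(1) by (metis coprime_divisors dvd_refl)
    hence cop: "coprime n d" using that(2) by (metis coprime_mod_left_iff d(3) neq0_conv)
    have "\<chi> (lift n) = \<chi> m"
      using lift[OF cop] that by (intro well) auto
    thus ?thesis using cop by (simp add: \<psi>_def)
  qed
  have "dirichlet_char d \<psi>"
    unfolding dirichlet_char_def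
  proof (intro conjI allI)
    show "d > 0" by (rule d)
    fix n
    show "\<psi> (n + d) = \<psi> n"
    proof (cases "coprime n d")
      case True
      thus ?thesis using \<psi>_eq[of "lift n" "n + d"] \<psi>_eq[of "lift n" n] lift[OF True] by simp
    next
      case False
      hence "\<not> coprime (n + d) d" by (metis gcd_add1 coprime_iff_gcd_eq_1)
      thus ?thesis using False by (simp add: \<psi>_def)
    qed
    show "\<psi> n \<noteq> 0 \<longleftrightarrow> coprime n d"
      using lift(2)[of n] dirichlet_char_eq_0_iff[OF \<chi>, of "lift n"] by (auto simp: \<psi>_def)
  next
    fix m n
    show "\<psi> (m * n) = \<psi> m * \<psi> n"
    proof (cases "coprime m d \<and> coprime n d")
      case True
      have "\<psi> (m * n) = \<chi> (lift m * lift n)"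
        using lift[of m] lift[of n] True by (intro \<psi>_eq) (auto, metis mod_mult_eq)
      thus ?thesis using True by (simp add: \<psi>_def dirichlet_char_mult[OF \<chi>])
    next
      case False
      thus ?thesis by (auto simp: \<psi>_def)
    qed
  qed
  moreover have "\<chi> n = (if coprime n q then \<psi> n else 0)" for n
    using \<psi>_eq[of n n] dirichlet_char_eq_0_iff[OF \<chi>, of n] by auto
  ultimately show ?thesis using d by blast
qed

lemma primitive_char_exists:
  assumes "dirichlet_char q \<chi>"
  shows "\<exists>d \<psi>. d dvd q \<and> primitive_char d \<psi> \<and> (\<forall>n. \<chi> n = (if coprime n q then \<psi> n else 0))"
  using assms
proof (induction q arbitrary: \<chi> rule: less_induct)
  case (less q)
  show ?case
  proof (cases "primitive_char q \<chi>")
    case True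
    have "\<chi> n = (if coprime n q then \<chi> n else 0)" for n
      using dirichlet_char_eq_0_iff[OF less.prems, of n] by auto
    thus ?thesis using True by (intro exI[of _ q] exI[of _ \<chi>]) auto
  next
    case False
    obtain d \<psi> where d: "d dvd q" "d < q" "dirichlet_char d \<psi>" "\<forall>n. \<chi> n = (if coprime n q then \<psi> n else 0)"
      using imprimitive_char_reduce[OF less.prems False] by blast
    obtain e \<theta> where e: "e dvd d" "primitive_char e \<theta>" "\<forall>n. \<psi> n = (if coprime n d then \<theta> n else 0)"
      using less.IH[OF d(2,3)] by blast
    have "coprime n d" if "coprime n q" for n using that d(1) by (metis coprime_divisors dvd_refl)
    hence "\<forall>n. \<chi> n = (if coprime n q then \<theta> n else 0)" using d(4) e(3) by simp
    thus ?thesis using e(1,2) d(1) dvd_trans by blast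
  qed
qed

text \<open>Sieving by one more prime p subtracts \<psi>(p) times a shorter sum already sieved by
  the other primes, so the bound at most doubles.\<close>

lemma sifted_char_sum_le:
  fixes \<psi> :: "nat \<Rightarrow> complex"
  assumes mult: "\<And>m n. \<psi> (m * n) = \<psi> m * \<psi> n" and norm1: "\<And>n. norm (\<psi> n) \<le> 1"
    and P: "finite P" "\<And>p. p \<in> P \<Longrightarrow> prime p" and M: "\<And>t. norm (\<Sum>n\<in>{1..t}. \<psi> n) \<le> M"
  shows "norm (\<Sum>n\<in>{1..t}. if \<exists>p\<in>P. p dvd n then 0 else \<psi> n) \<le> 2 ^ card P * M"
  using P
proof (induction P arbitrary: t rule: finite_induct)
  case empty
  show ?case using M[of t] by simp
next
  case (insert p P)
  define f where "f n = (if \<exists>p\<in>P. p dvd n then 0 else \<psi> n)" for n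
  have p: "prime p" using insert.prems by auto
  have IH: "norm (\<Sum>n\<in>{1..t}. f n) \<le> 2 ^ card P * M" for t
    unfolding f_def by (rule insert.IH) (use insert.prems in auto)
  have f_mult: "f (p * m) = \<psi> p * f m" for m
  proof -
    have "r dvd p * m \<longleftrightarrow> r dvd m" if "r \<in> P" for r
    proof -
      have "prime r" "r \<noteq> p" using that insert by auto
      hence "\<not> r dvd p" using p by (auto dest: primes_dvd_imp_eq)
      thus ?thesis using \<open>prime r\<close> by (simp add: prime_dvd_mult_iff)
    qed
    thus ?thesis by (auto simp: f_def mult)
  qed
  have "(\<Sum>n\<in>{1..t}. if \<exists>p\<in>insert p P. p dvd n then 0 else \<psi> n)
      = (\<Sum>n\<in>{1..t}. f n - (if p dvd n then f n else 0))"
    by (intro sum.cong refl) (auto simp: f_def)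
  also have "\<dots> = (\<Sum>n\<in>{1..t}. f n) - (\<Sum>n\<in>{n\<in>{1..t}. p dvd n}. f n)"
    by (simp only: sum_subtractf sum.inter_filter finite_atLeastAtMost)
  also have "(\<Sum>n\<in>{n\<in>{1..t}. p dvd n}. f n) = (\<Sum>m\<in>{1..t div p}. f (p * m))"
  proof (rule sum.reindex_bij_witness[of _ "\<lambda>m. p * m" "\<lambda>n. n div p"])
    have p0: "p > 0" using p by (rule prime_gt_0_nat)
    fix n assume n: "n \<in> {n\<in>{1..t}. p dvd n}"
    thus "p * (n div p) = n" by simp
    show "n div p \<in> {1..t div p}" using n p0 by (auto simp: div_greater_zero_iff Suc_le_eq dvd_imp_le div_le_mono)
    show "f (p * (n div p)) = f n" using n by simp
  next
    have p0: "p > 0" using p by (rule prime_gt_0_nat)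
    fix m assume m: "m \<in> {1..t div p}"
    show "p * m div p = m" using p0 by simp
    show "p * m \<in> {n\<in>{1..t}. p dvd n}" using m p0 by (auto simp: less_eq_div_iff_mult_less_eq mult.commute)
  qed
  also have "\<dots> = \<psi> p * (\<Sum>m\<in>{1..t div p}. f m)" by (simp add: f_mult sum_distrib_left)
  also have "norm ((\<Sum>n\<in>{1..t}. f n) - \<psi> p * (\<Sum>m\<in>{1..t div p}. f m)) \<le> 2 ^ card P * M + 1 * (2 ^ card P * M)"
    by (intro order.trans[OF norm_triangle_ineq4] add_mono IH) (unfold norm_mult, intro mult_mono IH norm1, auto)
  finally show ?case using insert.hyps by (simp add: mult_ac)
qed

text \<open>Primes from 16 on contribute at least 16 each to a divisor of \<open>m\<close>; those
  below 16 are at most 16 in number. Taking square roots gives 4^(card P) <= 2^32 * sqrt m.\<close>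

lemma sixteen_power_card_primes_le:
  fixes m :: nat
  assumes "finite P" "\<And>p. p \<in> P \<Longrightarrow> prime p" "\<And>p. p \<in> P \<Longrightarrow> p dvd m" "m > 0"
  shows "16 ^ card P \<le> 16 ^ 16 * m"
proof -
  define A where "A = {p\<in>P. p < 16}"
  define B where "B = {p\<in>P. p \<ge> 16}"
  have P: "P = A \<union> B" "A \<inter> B = {}" "finite A" "finite B" using assms(1) by (auto simp: A_def B_def)
  have "card A \<le> card {..<16::nat}" by (rule card_mono) (auto simp: A_def)
  hence "(16::nat) ^ card A \<le> 16 ^ 16" by (intro power_increasing) auto
  moreover have "16 ^ card B \<le> m"
  proof -
    have "16 ^ card B \<le> \<Prod>B"
      using prod_mono[of B "\<lambda>_. 16" "\<lambda>p. p"] by (auto simp: B_def)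
    also have "\<dots> \<le> m"
    proof (rule dvd_imp_le[OF _ assms(4)])
      show "\<Prod>B dvd m" by (rule prod_primes_dvd) (use P(4) assms(2,3) in \<open>auto simp: B_def\<close>)
    qed
    finally show ?thesis .
  qed
  ultimately have "(16::nat) ^ card A * 16 ^ card B \<le> 16 ^ 16 * m" by (rule mult_mono) auto
  thus ?thesis using P by (simp add: card_Un_disjoint power_add)
qed

section \<open>Maxima for induced characters\<close>

lemma char_sum_eq: "char_sum \<chi> t = (\<Sum>n\<in>{1..nat \<lfloor>t\<rfloor>}. \<chi> n)"
proof -
  have "1 \<le> n \<and> real n \<le> t \<longleftrightarrow> n \<in> {1..nat \<lfloor>t\<rfloor>}" for n
  proof (cases "t \<ge> 0")
    case True
    hence "n \<le> nat \<lfloor>t\<rfloor> \<longleftrightarrow> real n \<le> t" by (simp add: le_nat_iff le_floor_iff)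
    thus ?thesis by simp
  next
    case False
    hence "\<not> real n \<le> t" "\<lfloor>t\<rfloor> < 0" by linarith+
    thus ?thesis by simp
  qed
  hence "{n. 1 \<le> n \<and> real n \<le> t} = {1..nat \<lfloor>t\<rfloor>}" by blast
  thus ?thesis by (simp only: char_sum_def)
qed

lemma max_char_sum_ge:
  assumes "\<chi> \<in> nonprincipal_chars q"
  shows "norm (\<Sum>n\<in>{1..t}. \<chi> n) \<le> max_char_sum \<chi>"
  unfolding max_char_sum_def char_sum_nat[symmetric]
  by (intro Max_ge finite_range_norm_char_sum[OF assms] rangeI)

lemma max_char_sum_attained:
  assumes "\<chi> \<in> nonprincipal_chars q"
  shows "\<exists>T. max_char_sum \<chi> = norm (\<Sum>n\<in>{1..T}. \<chi> n)"
proof -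
  have "max_char_sum \<chi> \<in> range (\<lambda>t. norm (char_sum \<chi> t))"
    unfolding max_char_sum_def by (intro Max_in finite_range_norm_char_sum[OF assms]) auto
  thus ?thesis unfolding char_sum_eq by auto
qed

lemma max_char_sum_nonneg:
  assumes "\<chi> \<in> nonprincipal_chars q"
  shows "0 \<le> max_char_sum \<chi>"
  using max_char_sum_ge[OF assms, of 0] by simp

text \<open>The values of \<chi> arise from those of \<psi> by sieving with the primes of q that do
  not divide d, all of which divide q/d. The squared factor 4^(card P) is the square root of
  16^(card P), whence \<open>sqrt (real (q div d))\<close>.\<close>

lemma max_char_sum_le_primitive:
  assumes \<chi>: "\<chi> \<in> nonprincipal_chars q"
  shows "\<exists>d \<psi>. d dvd q \<and> primitive_char d \<psi> \<and> \<psi> \<in> nonprincipal_chars d \<and>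
    (\<forall>n. \<chi> n = (if coprime n q then \<psi> n else 0)) \<and>
    max_char_sum \<chi> ^ 2 \<le> 2 ^ 32 * sqrt (real (q div d)) * max_char_sum \<psi> ^ 2"
proof -
  have \<chi>': "dirichlet_char q \<chi>" "\<chi> \<noteq> principal_char q" using \<chi> by (auto simp: nonprincipal_chars_def)
  have q: "q > 0" using dirichlet_char_pos[OF \<chi>'(1)] .
  obtain d \<psi> where d: "d dvd q" "primitive_char d \<psi>" "\<forall>n. \<chi> n = (if coprime n q then \<psi> n else 0)"
    using primitive_char_exists[OF \<chi>'(1)] by blast
  have \<psi>: "dirichlet_char d \<psi>" using d(2) by (simp add: primitive_char_def)
  have cop: "coprime n d" if "coprime n q" for n using that d(1) by (metis coprime_divisors dvd_refl)
  have "\<psi> \<noteq> principal_char d"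
  proof
    assume "\<psi> = principal_char d"
    hence "\<chi> = principal_char q" using d(3) cop by (auto simp: principal_char_def fun_eq_iff)
    thus False using \<chi>' by simp
  qed
  hence np: "\<psi> \<in> nonprincipal_chars d" using \<psi> by (simp add: nonprincipal_chars_def)
  define P where "P = {p \<in> prime_factors q. \<not> p dvd d}"
  have P: "finite P" "\<And>p. p \<in> P \<Longrightarrow> prime p" by (auto simp: P_def)
  have eq: "\<chi> n = (if \<exists>p\<in>P. p dvd n then 0 else \<psi> n)" for n
  proof (cases "coprime n d")
    case False
    hence "\<psi> n = 0" using dirichlet_char_eq_0_iff[OF \<psi>] by blast
    thus ?thesis using d(3) by simp
  next
    case True
    have "coprime n q \<longleftrightarrow> \<not> (\<exists>p\<in>P. p dvd n)"
    proof
      assume "coprime n q"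
      thus "\<not> (\<exists>p\<in>P. p dvd n)" unfolding P_def
        by (metis (no_types, lifting) coprime_common_divisor_nat in_prime_factors_imp_dvd in_prime_factors_imp_prime mem_Collect_eq not_prime_1)
    next
      assume np: "\<not> (\<exists>p\<in>P. p dvd n)"
      show "coprime n q"
      proof (rule ccontr)
        assume "\<not> coprime n q"
        then obtain p where p: "prime p" "p dvd n" "p dvd q"
          by (rule not_coprime_common_prime)
        have "\<not> p dvd d" using True p by (metis coprime_common_divisor_nat not_prime_1)
        hence "p \<in> P" using p q by (simp add: P_def in_prime_factors_iff)
        thus False using np p by blast
      qed
    qed
    thus ?thesis using d(3) by simp
  qed
  obtain T where T: "max_char_sum \<chi> = norm (\<Sum>n\<in>{1..T}. \<chi> n)" using max_char_sum_attained[OF \<chi>] by blast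
  have le: "max_char_sum \<chi> \<le> 2 ^ card P * max_char_sum \<psi>"
    unfolding T eq
    by (rule sifted_char_sum_le[OF dirichlet_char_mult[OF \<psi>] norm_dirichlet_char_le_1[OF \<psi>] P max_char_sum_ge[OF np]])
  have e: "q = d * (q div d)" using d(1) by simp
  have e0: "q div d > 0" using q d(1) by (metis dvd_div_eq_0_iff neq0_conv)
  have "16 ^ card P \<le> 16 ^ 16 * (q div d)"
  proof (rule sixteen_power_card_primes_le[OF P _ e0])
    fix p assume p: "p \<in> P"
    hence "p dvd d * (q div d)" using e by (auto simp: P_def)
    thus "p dvd q div d" using p P(2) by (auto simp: P_def prime_dvd_mult_iff)
  qed
  hence "real (16 ^ card P) \<le> real (16 ^ 16 * (q div d))" by (simp only: of_nat_le_iff)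
  moreover have "real (16 ^ card P) = (4 ^ card P) ^ 2"
    using power_mult_distrib[of "4::real" 4 "card P"] by (simp add: power2_eq_square)
  moreover have "real (16 ^ 16 * (q div d)) = (2 ^ 32 * sqrt (real (q div d))) ^ 2"
    by (simp add: power_mult_distrib)
  ultimately have "(4 ^ card P) ^ 2 \<le> (2 ^ 32 * sqrt (real (q div d))) ^ 2"
    by (simp only:)
  hence four: "4 ^ card P \<le> 2 ^ 32 * sqrt (real (q div d))" by (rule power2_le_imp_le) simp
  have "max_char_sum \<chi> ^ 2 \<le> (2 ^ card P * max_char_sum \<psi>) ^ 2"
    using max_char_sum_nonneg[OF \<chi>] by (intro power_mono le) auto
  also have "\<dots> = 4 ^ card P * max_char_sum \<psi> ^ 2"
    using power_mult_distrib[of "2::real" 2 "card P"] by (simp add: power_mult_distrib power2_eq_square)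
  also have "\<dots> \<le> 2 ^ 32 * sqrt (real (q div d)) * max_char_sum \<psi> ^ 2"
    by (intro mult_right_mono four) auto
  finally show ?thesis using d np by blast
qed

section \<open>Moments over all nonprincipal characters\<close>

text \<open>\<open>T \<chi>\<close> is a length at which the maximum for \<chi> is attained.\<close>

lemma sum_primitive_le:
  fixes k l :: nat
  assumes k: "k \<ge> 3" and l: "k \<le> 2 ^ l"
  shows "\<exists>D. \<forall>q\<ge>D. (\<Sum>\<psi> | primitive_char q \<psi> \<and> \<psi> \<in> nonprincipal_chars q. max_char_sum \<psi> ^ (2 * k))
           \<le> real (totient q) * real q ^ k * (2 ^ 45 * real l ^ 4) ^ k"
proof -
  obtain D where D: "\<And>q T. q \<ge> D \<Longrightarrow> (\<Sum>\<chi> | primitive_char q \<chi>. norm (\<Sum>n\<in>{1..T \<chi>}. \<chi> n) ^ (2 * k))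
           \<le> real (totient q) * real q ^ k * (2 ^ 45 * real l ^ 4) ^ k"
    using primitive_char_sum_moment[OF k l] by blast
  show ?thesis
  proof (intro exI[of _ D] allI impI)
    fix q assume q: "q \<ge> D"
    define T where "T \<chi> = (SOME T. max_char_sum \<chi> = norm (\<Sum>n\<in>{1..T}. \<chi> n))" for \<chi>
    have T: "max_char_sum \<chi> = norm (\<Sum>n\<in>{1..T \<chi>}. \<chi> n)" if "\<chi> \<in> nonprincipal_chars q" for \<chi>
      unfolding T_def by (rule someI_ex) (rule max_char_sum_attained[OF that])
    have "finite {\<chi>. primitive_char q \<chi>}"
      by (rule finite_subset[OF _ finite_dirichlet_chars[of q]]) (auto simp: primitive_char_def)
    hence "(\<Sum>\<psi> | primitive_char q \<psi> \<and> \<psi> \<in> nonprincipal_chars q. max_char_sum \<psi> ^ (2 * k))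
        \<le> (\<Sum>\<chi> | primitive_char q \<chi>. norm (\<Sum>n\<in>{1..T \<chi>}. \<chi> n) ^ (2 * k))"
      by (subst sum.cong[OF refl, of _ _ "\<lambda>\<chi>. norm (\<Sum>n\<in>{1..T \<chi>}. \<chi> n) ^ (2 * k)"])
         (auto simp: T intro!: sum_mono2)
    also have "\<dots> \<le> real (totient q) * real q ^ k * (2 ^ 45 * real l ^ 4) ^ k" by (rule D[OF q])
    finally show "(\<Sum>\<psi> | primitive_char q \<psi> \<and> \<psi> \<in> nonprincipal_chars q. max_char_sum \<psi> ^ (2 * k))
           \<le> real (totient q) * real q ^ k * (2 ^ 45 * real l ^ 4) ^ k" .
  qed
qed

text \<open>A character modulo q is recovered from the primitive character inducing it, so the
  choice function \<open>r\<close> is injective and the sum over all pairs of conductor and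
  primitive character dominates.\<close>

lemma sum_nonprincipal_le_divisor_sum:
  assumes q: "q > 0"
  shows "(\<Sum>\<chi>\<in>nonprincipal_chars q. max_char_sum \<chi> ^ (2 * k)) \<le>
    (\<Sum>d | d dvd q. (2 ^ 32 * sqrt (real (q div d))) ^ k *
       (\<Sum>\<psi> | primitive_char d \<psi> \<and> \<psi> \<in> nonprincipal_chars d. max_char_sum \<psi> ^ (2 * k)))"
proof -
  define P where "P d = {\<psi>. primitive_char d \<psi> \<and> \<psi> \<in> nonprincipal_chars d}" for d
  define R where "R \<chi> p \<longleftrightarrow> fst p dvd q \<and> snd p \<in> P (fst p) \<and>
    (\<forall>n. \<chi> n = (if coprime n q then snd p n else 0)) \<and>
    max_char_sum \<chi> ^ 2 \<le> 2 ^ 32 * sqrt (real (q div fst p)) * max_char_sum (snd p) ^ 2"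
    for \<chi> :: "nat \<Rightarrow> complex" and p :: "nat \<times> (nat \<Rightarrow> complex)"
  define r where "r \<chi> = (SOME p. R \<chi> p)" for \<chi>
  have r: "R \<chi> (r \<chi>)" if \<chi>: "\<chi> \<in> nonprincipal_chars q" for \<chi>
  proof -
    obtain d \<psi> where "d dvd q \<and> primitive_char d \<psi> \<and> \<psi> \<in> nonprincipal_chars d \<and>
        (\<forall>n. \<chi> n = (if coprime n q then \<psi> n else 0)) \<and>
        max_char_sum \<chi> ^ 2 \<le> 2 ^ 32 * sqrt (real (q div d)) * max_char_sum \<psi> ^ 2"
      using max_char_sum_le_primitive[OF \<chi>] by blast
    hence "R \<chi> (d, \<psi>)" unfolding R_def P_def by simp
    hence "\<exists>p. R \<chi> p" by blast
    thus ?thesis unfolding r_def by (rule someI_ex)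
  qed
  define g where "g p = (2 ^ 32 * sqrt (real (q div fst p))) ^ k * max_char_sum (snd p) ^ (2 * k)"
    for p :: "nat \<times> (nat \<Rightarrow> complex)"
  define S where "S = Sigma {d. d dvd q} P"
  have finP: "finite (P d)" for d
    by (rule finite_subset[OF _ finite_nonprincipal_chars[of d]]) (auto simp: P_def)
  have finS: "finite S" unfolding S_def using q finP by (intro finite_SigmaI) auto
  have inj: "inj_on r (nonprincipal_chars q)"
  proof (rule inj_onI)
    fix \<chi> \<chi>' assume a: "\<chi> \<in> nonprincipal_chars q" "\<chi>' \<in> nonprincipal_chars q" "r \<chi> = r \<chi>'"
    have "\<chi> n = \<chi>' n" for n using r[OF a(1)] r[OF a(2)] a(3) unfolding R_def by simp
    thus "\<chi> = \<chi>'" by blast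
  qed
  have "(\<Sum>\<chi>\<in>nonprincipal_chars q. max_char_sum \<chi> ^ (2 * k)) \<le> (\<Sum>\<chi>\<in>nonprincipal_chars q. g (r \<chi>))"
  proof (rule sum_mono)
    fix \<chi> assume \<chi>: "\<chi> \<in> nonprincipal_chars q"
    have "max_char_sum \<chi> ^ (2 * k) = (max_char_sum \<chi> ^ 2) ^ k" by (simp add: power_mult)
    also have "\<dots> \<le> (2 ^ 32 * sqrt (real (q div fst (r \<chi>))) * max_char_sum (snd (r \<chi>)) ^ 2) ^ k"
      using r[OF \<chi>] unfolding R_def by (intro power_mono) auto
    also have "\<dots> = g (r \<chi>)" by (simp only: g_def power_mult_distrib power_mult)
    finally show "max_char_sum \<chi> ^ (2 * k) \<le> g (r \<chi>)" .
  qed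
  also have "\<dots> = (\<Sum>p\<in>r ` nonprincipal_chars q. g p)" by (simp add: sum.reindex[OF inj])
  also have "\<dots> \<le> (\<Sum>p\<in>S. g p)"
  proof (rule sum_mono2[OF finS])
    show "r ` nonprincipal_chars q \<subseteq> S"
    proof
      fix p assume "p \<in> r ` nonprincipal_chars q"
      then obtain \<chi> where "\<chi> \<in> nonprincipal_chars q" "p = r \<chi>" by blast
      hence "fst p \<in> {d. d dvd q}" "snd p \<in> P (fst p)" using r[of \<chi>] by (simp_all add: R_def)
      thus "p \<in> S" unfolding S_def by (metis SigmaI prod.collapse)
    qed
    show "0 \<le> g p" for p unfolding g_def by (simp add: power_mult)
  qed
  also have "\<dots> = (\<Sum>d | d dvd q. \<Sum>\<psi>\<in>P d. g (d, \<psi>))"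
    unfolding S_def using q finP by (subst sum.Sigma) (auto simp: case_prod_unfold)
  also have "\<dots> = (\<Sum>d | d dvd q. (2 ^ 32 * sqrt (real (q div d))) ^ k * (\<Sum>\<psi>\<in>P d. max_char_sum \<psi> ^ (2 * k)))"
    by (simp add: g_def sum_distrib_left)
  finally show ?thesis by (simp add: P_def)
qed

section \<open>Summation over the conductors\<close>

lemma sum_inverse_sqrt_cubed_le:
  assumes "n \<ge> 1"
  shows "(\<Sum>e\<in>{1..n}. (1 / sqrt (real e)) ^ 3) \<le> 3 - 2 / sqrt (real n)"
  using assms
proof (induction n rule: dec_induct)
  case (step n)
  define s where "s = sqrt (real n)"
  define t where "t = sqrt (real (Suc n))"
  have s: "0 < s" "s \<le> t" and t: "0 < t" using step.hyps by (auto simp: s_def t_def)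
  \<comment> \<open>This gives 1/t <= 2 (t - s), so that 1/t^3 is at most the telescoping difference
    2/s - 2/t.\<close>
  have "1 = (t - s) * (t + s)"
    using step.hyps by (simp add: s_def t_def algebra_simps)
  also have "\<dots> \<le> (t - s) * (2 * t)" using s by (intro mult_left_mono) auto
  finally have ts: "1 / t \<le> 2 * (t - s)" using t by (simp add: field_simps)
  have "(1 / t) ^ 3 = (1 / t) / (t * t)" by (simp add: power3_eq_cube)
  also have "\<dots> \<le> (1 / t) / (s * t)" using s t by (intro divide_left_mono mult_right_mono) auto
  also have "\<dots> \<le> (2 * (t - s)) / (s * t)" using s t ts by (intro divide_right_mono) auto
  also have "\<dots> = 2 / s - 2 / t" using s t by (simp add: field_simps)
  finally have "(1 / sqrt (real (Suc n))) ^ 3 \<le> 2 / sqrt (real n) - 2 / sqrt (real (Suc n))"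
    by (simp only: s_def t_def)
  moreover have "(\<Sum>e\<in>{1..Suc n}. (1 / sqrt (real e)) ^ 3) = (\<Sum>e\<in>{1..n}. (1 / sqrt (real e)) ^ 3) + (1 / sqrt (real (Suc n))) ^ 3"
    by simp
  ultimately show ?case using step.IH by linarith
qed simp

text \<open>For q = d e the base is q / sqrt e. Its k-th power is at most q^k e^(-3/2) because k >=
  3, and the sum over e converges.\<close>

lemma divisor_sum_inverse_le:
  assumes q: "q > 0" and k: "k \<ge> 3"
  shows "(\<Sum>d | d dvd q. (sqrt (real (q div d)) * real d) ^ k) \<le> real q ^ k * 3"
proof -
  have "(\<Sum>d | d dvd q. (sqrt (real (q div d)) * real d) ^ k) \<le> (\<Sum>d | d dvd q. real q ^ k * (1 / sqrt (real (q div d))) ^ 3)"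
  proof (rule sum_mono)
    fix d assume "d \<in> {d. d dvd q}"
    hence d: "d dvd q" by simp
    define e where "e = q div d"
    have e: "q = d * e" "e > 0" using d q by (auto simp: e_def dvd_div_eq_0_iff intro!: Nat.gr0I)
    have se: "sqrt (real e) \<ge> 1" using e by simp
    have "sqrt (real e) * real d = real q * (1 / sqrt (real e))"
    proof -
      have "real q * (1 / sqrt (real e)) = real d * (real e / sqrt (real e))" by (simp add: e)
      also have "real e / sqrt (real e) = sqrt (real e)" by (simp add: real_div_sqrt)
      finally show ?thesis by simp
    qed
    hence "(sqrt (real e) * real d) ^ k = real q ^ k * (1 / sqrt (real e)) ^ k"
      by (simp only: power_mult_distrib)
    also have "\<dots> \<le> real q ^ k * (1 / sqrt (real e)) ^ 3"
      using se k by (intro mult_left_mono power_decreasing) auto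
    finally show "(sqrt (real (q div d)) * real d) ^ k \<le> real q ^ k * (1 / sqrt (real (q div d))) ^ 3"
      by (simp only: e_def)
  qed
  also have "\<dots> = real q ^ k * (\<Sum>d | d dvd q. (1 / sqrt (real (q div d))) ^ 3)"
    by (simp only: sum_distrib_left)
  also have "(\<Sum>d | d dvd q. (1 / sqrt (real (q div d))) ^ 3) = (\<Sum>e | e dvd q. (1 / sqrt (real e)) ^ 3)"
    using q by (intro sum.reindex_bij_witness[of _ "\<lambda>d. q div d" "\<lambda>d. q div d"]) auto
  also have "(\<Sum>e | e dvd q. (1 / sqrt (real e)) ^ 3) \<le> 3"
  proof -
    have "(\<Sum>e | e dvd q. (1 / sqrt (real e)) ^ 3) \<le> (\<Sum>e\<in>{1..q}. (1 / sqrt (real e)) ^ 3)"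
      using q by (intro sum_mono2) (auto intro: dvd_imp_le Nat.gr0I simp: Suc_le_eq)
    also have "\<dots> \<le> 3 - 2 / sqrt (real q)" by (rule sum_inverse_sqrt_cubed_le) (use q in simp)
    also have "\<dots> \<le> 3" by simp
    finally show ?thesis .
  qed
  finally show ?thesis by (simp add: mult_left_mono)
qed

text \<open>Conductors beyond the threshold \<open>D\<close> of the primitive moment bound give the
  main term; the smaller ones go into \<epsilon>. The constant is 2^77 = 2^45 * 2^32, the second
  factor coming from the passage to primitive characters.\<close>

lemma moment_max_char_sum:
  fixes k l :: nat
  assumes k: "k \<ge> 3" and l: "k \<le> 2 ^ l"
  shows "\<exists>\<epsilon> :: nat \<Rightarrow> real. \<epsilon> \<longlonglongrightarrow> 0 \<and>
    (\<forall>q\<ge>1. 1 / real (totient q) * (\<Sum>\<chi>\<in>nonprincipal_chars q. max_char_sum \<chi> ^ (2 * k))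
       \<le> ((2 ^ 77 * real l ^ 4) ^ k * 3 + \<epsilon> q) * real q ^ k)"
proof -
  define A where "A d = (\<Sum>\<psi> | primitive_char d \<psi> \<and> \<psi> \<in> nonprincipal_chars d. max_char_sum \<psi> ^ (2 * k))" for d
  define C0 where "C0 = (2 ^ 45 * real l ^ 4) ^ k"
  define Z :: real where "Z = 3"
  obtain D where D: "\<And>d. d \<ge> D \<Longrightarrow> A d \<le> real (totient d) * real d ^ k * C0"
    using sum_primitive_le[OF k l] unfolding A_def C0_def by blast
  have A0: "0 \<le> A d" for d unfolding A_def by (intro sum_nonneg) (simp add: power_mult)
  have C0: "0 \<le> C0" by (simp add: C0_def)
  \<comment> \<open>The finitely many conductors \<open>d < D\<close> contribute only \<open>O(q\<^bsup>k/2\<^esup>)\<close>.\<close>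
  define K where "K = (\<Sum>d<D. A d)"
  have K: "A d \<le> K" if "d < D" for d unfolding K_def using that A0 by (intro member_le_sum) auto
  have K0: "0 \<le> K" unfolding K_def by (intro sum_nonneg A0)
  define \<epsilon> where "\<epsilon> q = (2 ^ 32) ^ k * K * real D * (1 / sqrt (real q)) ^ k" for q :: nat
  have "\<epsilon> \<longlonglongrightarrow> (2 ^ 32) ^ k * K * real D * 0 ^ k"
    unfolding \<epsilon>_def
  proof (intro tendsto_intros)
    show "(\<lambda>q. 1 / sqrt (real q)) \<longlonglongrightarrow> 0" by real_asymp
  qed
  hence lim: "\<epsilon> \<longlonglongrightarrow> 0" using k by (simp add: power_0_left)
  have "1 / real (totient q) * (\<Sum>\<chi>\<in>nonprincipal_chars q. max_char_sum \<chi> ^ (2 * k))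
       \<le> ((2 ^ 77 * real l ^ 4) ^ k * Z + \<epsilon> q) * real q ^ k" if q1: "q \<ge> 1" for q
  proof -
    have q: "q > 0" using q1 by simp
    define \<phi> where "\<phi> = real (totient q)"
    have \<phi>: "\<phi> \<ge> 1" using q by (simp add: \<phi>_def Suc_le_eq)
    have fin: "finite {d. d dvd q}" using q by simp
    define b where "b d = (2 ^ 32) ^ k * sqrt (real (q div d)) ^ k" for d
    have b0: "0 \<le> b d" for d by (simp add: b_def)
    have bq: "b d \<le> (2 ^ 32) ^ k * sqrt (real q) ^ k" for d
      unfolding b_def by (intro mult_left_mono power_mono) auto
    have "(\<Sum>\<chi>\<in>nonprincipal_chars q. max_char_sum \<chi> ^ (2 * k)) \<le> (\<Sum>d | d dvd q. b d * A d)"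
      using sum_nonprincipal_le_divisor_sum[OF q, of k] unfolding A_def b_def power_mult_distrib .
    also have "\<dots> \<le> (\<Sum>d | d dvd q. b d * (\<phi> * real d ^ k * C0) + (if d < D then b d * K else 0))"
    proof (rule sum_mono)
      fix d assume "d \<in> {d. d dvd q}"
      hence d: "d dvd q" by simp
      show "b d * A d \<le> b d * (\<phi> * real d ^ k * C0) + (if d < D then b d * K else 0)"
      proof (cases "d < D")
        case True
        have "b d * A d \<le> b d * K" by (intro mult_left_mono K True b0)
        moreover have "0 \<le> b d * (\<phi> * real d ^ k * C0)" using b0 C0 \<phi> by simp
        ultimately show ?thesis using True by simp
      next
        case False
        \<comment> \<open>This replaces \<phi>(d) by \<phi>(q), which cancels in the mean.\<close>
        have "totient d dvd totient q" using d by (rule totient_dvd)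
        hence "totient d \<le> totient q" using q by (intro dvd_imp_le) auto
        hence "real (totient d) * real d ^ k * C0 \<le> \<phi> * real d ^ k * C0"
          using C0 by (intro mult_right_mono) (auto simp: \<phi>_def)
        hence "A d \<le> \<phi> * real d ^ k * C0" using D[of d] False by simp
        hence "b d * A d \<le> b d * (\<phi> * real d ^ k * C0)" by (intro mult_left_mono b0)
        thus ?thesis using False by simp
      qed
    qed
    also have "\<dots> = \<phi> * (C0 * (\<Sum>d | d dvd q. b d * real d ^ k)) + (\<Sum>d | d dvd q. if d < D then b d * K else 0)"
      by (simp add: sum.distrib sum_distrib_left mult_ac)
    also have "(\<Sum>d | d dvd q. b d * real d ^ k) \<le> (2 ^ 32) ^ k * (real q ^ k * Z)"
    proof -
      have "(\<Sum>d | d dvd q. b d * real d ^ k) = (2 ^ 32) ^ k * (\<Sum>d | d dvd q. (sqrt (real (q div d)) * real d) ^ k)"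
        by (simp only: b_def power_mult_distrib sum_distrib_left mult.assoc)
      also have "\<dots> \<le> (2 ^ 32) ^ k * (real q ^ k * Z)"
        unfolding Z_def by (intro mult_left_mono divisor_sum_inverse_le[OF q k]) auto
      finally show ?thesis .
    qed
    also have "(\<Sum>d | d dvd q. if d < D then b d * K else 0) \<le> real D * ((2 ^ 32) ^ k * sqrt (real q) ^ k * K)"
    proof -
      have "(\<Sum>d | d dvd q. if d < D then b d * K else 0) = (\<Sum>d\<in>{d\<in>{d. d dvd q}. d < D}. b d * K)"
        by (rule sum.inter_filter[OF fin, symmetric])
      also have "\<dots> \<le> (\<Sum>d\<in>{..<D}. (2 ^ 32) ^ k * sqrt (real q) ^ k * K)"
      proof (rule order.trans[OF sum_mono sum_mono2])
        show "b d * K \<le> (2 ^ 32) ^ k * sqrt (real q) ^ k * K" for d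
          by (intro mult_right_mono bq K0)
      qed (use K0 in auto)
      finally show ?thesis by simp
    qed
    finally have main: "(\<Sum>\<chi>\<in>nonprincipal_chars q. max_char_sum \<chi> ^ (2 * k))
        \<le> \<phi> * (C0 * ((2 ^ 32) ^ k * (real q ^ k * Z))) + real D * ((2 ^ 32) ^ k * sqrt (real q) ^ k * K)"
      using C0 \<phi> by (auto intro: mult_left_mono)
    have e: "real D * ((2 ^ 32) ^ k * sqrt (real q) ^ k * K) = \<epsilon> q * real q ^ k"
    proof -
      have "1 / sqrt (real q) * real q = sqrt (real q)" by (simp add: real_div_sqrt)
      hence "sqrt (real q) ^ k = (1 / sqrt (real q)) ^ k * real q ^ k" by (simp only: power_mult_distrib[symmetric])
      thus ?thesis by (simp add: \<epsilon>_def)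
    qed
    have c: "C0 * (2 ^ 32) ^ k = (2 ^ 77 * real l ^ 4) ^ k"
    proof -
      have "C0 * (2 ^ 32) ^ k = ((2 ^ 45 * real l ^ 4) * 2 ^ 32) ^ k" by (simp only: C0_def power_mult_distrib)
      also have "(2 ^ 45 * real l ^ 4) * 2 ^ 32 = 2 ^ 77 * real l ^ 4" by simp
      finally show ?thesis .
    qed
    have "1 / \<phi> * (\<Sum>\<chi>\<in>nonprincipal_chars q. max_char_sum \<chi> ^ (2 * k))
        \<le> 1 / \<phi> * (\<phi> * (C0 * ((2 ^ 32) ^ k * (real q ^ k * Z))) + \<epsilon> q * real q ^ k)"
      using main \<phi> unfolding e by (intro mult_left_mono) auto
    also have "\<dots> = C0 * ((2 ^ 32) ^ k * (real q ^ k * Z)) + 1 / \<phi> * (\<epsilon> q * real q ^ k)"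
      using \<phi> by (simp add: distrib_left)
    also have "1 / \<phi> * (\<epsilon> q * real q ^ k) \<le> 1 * (\<epsilon> q * real q ^ k)"
      using \<phi> K0 by (intro mult_right_mono) (auto simp: \<epsilon>_def)
    also have "C0 * ((2 ^ 32) ^ k * (real q ^ k * Z)) = (C0 * (2 ^ 32) ^ k) * Z * real q ^ k" by (simp only: mult_ac)
    finally show ?thesis unfolding c \<phi>_def by (simp add: distrib_right)
  qed
  thus ?thesis using lim unfolding Z_def by blast
qed

theorem theorem1p1:
  "\<exists>C :: nat \<Rightarrow> real.
     (\<exists>(E :: nat \<Rightarrow> real) (A :: real). \<forall>k\<ge>3.
        \<bar>E k\<bar> \<le> A * real k \<and>
        C k = exp (4 * real k * ln (ln (real k)) + real k * ln (ln (ln (real k))) + E k)) \<and>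
     (\<forall>k\<ge>3. \<exists>\<epsilon> :: nat \<Rightarrow> real. \<epsilon> \<longlonglongrightarrow> 0 \<and>
        (\<forall>q\<ge>1. 1 / real (totient q) * (\<Sum>\<chi>\<in>nonprincipal_chars q. max_char_sum \<chi> ^ (2 * k))
                 \<le> (C k + \<epsilon> q) * real q ^ k))"
proof -
  \<comment> \<open>81 = 3^4 comes from l <= 3 ln k, and the last 3 from 3 <= 3^k.\<close>
  define B :: real where "B = 2 ^ 77 * 81 * 3"
  \<comment> \<open>The required shape of \<open>C\<close> contains ln ln ln k, which is negative
    for small k; subtracting its least value, taken at k = 3, compensates for this.\<close>
  define A where "A = ln B - ln (ln (ln 3))"
  define C where "C k = exp (4 * real k * ln (ln (real k)) + real k * ln (ln (ln (real k))) + A * real k)" for k :: nat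
  have B: "B > 0" by (simp add: B_def)
  \<comment> \<open>This makes ln ln 3 positive, so that the iterated logarithms are increasing from
    k = 3 on.\<close>
  have ln3: "ln (3::real) > 1"
  proof -
    have "exp 1 = exp (1 / 4 :: real) ^ 4" by (simp flip: exp_of_nat_mult)
    also have "\<dots> \<le> (1 + 1 / 4 + (1 / 4) ^ 2) ^ 4" by (intro power_mono exp_bound) auto
    also have "\<dots> < (3::real)" by (simp add: power_divide power4_eq_xxxx power2_eq_square)
    finally have "exp 1 < (3::real)" .
    hence "ln (exp 1) < ln (3::real)" by (subst ln_less_cancel_iff) auto
    thus ?thesis by simp
  qed
  have bound: "(2 ^ 77 * real (nat \<lceil>log 2 (real k)\<rceil>) ^ 4) ^ k * 3 \<le> C k" if k: "k \<ge> 3" for k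
  proof -
    define l where "l = nat \<lceil>log 2 (real k)\<rceil>"
    have lnk: "ln 3 \<le> ln (real k)" using k by (subst ln_le_cancel_iff) auto
    hence lnk1: "ln (real k) > 1" using ln3 by linarith
    have lln: "ln (ln 3) \<le> ln (ln (real k))" using lnk ln3 lnk1 by (subst ln_le_cancel_iff) auto
    have lln3: "0 < ln (ln (3::real))" using ln3 by simp
    have llln: "ln (ln (ln 3)) \<le> ln (ln (ln (real k)))" 
    proof -
      have "0 < ln (ln (real k))" using lln lln3 by linarith
      thus ?thesis using lln lln3 by (simp only: ln_le_cancel_iff)
    qed
    have ll: "real l \<le> 3 * ln (real k)"
    proof -
      have "0 \<le> log 2 (real k)" using k by simp
      hence "real l \<le> log 2 (real k) + 1" unfolding l_def by linarith
      also have "log 2 (real k) \<le> 2 * ln (real k)"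
      proof -
        have "exp (1 / 2 :: real) \<le> 2"
          using exp_bound[of "1 / 2"] by (simp add: power2_eq_square)
        hence "1 / 2 \<le> ln (2::real)" by (subst ln_ge_iff) auto
        hence "1 / ln 2 \<le> (2::real)" by (simp add: field_simps)
        hence "ln (real k) * (1 / ln 2) \<le> ln (real k) * 2" using lnk1 by (intro mult_left_mono) auto
        thus ?thesis by (simp add: log_def)
      qed
      finally show ?thesis using lnk1 by linarith
    qed
    have "(2 ^ 77 * real l ^ 4) ^ k * 3 \<le> (2 ^ 77 * (3 * ln (real k)) ^ 4) ^ k * 3"
      using ll by (intro mult_right_mono power_mono mult_left_mono) auto
    also have "(3::real) \<le> 3 ^ k" using k power_increasing[of 1 k "3::real"] by simp
    hence "(2 ^ 77 * (3 * ln (real k)) ^ 4) ^ k * 3 \<le> (2 ^ 77 * (3 * ln (real k)) ^ 4) ^ k * 3 ^ k"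
      using lnk1 by (intro mult_left_mono) auto
    also have "\<dots> = (B * ln (real k) ^ 4) ^ k"
      unfolding power_mult_distrib[symmetric] B_def by (simp add: power_mult_distrib mult_ac)
    also have "\<dots> = exp (real k * (ln B + 4 * ln (ln (real k))))"
    proof -
      have "B * ln (real k) ^ 4 = exp (ln B + 4 * ln (ln (real k)))"
        using B lnk1 exp_of_nat_mult[of 4 "ln (ln (real k))"] by (simp add: exp_add)
      thus ?thesis by (simp add: exp_of_nat_mult)
    qed
    also have "\<dots> \<le> C k"
    proof -
      have "real k * ln B \<le> real k * (ln (ln (ln (real k))) + A)"
        unfolding A_def using llln by (intro mult_left_mono) auto
      thus ?thesis unfolding C_def by (simp add: algebra_simps)
    qed
    finally show ?thesis by (simp add: l_def)
  qed
  show ?thesis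
  proof (rule exI[of _ C], rule conjI)
    show "\<exists>E A. \<forall>k\<ge>3. \<bar>E k\<bar> \<le> A * real k \<and>
        C k = exp (4 * real k * ln (ln (real k)) + real k * ln (ln (ln (real k))) + E k)"
      by (intro exI[of _ "\<lambda>k. A * real k"] exI[of _ "\<bar>A\<bar>"]) (auto simp: C_def abs_mult)
    show "\<forall>k\<ge>3. \<exists>\<epsilon> :: nat \<Rightarrow> real. \<epsilon> \<longlonglongrightarrow> 0 \<and>
        (\<forall>q\<ge>1. 1 / real (totient q) * (\<Sum>\<chi>\<in>nonprincipal_chars q. max_char_sum \<chi> ^ (2 * k))
                 \<le> (C k + \<epsilon> q) * real q ^ k)"
    proof (intro allI impI)
      fix k :: nat assume k: "k \<ge> 3"
      \<comment> \<open>The least exponent with k <= 2^l, hence of order log k.\<close>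
      define l where "l = nat \<lceil>log 2 (real k)\<rceil>"
      have "log 2 (real k) \<le> real l" unfolding l_def by linarith
      hence "real k \<le> 2 powr real l" using k by (simp add: log_le_iff)
      hence "real k \<le> real (2 ^ l)" by (simp add: powr_realpow)
      hence l: "k \<le> 2 ^ l" by (simp only: of_nat_le_iff)
      obtain \<epsilon> :: "nat \<Rightarrow> real" where \<epsilon>: "\<epsilon> \<longlonglongrightarrow> 0"
        "\<And>q. q \<ge> 1 \<Longrightarrow> 1 / real (totient q) * (\<Sum>\<chi>\<in>nonprincipal_chars q. max_char_sum \<chi> ^ (2 * k))
         \<le> ((2 ^ 77 * real l ^ 4) ^ k * 3 + \<epsilon> q) * real q ^ k"
        using moment_max_char_sum[OF k l] by blast
      have "1 / real (totient q) * (\<Sum>\<chi>\<in>nonprincipal_chars q. max_char_sum \<chi> ^ (2 * k))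
                 \<le> (C k + \<epsilon> q) * real q ^ k" if "q \<ge> 1" for q
        by (rule order.trans[OF \<epsilon>(2)[OF that]], intro mult_right_mono add_right_mono)
           (use bound[OF k] in \<open>simp_all add: l_def\<close>)
      thus "\<exists>\<epsilon> :: nat \<Rightarrow> real. \<epsilon> \<longlonglongrightarrow> 0 \<and>
        (\<forall>q\<ge>1. 1 / real (totient q) * (\<Sum>\<chi>\<in>nonprincipal_chars q. max_char_sum \<chi> ^ (2 * k))
                 \<le> (C k + \<epsilon> q) * real q ^ k)"
        using \<epsilon>(1) by blast
    qed
  qed
qed

end
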